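(* Let $P$ be a (degenerate) Nambu-determinant Poisson bivector on $\mathbb{R}^3$. Consider the graph subcomplex of the Lichnerowicz--Poisson complex restricted to Hamiltonians on $2$ copies of $P$ (the space $\mathcal{H}_{3D}$), vector fields on $3$ copies of $P$ (the space $\mathcal{V}_{3D}$), bivectors on $4$ copies of $P$ and trivectors on $5$ copies of $P$, with differential $d_P=[\![P,\cdot]\!]$. Then the corresponding homogeneous part of the first Lichnerowicz--Poisson cohomology $H^1_{\mathrm{gra}}(\mathbb{R}^3)$ is trivial; that is, every $\vec{Y}\in\mathcal{V}_{3D}$ with $d_P(\vec{Y})=0$ is of the form $\vec{Y}=d_P(H)$ for some $H\in\mathcal{H}_{3D}$.
   Context: $[\![\cdot,\cdot]\!]$ is the Schouten bracket of multivector fields; $d_P=[\![P,\cdot]\!]$. The Nambu-determinant Poisson bivector on $\mathbb{R}^3$ is $P=\tfrac12P^{ij}\partial_i\wedge\partial_j$ with $P^{ij}=\sum_k\varrho\,\varepsilon^{ijk}\,\partial_k a$, i.e. $\{f,g\}=\varrho\cdot\det\big(\partial(f,g,a)/\partial(x^1,x^2,x^3)\big)$, for smooth functions $\varrho$ and $a$ ($a$ is a Casimir). A three-dimensional Nambu micro-graph on $n$ copies of $P$ and at most one sink $0$ is a weakly connected directed graph with $n$ Levi-Civita vertices $1,\dots,n$ and $n$ Casimir vertices $n+1,\dots,2n$, the vertex $n+k$ belonging to the Levi-Civita vertex $k$. Each Levi-Civita vertex $k$ issues three ordered edges to three distinct targets, one of them being its own Casimir vertex $n+k$; the other two targets may be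 any vertices (including $k$ itself, other Casimir vertices, or the sink). Casimir vertices and the sink issue no edges, and the sink, if present, receives exactly one edge. The evaluation $\phi$ sends such a graph to a function (no sink) or a vector field (one sink): decorate the three ordered edges of vertex $k$ with indices $i_{k1},i_{k2},i_{k3}\in\{1,2,3\}$; form $\prod_k\varepsilon^{i_{k1}i_{k2}i_{k3}}$ times the product of $\varrho$ over Levi-Civita vertices and of $a$ over Casimir vertices, each differentiated with respect to $x^i$ for every incoming edge with index $i$, times $\partial_{x^i}$ if the edge with index $i$ enters the sink; sum over all indices. $\mathcal{H}_{3D}$ is the real span of $\phi(\Gamma)$ over such micro-graphs on $2$ copies of $P$ with no sink; $\mathcal{V}_{3D}$ is the real span of $\phi(\Gamma)$ over such micro-graphs on $3$ copies of $P$ with one sink. The functions $\varrho,a$ are treated as arbitrary (generic): elements of these spaces are differential-polynomial expressions in $\varrho,a$ with constant coefficients, and equalities are required to hold identically for all smooth $\varrho,a$. *)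

theory Defs
  imports "HOL-Analysis.Analysis"
begin

type_synonym scalar_field = "real^3 \<Rightarrow> real"

definition partial :: "3 \<Rightarrow> scalar_field \<Rightarrow> scalar_field" where
  "partial i f = (\<lambda>x. frechet_derivative f (at x) (axis i 1))"

definition smooth :: "scalar_field \<Rightarrow> bool" where
  "smooth f \<longleftrightarrow> (\<forall>is. foldr partial is f differentiable_on UNIV)"


text \<open>
  Multivector fields on \<open>\<real>\<^sup>3\<close> are written as polynomials in the anticommuting variables
  \<open>\<xi>\<^sub>i = \<partial>\<^sub>i\<close>: the field \<open>A\<close> stands for the sum of \<open>A S \<cdot> \<xi>\<^sub>S\<close> over all index sets \<open>S\<close>, where
  \<open>\<xi>\<^sub>S\<close> is the wedge product of the \<open>\<xi>\<^sub>i\<close>, \<open>i \<in> S\<close>, in increasing order. In the library's order on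
  type \<open>3\<close> the numeral 3 equals 0, so that \<open>3 < 1 < 2\<close>; the order only fixes the signs of the
  basis elements \<open>\<xi>\<^sub>S\<close>.
\<close>

type_synonym multivector_field = "3 set \<Rightarrow> scalar_field"

definition coord_vector :: "3 \<Rightarrow> multivector_field" where
  "coord_vector i = (\<lambda>S x. if S = {i} then 1 else 0)"

definition wedge :: "multivector_field \<Rightarrow> multivector_field \<Rightarrow> multivector_field" where
  "wedge A B = (\<lambda>S x. \<Sum>T\<in>Pow S.
     (-1) ^ card {(t, u). t \<in> T \<and> u \<in> S - T \<and> u < t} * A T x * B (S - T) x)"

definition xi_left :: "3 \<Rightarrow> multivector_field \<Rightarrow> multivector_field" where
  "xi_left i A = (\<lambda>S x. if i \<in> S then 0 else (-1) ^ card {j \<in> S. j < i} * A (insert i S) x)"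

definition xi_right :: "3 \<Rightarrow> multivector_field \<Rightarrow> multivector_field" where
  "xi_right i A = (\<lambda>S x. if i \<in> S then 0 else (-1) ^ card {j \<in> S. i < j} * A (insert i S) x)"

definition partial_mv :: "3 \<Rightarrow> multivector_field \<Rightarrow> multivector_field" where
  "partial_mv i A = (\<lambda>S. partial i (A S))"

text \<open>
  The Schouten bracket as the odd Poisson bracket of the conjugate variables \<open>x\<^sup>i, \<xi>\<^sub>i\<close>. It is
  normalised so that it gives \<open>X(f)\<close> on a vector field \<open>X\<close> and a function \<open>f\<close>, and the commutator
  on two vector fields.
\<close>

definition schouten :: "multivector_field \<Rightarrow> multivector_field \<Rightarrow> multivector_field" where
  "schouten A B = (\<lambda>S x. \<Sum>i\<in>UNIV.
     wedge (xi_right i A) (partial_mv i B) S x - wedge (partial_mv i A) (xi_left i B) S x)"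


definition levi_civita :: "3 \<Rightarrow> 3 \<Rightarrow> 3 \<Rightarrow> real" where
  "levi_civita i j k =
     (if (i, j, k) \<in> {(1, 2, 3), (2, 3, 1), (3, 1, 2)} then 1
      else if (i, j, k) \<in> {(1, 3, 2), (3, 2, 1), (2, 1, 3)} then -1
      else 0)"

definition nambu_bivector :: "scalar_field \<Rightarrow> scalar_field \<Rightarrow> multivector_field" where
  "nambu_bivector \<rho> a = (\<lambda>S x. 1/2 * (\<Sum>i\<in>UNIV. \<Sum>j\<in>UNIV.
     (\<Sum>k\<in>UNIV. \<rho> x * levi_civita i j k * partial k a x)
     * wedge (coord_vector i) (coord_vector j) S x))"


text \<open>
  A micro-graph on \<open>n\<close> copies has Levi-Civita vertices \<open>1, \<dots>, n\<close>, Casimir vertices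
  \<open>n + 1, \<dots>, 2 n\<close> and, if \<open>sink\<close> holds, the sink \<open>0\<close>. The pair \<open>(k, s)\<close> is the \<open>s\<close>-th edge issued
  by vertex \<open>k\<close>, and the graph is the map that sends each edge to its target.
\<close>

type_synonym micrograph = "nat \<times> 3 \<Rightarrow> nat"

definition mg_vertices :: "nat \<Rightarrow> bool \<Rightarrow> nat set" where
  "mg_vertices n sink = {1..2*n} \<union> (if sink then {0} else {})"

definition mg_edges :: "nat \<Rightarrow> (nat \<times> 3) set" where
  "mg_edges n = {1..n} \<times> UNIV"

definition weakly_connected :: "nat \<Rightarrow> bool \<Rightarrow> micrograph \<Rightarrow> bool" where
  "weakly_connected n sink \<Gamma> \<longleftrightarrow>
     (let A = (\<lambda>e. (fst e, \<Gamma> e)) ` mg_edges n in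
       \<forall>u\<in>mg_vertices n sink. \<forall>v\<in>mg_vertices n sink. (u, v) \<in> (A \<union> A\<inverse>)\<^sup>*)"

definition nambu_micrographs :: "nat \<Rightarrow> bool \<Rightarrow> micrograph set" where
  "nambu_micrographs n sink = {\<Gamma> \<in> mg_edges n \<rightarrow>\<^sub>E mg_vertices n sink.
     (\<forall>k\<in>{1..n}. inj (\<lambda>s. \<Gamma> (k, s)) \<and> (\<exists>s. \<Gamma> (k, s) = n + k)) \<and>
     (sink \<longrightarrow> card {e \<in> mg_edges n. \<Gamma> e = 0} = 1) \<and>
     weakly_connected n sink \<Gamma>}"

text \<open>
  \<open>decorate n \<Gamma> I v f\<close> differentiates the content \<open>f\<close> of vertex \<open>v\<close> once along each incoming edge
  \<open>e\<close>, in the direction of the index \<open>I e\<close>.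
\<close>

definition decorate ::
  "nat \<Rightarrow> micrograph \<Rightarrow> (nat \<times> 3 \<Rightarrow> 3) \<Rightarrow> nat \<Rightarrow> scalar_field \<Rightarrow> scalar_field" where
  "decorate n \<Gamma> I v f =
     foldr (\<lambda>e g. if \<Gamma> e = v then partial (I e) g else g) (List.product [1..<Suc n] [1, 2, 3]) f"

text \<open>
  In \<open>mg_eval\<close> the last factor is the component at \<open>S\<close> of what is placed in the sink: it is the
  vector field \<open>\<partial>\<^sub>i\<close> if an edge with index \<open>i\<close> is the only one to enter the sink, and the constant
  function 1 (a multivector field of degree 0, supported at \<open>S = {}\<close>) if there is no sink.
\<close>

definition mg_eval ::
  "nat \<Rightarrow> micrograph \<Rightarrow> scalar_field \<Rightarrow> scalar_field \<Rightarrow> multivector_field" where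
  "mg_eval n \<Gamma> \<rho> a = (\<lambda>S x. \<Sum>I \<in> mg_edges n \<rightarrow>\<^sub>E (UNIV :: 3 set).
     (\<Prod>k\<in>{1..n}. levi_civita (I (k, 1)) (I (k, 2)) (I (k, 3))
        * decorate n \<Gamma> I k \<rho> x * decorate n \<Gamma> I (n + k) a x)
     * (if S = I ` {e \<in> mg_edges n. \<Gamma> e = 0} then 1 else 0))"

text \<open>
  Differential-polynomial expressions are represented as operators acting on the pair \<open>\<rho>, a\<close>;
  the coefficients of a linear combination do not depend on \<open>\<rho>\<close>, \<open>a\<close> or the point.
\<close>

type_synonym mv_operator = "scalar_field \<Rightarrow> scalar_field \<Rightarrow> multivector_field"

definition mg_span :: "nat \<Rightarrow> bool \<Rightarrow> mv_operator set" where
  "mg_span n sink = {\<lambda>\<rho> a S x. \<Sum>\<Gamma>\<in>F. c \<Gamma> * mg_eval n \<Gamma> \<rho> a S x |F c.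
     finite F \<and> F \<subseteq> nambu_micrographs n sink}"

definition H3D :: "mv_operator set" where
  "H3D = mg_span 2 False"

definition V3D :: "mv_operator set" where
  "V3D = mg_span 3 True"

definition d_P :: "mv_operator \<Rightarrow> mv_operator" where
  "d_P A = (\<lambda>\<rho> a. schouten (nambu_bivector \<rho> a) (A \<rho> a))"

text \<open>Equality of differential-polynomial expressions, tested on smooth arguments only.\<close>

definition generic_eq :: "mv_operator \<Rightarrow> mv_operator \<Rightarrow> bool" where
  "generic_eq A B \<longleftrightarrow> (\<forall>\<rho> a. smooth \<rho> \<longrightarrow> smooth a \<longrightarrow> A \<rho> a = B \<rho> a)"

end

theory Submission
  imports Defs
begin

text \<open>The i-th component of a vector field is its value on the coordinate function x^i. The
  sink can therefore be a letter 0 with content x^i, treated like any other vertex, and a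
  Hamiltonian acquires its new letters by multiplying with one more bracket. The exchange relation
  is where dimension 3 enters: it is Cramer's rule for four vectors.

  The obstacle is to pass from identities for all smooth \<open>\<rho>\<close> and \<open>a\<close>
  to a finite computation. The symbolic reduction is proved for every functional on words that obeys
  the bracket rules. Hence the coordinates of \<open>Y\<close> in the 23 words are fixed before
  \<open>\<rho>\<close>, \<open>a\<close>, the point and the component are chosen, and an equation
  obtained from one polynomial pair at the origin constrains the coefficients that are valid for all
  smooth arguments. The 23 words act as a spanning family; the equations are imposed on one chosen
  coordinate vector, and the solutions are matched with coboundaries coordinate by coordinate. All
  tables hold integers and are verified by evaluation, so the search that produced them does not
  enter the proof.\<close>

text \<open>
  The value of a micro-graph is a product of brackets: a Levi-Civita vertex with targets \<open>u, v, w\<close>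
  acts on the contents of the vertices as the determinant \<open>[u v w]\<close> of their differentiations.
  Brackets are alternating, commute, and satisfy the exchange relation
  \<open>[a b c][d e f] = [d b c][a e f] + [e b c][d a f] + [f b c][d e a]\<close>; moreover the three vertices with
  content \<open>\<rho>\<close> may be permuted, and so may the three with content \<open>a\<close>. These rules express every
  micro-graph with a sink through 23 words. Since \<open>d_P Y\<close> vanishes at the origin for all \<open>\<rho>, a\<close>, in
  particular for sparse polynomials, 19 choices of the latter give 19 independent linear equations
  for the 23 coordinates of a cocycle \<open>Y\<close>. By the Leibniz rule the coboundary of a Hamiltonian \<open>H\<close> on
  two copies is the sum of the words \<open>[0 v 6] H\<close> over the vertices \<open>v\<close> of \<open>H\<close>, and four
  Hamiltonians yield the four remaining dimensions.
\<close>

section \<open>Partial derivatives and jets\<close>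

lemma less_3: "(3::3) < 1" "(1::3) < 2" "(3::3) < 2" "\<not> (1::3) < 3" "\<not> (2::3) < 1" "\<not> (2::3) < 3"
  by (simp_all add: less_bit1_def bit1.Rep_numeral bit1.Rep_1)

lemma neq_3: "(1::3) \<noteq> 2" "(2::3) \<noteq> 1" "(1::3) \<noteq> 3" "(3::3) \<noteq> 1" "(2::3) \<noteq> 3" "(3::3) \<noteq> 2"
  using less_3 by auto

lemma partial_eqI: "(f has_derivative D) (at x) \<Longrightarrow> partial i f x = D (axis i 1)"
  by (simp add: partial_def frechet_derivative_at[symmetric])

lemma has_derivative_frechet: "f differentiable (at x) \<Longrightarrow> (f has_derivative frechet_derivative f (at x)) (at x)"
  by (simp add: frechet_derivative_works)

lemma partial_const [simp]: "partial i (\<lambda>x. c) = (\<lambda>x. 0)"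
  using partial_eqI[OF has_derivative_const] by fastforce

lemma partial_add:
  assumes "f differentiable (at x)" "g differentiable (at x)"
  shows "partial i (\<lambda>x. f x + g x) x = partial i f x + partial i g x"
  using partial_eqI[OF has_derivative_add[OF assms[THEN has_derivative_frechet]]]
  by (simp add: partial_def)

lemma partial_mult:
  assumes "f differentiable (at x)" "g differentiable (at x)"
  shows "partial i (\<lambda>x. f x * g x) x = f x * partial i g x + partial i f x * g x"
  using partial_eqI[OF has_derivative_mult[OF assms[THEN has_derivative_frechet]]]
  by (simp add: partial_def)

lemma partial_cmult:
  assumes "f differentiable (at x)"
  shows "partial i (\<lambda>x. c * f x) x = c * partial i f x"
  using partial_mult[of "\<lambda>_. c" x f i] assms by simp

lemma partial_sum:
  assumes "\<And>s. s \<in> A \<Longrightarrow> f s differentiable (at x)"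
  shows "partial i (\<lambda>x. \<Sum>s\<in>A. f s x) x = (\<Sum>s\<in>A. partial i (f s) x)"
  using partial_eqI[OF has_derivative_sum, of A f "\<lambda>s. frechet_derivative (f s) (at x)" x i]
  using assms by (simp add: partial_def has_derivative_frechet)

section \<open>Smooth functions and the symmetry of mixed derivatives\<close>

lemma smoothD: "smooth f \<Longrightarrow> foldr partial is f differentiable (at x)"
  by (simp add: smooth_def differentiable_on_def)

lemma smooth_differentiable: "smooth f \<Longrightarrow> f differentiable (at x)"
  using smoothD[of f "[]"] by simp

lemma smooth_partial: "smooth f \<Longrightarrow> smooth (partial i f)"
  unfolding smooth_def
proof
  fix js assume "\<forall>is. foldr partial is f differentiable_on UNIV"
  then have "foldr partial (js @ [i]) f differentiable_on UNIV" by blast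
  then show "foldr partial js (partial i f) differentiable_on UNIV" by simp
qed

lemma smooth_foldr_partial: "smooth f \<Longrightarrow> smooth (foldr partial is f)"
  by (induction "is") (auto intro: smooth_partial)

lemma partial_line:
  assumes "smooth f"
  shows "((\<lambda>t. f (x + t *\<^sub>R axis i 1)) has_real_derivative partial i f (x + t *\<^sub>R axis i 1)) (at t)"
proof -
  let ?y = "x + t *\<^sub>R axis i 1"
  have D: "(f has_derivative frechet_derivative f (at ?y)) (at ?y)"
    using assms by (simp add: has_derivative_frechet smooth_differentiable)
  have "((\<lambda>t. x + t *\<^sub>R axis i (1::real)) has_derivative (\<lambda>t. t *\<^sub>R axis i 1)) (at t)"
    by (auto intro!: derivative_eq_intros)
  from diff_chain_at[OF this D]
  have "((\<lambda>t. f (x + t *\<^sub>R axis i 1)) has_derivative (\<lambda>s. frechet_derivative f (at ?y) (s *\<^sub>R axis i 1))) (at t)"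
    by (simp add: o_def)
  moreover have "frechet_derivative f (at ?y) (s *\<^sub>R axis i 1) = partial i f ?y * s" for s
    using has_derivative_linear[OF D] by (simp add: partial_def linear_scale)
  ultimately show ?thesis by (simp add: has_field_derivative_def)
qed

text \<open>
  Schwarz's theorem: by the mean value theorem, applied in one coordinate direction and then in
  the other, a mixed second difference quotient is a value of the mixed derivative nearby.
\<close>

lemma second_difference:
  assumes "smooth f" "h > 0"
  shows "\<exists>s t. 0 < s \<and> s < h \<and> 0 < t \<and> t < h \<and>
    f (x + h *\<^sub>R axis i 1 + h *\<^sub>R axis j 1) - f (x + h *\<^sub>R axis i 1) - f (x + h *\<^sub>R axis j 1) + f x
      = h * h * partial j (partial i f) (x + s *\<^sub>R axis i 1 + t *\<^sub>R axis j 1)"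
proof -
  let ?u = "axis i 1 :: real^3" and ?v = "axis j 1 :: real^3"
  let ?p = "\<lambda>s. f ((x + h *\<^sub>R ?v) + s *\<^sub>R ?u) - f (x + s *\<^sub>R ?u)"
  have "\<exists>s>0. s < h \<and> ?p h - ?p 0 = (h - 0) *
      (partial i f ((x + h *\<^sub>R ?v) + s *\<^sub>R ?u) - partial i f (x + s *\<^sub>R ?u))"
    by (rule MVT2[OF \<open>h > 0\<close>]) (intro DERIV_diff partial_line assms)
  then obtain s where s: "0 < s" "s < h" "?p h - ?p 0 = h *
      (partial i f ((x + h *\<^sub>R ?v) + s *\<^sub>R ?u) - partial i f (x + s *\<^sub>R ?u))" by auto
  let ?q = "\<lambda>t. partial i f ((x + s *\<^sub>R ?u) + t *\<^sub>R ?v)"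
  have "\<exists>t>0. t < h \<and> ?q h - ?q 0 = (h - 0) * partial j (partial i f) ((x + s *\<^sub>R ?u) + t *\<^sub>R ?v)"
    by (rule MVT2[OF \<open>h > 0\<close>]) (intro partial_line smooth_partial assms)
  then obtain t where t: "0 < t" "t < h"
    "?q h - ?q 0 = h * partial j (partial i f) ((x + s *\<^sub>R ?u) + t *\<^sub>R ?v)" by auto
  have "?p h - ?p 0 = h * (?q h - ?q 0)" using s(3) by (simp add: add_ac)
  then have "?p h - ?p 0 = h * h * partial j (partial i f) ((x + s *\<^sub>R ?u) + t *\<^sub>R ?v)"
    by (simp only: t(3) mult.assoc)
  then show ?thesis using s t by (intro exI[of _ s] exI[of _ t]) (simp add: add_ac)
qed

lemma partial_commute:
  assumes "smooth f"
  shows "partial i (partial j f) = partial j (partial i f)"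
proof
  fix x
  let ?A = "partial i (partial j f)" and ?B = "partial j (partial i f)"
  have c: "isCont (partial k (partial l f)) x" for k l
    using assms by (intro differentiable_imp_continuous_within smooth_differentiable smooth_partial)
  show "?A x = ?B x"
  proof (rule ccontr)
    assume "?A x \<noteq> ?B x"
    then have e: "dist (?A x) (?B x) / 2 > 0" (is "?e > 0") by simp
    obtain d1 where d1: "d1 > 0" "\<And>y. dist y x < d1 \<Longrightarrow> dist (?A y) (?A x) < ?e"
      using c[of i j] e unfolding continuous_at_eps_delta by blast
    obtain d2 where d2: "d2 > 0" "\<And>y. dist y x < d2 \<Longrightarrow> dist (?B y) (?B x) < ?e"
      using c[of j i] e unfolding continuous_at_eps_delta by blast
    \<comment> \<open>Both displacements are shorter than \<open>h\<close>, so the points reached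
      lie within \<open>2 * h\<close> of \<open>x\<close>, hence within \<open>d1\<close> and
      \<open>d2\<close>.\<close>
    define h where "h = min d1 d2 / 2"
    have h: "h > 0" "2 * h \<le> d1" "2 * h \<le> d2" using d1 d2 by (auto simp: h_def)
    have near: "dist (x + s *\<^sub>R axis k 1 + t *\<^sub>R axis l 1) x < 2 * h"
      if "0 < s" "s < h" "0 < t" "t < h" for s t and k l :: 3
    proof -
      have "dist (x + s *\<^sub>R axis k 1 + t *\<^sub>R axis l 1) x = norm (s *\<^sub>R axis k 1 + t *\<^sub>R axis l (1::real))"
        by (simp add: dist_norm add.assoc)
      also have "\<dots> \<le> s + t" using that by (intro order_trans[OF norm_triangle_ineq]) simp
      finally show ?thesis using that by linarith
    qed
    obtain s t where 1: "0 < s" "s < h" "0 < t" "t < h"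
      "f (x + h *\<^sub>R axis i 1 + h *\<^sub>R axis j 1) - f (x + h *\<^sub>R axis i 1) - f (x + h *\<^sub>R axis j 1) + f x
        = h * h * ?B (x + s *\<^sub>R axis i 1 + t *\<^sub>R axis j 1)"
      using second_difference[OF assms h(1), of x i j] by blast
    obtain s' t' where 2: "0 < s'" "s' < h" "0 < t'" "t' < h"
      "f (x + h *\<^sub>R axis j 1 + h *\<^sub>R axis i 1) - f (x + h *\<^sub>R axis j 1) - f (x + h *\<^sub>R axis i 1) + f x
        = h * h * ?A (x + s' *\<^sub>R axis j 1 + t' *\<^sub>R axis i 1)"
      using second_difference[OF assms h(1), of x j i] by blast
    \<comment> \<open>The mixed second difference is symmetric in \<open>i\<close> and
      \<open>j\<close>, so a value of one mixed derivative near \<open>x\<close> equals a value of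
      the other near \<open>x\<close>.\<close>
    have "h * h * ?B (x + s *\<^sub>R axis i 1 + t *\<^sub>R axis j 1) = h * h * ?A (x + s' *\<^sub>R axis j 1 + t' *\<^sub>R axis i 1)"
      unfolding 1(5)[symmetric] 2(5)[symmetric] by (simp add: add_ac)
    then have eq: "?B (x + s *\<^sub>R axis i 1 + t *\<^sub>R axis j 1) = ?A (x + s' *\<^sub>R axis j 1 + t' *\<^sub>R axis i 1)"
      using h(1) by simp
    have "dist (?A (x + s' *\<^sub>R axis j 1 + t' *\<^sub>R axis i 1)) (?A x) < ?e"
      using near[OF 2(1-4), of j i] h by (intro d1(2)) linarith
    moreover have "dist (?B (x + s *\<^sub>R axis i 1 + t *\<^sub>R axis j 1)) (?B x) < ?e"
      using near[OF 1(1-4), of i j] h by (intro d2(2)) linarith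
    ultimately have "dist (?A x) (?B x) < ?e + ?e"
      unfolding eq by (meson dist_triangle_less_add dist_commute_lessI)
    then show False by simp
  qed
qed

lemma foldr_partial_mset_cong:
  assumes "smooth f" "mset is = mset js"
  shows "foldr partial is f = foldr partial js f"
  using assms(2)
proof (induction "is" arbitrary: js)
  case (Cons i "is")
  obtain as bs where js: "js = as @ i # bs"
    using Cons.prems by (metis list.set_intros(1) mset_eq_setD split_list)
  have "foldr partial as (partial i (foldr partial bs f)) = partial i (foldr partial as (foldr partial bs f))"
    by (induction as) (simp_all add: partial_commute smooth_foldr_partial assms(1))
  moreover have "foldr partial is f = foldr partial (as @ bs) f"
    using Cons.prems by (intro Cons.IH) (simp add: js)
  ultimately show ?case by (simp add: js)
qed simp

text \<open>Partial derivatives of smooth functions commute, so only the multiset of directions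
  counts; sorting selects one order and makes the notion total.\<close>

definition jet :: "scalar_field \<Rightarrow> 3 multiset \<Rightarrow> scalar_field" where
  "jet f M = foldr partial (sorted_list_of_multiset M) f"

lemma jet_empty [simp]: "jet f {#} = f"
  by (simp add: jet_def)

lemma jet_mset: "smooth f \<Longrightarrow> foldr partial is f = jet f (mset is)"
  unfolding jet_def by (rule foldr_partial_mset_cong) simp_all

lemma partial_jet: "smooth f \<Longrightarrow> partial i (jet f M) = jet f (add_mset i M)"
  using jet_mset[of f "i # sorted_list_of_multiset M"] by (simp add: jet_def)

lemma jet_single: "smooth f \<Longrightarrow> jet f {#i#} = partial i f"
  using jet_mset[of f "[i]"] by simp

lemma smooth_jet: "smooth f \<Longrightarrow> smooth (jet f M)"
  by (simp add: jet_def smooth_foldr_partial)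

lemma jet_differentiable: "smooth f \<Longrightarrow> jet f M differentiable (at x)"
  by (simp add: smooth_differentiable smooth_jet)

lemma differentiable_prod:
  fixes f :: "'b \<Rightarrow> scalar_field"
  assumes "finite V" "\<And>v. v \<in> V \<Longrightarrow> f v differentiable (at x)"
  shows "(\<lambda>x. \<Prod>v\<in>V. f v x) differentiable (at x)"
  using assms by (induction V rule: finite_induct) (simp_all add: differentiable_mult)

lemma partial_prod:
  fixes f :: "'b \<Rightarrow> scalar_field"
  assumes "finite V" "\<And>v. v \<in> V \<Longrightarrow> f v differentiable (at x)"
  shows "partial i (\<lambda>x. \<Prod>v\<in>V. f v x) x = (\<Sum>v\<in>V. \<Prod>u\<in>V. (if u = v then partial i (f u) else f u) x)"
  using assms
proof (induction V rule: finite_induct)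
  case (insert w V)
  have "(\<Sum>v\<in>V. \<Prod>u\<in>insert w V. (if u = v then partial i (f u) else f u) x)
      = f w x * (\<Sum>v\<in>V. \<Prod>u\<in>V. (if u = v then partial i (f u) else f u) x)"
    unfolding sum_distrib_left using insert.hyps by (intro sum.cong) auto
  moreover have "(\<Prod>u\<in>V. (if u = w then partial i (f u) else f u) x) = (\<Prod>u\<in>V. f u x)"
    using insert.hyps by (intro prod.cong) auto
  ultimately show ?case
    using insert by (simp add: partial_mult differentiable_prod)
qed simp

section \<open>Bracket operators\<close>

lemma levi_civita_simps [simp]:
  "levi_civita 1 1 1 = 0" "levi_civita 1 1 2 = 0" "levi_civita 1 1 3 = 0"
  "levi_civita 1 2 1 = 0" "levi_civita 1 2 2 = 0" "levi_civita 1 2 3 = 1"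
  "levi_civita 1 3 1 = 0" "levi_civita 1 3 2 = -1" "levi_civita 1 3 3 = 0"
  "levi_civita 2 1 1 = 0" "levi_civita 2 1 2 = 0" "levi_civita 2 1 3 = -1"
  "levi_civita 2 2 1 = 0" "levi_civita 2 2 2 = 0" "levi_civita 2 2 3 = 0"
  "levi_civita 2 3 1 = 1" "levi_civita 2 3 2 = 0" "levi_civita 2 3 3 = 0"
  "levi_civita 3 1 1 = 0" "levi_civita 3 1 2 = 1" "levi_civita 3 1 3 = 0"
  "levi_civita 3 2 1 = -1" "levi_civita 3 2 2 = 0" "levi_civita 3 2 3 = 0"
  "levi_civita 3 3 1 = 0" "levi_civita 3 3 2 = 0" "levi_civita 3 3 3 = 0"
  by (simp_all add: levi_civita_def neq_3)

lemma levi_civita_cyclic: "levi_civita j k i = levi_civita i j k"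
  using exhaust_3[of i] exhaust_3[of j] exhaust_3[of k] by (elim disjE) simp_all

lemma levi_civita_swap: "levi_civita j i k = - levi_civita i j k"
  using exhaust_3[of i] exhaust_3[of j] exhaust_3[of k] by (elim disjE) simp_all

text \<open>Cramer's rule in dimension 3: the i-th basis vector times det(l, m, n) is a combination
  of the l-th, m-th and n-th ones; the determinant with \<open>j\<close> and \<open>k\<close> in the
  last two places is then applied. The proof runs through all index values.\<close>

lemma levi_civita_exchange:
  "levi_civita i j k * levi_civita l m n =
    levi_civita l j k * levi_civita i m n + levi_civita m j k * levi_civita l i n
    + levi_civita n j k * levi_civita l m i"
proof -
  have "\<forall>i j k l m n. levi_civita i j k * levi_civita l m n =
    levi_civita l j k * levi_civita i m n + levi_civita m j k * levi_civita l i n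
    + levi_civita n j k * levi_civita l m i"
    unfolding forall_3 by simp
  then show ?thesis by blast
qed

section \<open>Iterated brackets acting on functionals of multi-indices\<close>

type_synonym multiindex = "nat \<Rightarrow> 3 multiset"
type_synonym bracket_word = "(nat \<times> nat \<times> nat) list"

definition inc :: "nat \<Rightarrow> 3 \<Rightarrow> multiindex \<Rightarrow> multiindex" where
  "inc v i M = M(v := add_mset i (M v))"

lemma inc_commute: "inc u i (inc v j M) = inc v j (inc u i M)"
  by (auto simp: inc_def add_mset_commute)

lemma inc_apply: "inc v i M u = (if u = v then add_mset i (M u) else M u)"
  by (simp add: inc_def)

text \<open>The multi-index records in which directions each vertex has been differentiated. The
  functional \<open>g\<close> that reads it stays arbitrary, so that jets at a point, the indicator
  at the sink and the polynomial test data share one calculus.\<close>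

fun br :: "bracket_word \<Rightarrow> (multiindex \<Rightarrow> real) \<Rightarrow> multiindex \<Rightarrow> real" where
  "br [] g M = g M"
| "br ((a, b, c) # w) g M =
    (\<Sum>i\<in>UNIV. \<Sum>j\<in>UNIV. \<Sum>k\<in>UNIV. levi_civita i j k * br w g (inc a i (inc b j (inc c k M))))"

text \<open>Increments commute, so one that is present at the start can be moved into the
  functional. This is how a derivative falling on a single vertex is passed through all
  brackets.\<close>

lemma br_inc: "br w g (inc v i M) = br w (\<lambda>N. g (inc v i N)) M"
  by (induction w g M rule: br.induct) (simp_all add: inc_commute[of _ _ v i])

lemma br_scale: "br w (\<lambda>N. c * g N) M = c * br w g M"
  by (induction w g M rule: br.induct) (simp_all add: sum_distrib_left mult.left_commute)

lemma br_add: "br w (\<lambda>N. g N + g' N) M = br w g M + br w g' M"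
  by (induction w g M rule: br.induct) (simp_all add: sum.distrib distrib_left)

lemma br_zero: "br w (\<lambda>N. 0) M = 0"
  using br_scale[of w 0 "\<lambda>_. 0" M] by simp

lemma br_sum: "br w (\<lambda>N. \<Sum>s\<in>A. g s N) M = (\<Sum>s\<in>A. br w (g s) M)"
  by (induction A rule: infinite_finite_induct) (simp_all add: br_add br_zero)

text \<open>A word is a finite linear combination with constant coefficients, hence it commutes with
  partial derivatives in the point \<open>x\<close>.\<close>

lemma partial_br:
  assumes "\<And>M x. (\<lambda>x. g x M) differentiable (at x)"
  shows "(\<lambda>x. br w (g x) M) differentiable (at x)"
    and "partial k (\<lambda>x. br w (g x) M) x = br w (\<lambda>M. partial k (\<lambda>x. g x M) x) M"
proof -
  have "(\<lambda>x. br w (g x) M) differentiable (at x) \<and>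
    partial k (\<lambda>x. br w (g x) M) x = br w (\<lambda>M. partial k (\<lambda>x. g x M) x) M" for M
    by (induction w arbitrary: M)
      (simp_all add: assms partial_sum partial_cmult split_paired_all)
  then show "(\<lambda>x. br w (g x) M) differentiable (at x)"
    "partial k (\<lambda>x. br w (g x) M) x = br w (\<lambda>M. partial k (\<lambda>x. g x M) x) M" by blast+
qed

definition occ :: "bracket_word \<Rightarrow> nat \<Rightarrow> nat" where
  "occ w v = (\<Sum>(a, b, c)\<leftarrow>w. (if a = v then 1 else 0) + (if b = v then 1 else 0) + (if c = v then 1 else 0))"

lemma occ_Nil [simp]: "occ [] v = 0"
  by (simp add: occ_def)

lemma occ_Cons [simp]: "occ ((a, b, c) # w) v =
    (if a = v then 1 else 0) + (if b = v then 1 else 0) + (if c = v then 1 else 0) + occ w v"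
  by (simp add: occ_def)

text \<open>Whatever the summation indices are, letter \<open>v\<close> receives exactly
  \<open>occ w v\<close> increments, so the functional is read only at multi-indices of these
  sizes.\<close>

lemma br_cong:
  assumes "\<And>N. (\<And>v. size (N v) = size (M v) + occ w v) \<Longrightarrow> g N = g' N"
  shows "br w g M = br w g' M"
  using assms
proof (induction w arbitrary: M)
  case (Cons t w)
  obtain a b c where t: "t = (a, b, c)" by (cases t)
  have "br w g (inc a i (inc b j (inc c k M))) = br w g' (inc a i (inc b j (inc c k M)))" for i j k
    by (rule Cons.IH) (auto intro!: Cons.prems simp: t inc_apply)
  then show ?case by (simp add: t)
qed simp

text \<open>Injectivity keeps the increments of different letters apart after renaming.\<close>

lemma br_relabel:
  assumes "inj p"
  shows "br (map (\<lambda>(a, b, c). (p a, p b, p c)) w) (\<lambda>N. g (\<lambda>v. N (p v))) M = br w g (\<lambda>v. M (p v))"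
proof (induction w arbitrary: M)
  case (Cons t w)
  have "(\<lambda>v. inc (p a) i N (p v)) = inc a i (\<lambda>v. N (p v))" for a i N
    using assms by (auto simp: fun_eq_iff inj_eq inc_apply)
  then show ?case by (cases t) (simp add: Cons.IH)
qed simp

text \<open>Merging the six sums into one turns every rearrangement of two brackets into a
  reindexing of a single sum.\<close>

lemma br_pair: "br ((a, b, c) # (d, e, f) # w) g M =
    (\<Sum>(i, j, k, l, m, n)\<in>UNIV. levi_civita i j k * levi_civita l m n *
      br w g (inc a i (inc b j (inc c k (inc d l (inc e m (inc f n M)))))))"
proof -
  have "br ((a, b, c) # (d, e, f) # w) g M =
    (\<Sum>i\<in>UNIV. \<Sum>j\<in>UNIV. \<Sum>k\<in>UNIV. \<Sum>l\<in>UNIV. \<Sum>m\<in>UNIV. \<Sum>n\<in>UNIV. levi_civita i j k * levi_civita l m n *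
      br w g (inc a i (inc b j (inc c k (inc d l (inc e m (inc f n M)))))))"
    by (simp add: sum_distrib_left mult.assoc inc_commute)
  then show ?thesis by (simp add: sum.cartesian_product)
qed

lemma br_swap_brackets: "br (t # u # w) g M = br (u # t # w) g M"
proof -
  obtain a b c d e f where tu: "t = (a, b, c)" "u = (d, e, f)" by (cases t, cases u)
  show ?thesis unfolding tu br_pair
    by (rule sum.reindex_bij_witness[where i="\<lambda>(i, j, k, l, m, n). (l, m, n, i, j, k)"
          and j="\<lambda>(i, j, k, l, m, n). (l, m, n, i, j, k)"])
      (auto simp: inc_commute)
qed

lemma br_Cons_cong:
  assumes "\<And>M. br w g M = br w' g M"
  shows "br (t # w) g M = br (t # w') g M"
  by (cases t) (simp add: assms)

lemma br_mset_cong: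
  assumes "mset w = mset w'"
  shows "br w g M = br w' g M"
  using assms
proof (induction w arbitrary: w' M)
  case (Cons t w)
  have move: "br (as @ t # bs) g M = br (t # as @ bs) g M" for as bs M
  proof (induction as arbitrary: M)
    case (Cons u as)
    have "br (u # (as @ t # bs)) g M = br (u # (t # as @ bs)) g M"
      by (rule br_Cons_cong) (rule Cons.IH)
    also have "\<dots> = br (t # u # as @ bs) g M"
      by (rule br_swap_brackets)
    finally show ?case by (simp only: append_Cons)
  qed (simp only: append_Nil)
  obtain as bs where w': "w' = as @ t # bs"
    using Cons.prems by (metis list.set_intros(1) mset_eq_setD split_list)
  have "br w g M = br (as @ bs) g M" for M
    using Cons.prems by (intro Cons.IH) (simp add: w')
  then show ?case unfolding w' move by (rule br_Cons_cong)
qed simp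

lemma br_triple: "br ((a, b, c) # w) g M =
    (\<Sum>(i, j, k)\<in>UNIV. levi_civita i j k * br w g (inc a i (inc b j (inc c k M))))"
  by (simp add: sum.cartesian_product)

lemma br_cyclic: "br ((b, c, a) # w) g M = br ((a, b, c) # w) g M"
  unfolding br_triple
  by (rule sum.reindex_bij_witness[where i="\<lambda>(i, j, k). (j, k, i)" and j="\<lambda>(j, k, i). (i, j, k)"])
    (auto simp: inc_commute levi_civita_cyclic)

lemma br_swap: "br ((b, a, c) # w) g M = - br ((a, b, c) # w) g M"
  unfolding br_triple sum_negf[symmetric]
proof (rule sum.reindex_bij_witness[where i="\<lambda>(i, j, k). (j, i, k)" and j="\<lambda>(j, i, k). (i, j, k)"])
  fix p :: "3 \<times> 3 \<times> 3"
  obtain j i k where p: "p = (j, i, k)" by (cases p)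
  have "levi_civita j i k = - levi_civita i j k" by (rule levi_civita_swap)
  then show "- (case case p of (j, i, k) \<Rightarrow> (i, j, k) of
        (i, j, k) \<Rightarrow> levi_civita i j k * br w g (inc a i (inc b j (inc c k M))))
      = (case p of (i, j, k) \<Rightarrow> levi_civita i j k * br w g (inc b i (inc a j (inc c k M))))"
    by (simp add: p inc_commute)
qed auto

text \<open>In each of the four sums the index is made to travel with its letter. The multi-indices
  then agree term by term, and the identity of Levi-Civita symbols remains.\<close>

lemma br_exchange:
  "br ((a, b, c) # (d, e, f) # w) g M =
    br ((d, b, c) # (a, e, f) # w) g M + br ((e, b, c) # (d, a, f) # w) g M
    + br ((f, b, c) # (d, e, a) # w) g M"
proof -
  let ?X = "\<lambda>i j k l m n. br w g (inc a i (inc b j (inc c k (inc d l (inc e m (inc f n M))))))"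
  have 1: "br ((d, b, c) # (a, e, f) # w) g M =
      (\<Sum>(i, j, k, l, m, n)\<in>UNIV. levi_civita l j k * levi_civita i m n * ?X i j k l m n)"
    unfolding br_pair
    by (rule sum.reindex_bij_witness[where i="\<lambda>(i, j, k, l, m, n). (l, j, k, i, m, n)"
          and j="\<lambda>(i, j, k, l, m, n). (l, j, k, i, m, n)"])
      (auto simp: inc_commute)
  have 2: "br ((e, b, c) # (d, a, f) # w) g M =
      (\<Sum>(i, j, k, l, m, n)\<in>UNIV. levi_civita m j k * levi_civita l i n * ?X i j k l m n)"
    unfolding br_pair
    by (rule sum.reindex_bij_witness[where i="\<lambda>(i, j, k, l, m, n). (m, j, k, l, i, n)"
          and j="\<lambda>(i, j, k, l, m, n). (m, j, k, l, i, n)"])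
      (auto simp: inc_commute)
  have 3: "br ((f, b, c) # (d, e, a) # w) g M =
      (\<Sum>(i, j, k, l, m, n)\<in>UNIV. levi_civita n j k * levi_civita l m i * ?X i j k l m n)"
    unfolding br_pair
    by (rule sum.reindex_bij_witness[where i="\<lambda>(i, j, k, l, m, n). (n, j, k, l, m, i)"
          and j="\<lambda>(i, j, k, l, m, n). (n, j, k, l, m, i)"])
      (auto simp: inc_commute)
  show ?thesis
    unfolding 1 2 3 unfolding br_pair sum.distrib[symmetric]
    by (rule sum.cong[OF refl], clarify, subst levi_civita_exchange, simp only: prod.case distrib_right)
qed

section \<open>From sums over edge decorations to brackets\<close>

lemma sum_PiE_insert:
  assumes "e \<notin> A"
  shows "(\<Sum>I\<in>insert e A \<rightarrow>\<^sub>E B. \<phi> I) = (\<Sum>y\<in>B. \<Sum>I\<in>A \<rightarrow>\<^sub>E B. \<phi> (I(e := y)))"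
proof -
  have "(\<Sum>I\<in>insert e A \<rightarrow>\<^sub>E B. \<phi> I) = (\<Sum>p\<in>B \<times> (A \<rightarrow>\<^sub>E B). \<phi> ((snd p)(e := fst p)))"
    unfolding PiE_insert_eq using inj_combinator[OF assms, of "\<lambda>_. B"]
    by (subst sum.reindex) (simp_all add: case_prod_unfold)
  then show ?thesis by (simp add: sum.cartesian_product case_prod_unfold)
qed

definition incs :: "micrograph \<Rightarrow> (nat \<times> 3 \<Rightarrow> 3) \<Rightarrow> (nat \<times> 3) list \<Rightarrow> multiindex \<Rightarrow> multiindex" where
  "incs \<Gamma> I es M = foldr (\<lambda>e. inc (\<Gamma> e) (I e)) es M"

lemma incs_apply: "incs \<Gamma> I es M v = mset (map I (filter (\<lambda>e. \<Gamma> e = v) es)) + M v"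
  by (induction es) (auto simp: incs_def inc_apply)

lemma incs_inc: "incs \<Gamma> I es (inc v i M) = inc v i (incs \<Gamma> I es M)"
  by (auto simp: incs_apply inc_apply)

definition mg_word :: "nat list \<Rightarrow> micrograph \<Rightarrow> bracket_word" where
  "mg_word ks \<Gamma> = map (\<lambda>k. (\<Gamma> (k, 1), \<Gamma> (k, 2), \<Gamma> (k, 3))) ks"

text \<open>Induction over the issuing vertices: the three indices of the first vertex are split off
  the decoration, its Levi-Civita factor leaves the product, and its increments join the start
  value. For this reason \<open>M\<close> is arbitrary.\<close>

lemma sum_indices_eq_br:
  assumes "distinct ks"
  shows "(\<Sum>I\<in>set ks \<times> UNIV \<rightarrow>\<^sub>E UNIV. (\<Prod>k\<in>set ks. levi_civita (I (k, 1)) (I (k, 2)) (I (k, 3)))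
      * g (incs \<Gamma> I (List.product ks [1, 2, 3]) M)) = br (mg_word ks \<Gamma>) g M"
  using assms
proof (induction ks arbitrary: M)
  case Nil
  show ?case by (simp add: mg_word_def incs_def)
next
  case (Cons k ks)
  let ?A = "set ks \<times> (UNIV :: 3 set)"
  let ?es = "List.product ks [1, 2, 3 :: 3]"
  have E: "set (k # ks) \<times> UNIV = insert (k, 1) (insert (k, 2) (insert (k, 3) ?A))"
    by (auto simp: UNIV_3)
  have k: "k \<notin> set ks" using Cons.prems by simp
  have I: "(\<Prod>u\<in>set (k # ks). levi_civita ((I((k, 3) := m, (k, 2) := j, (k, 1) := i)) (u, 1))
          ((I((k, 3) := m, (k, 2) := j, (k, 1) := i)) (u, 2)) ((I((k, 3) := m, (k, 2) := j, (k, 1) := i)) (u, 3)))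
        * g (incs \<Gamma> (I((k, 3) := m, (k, 2) := j, (k, 1) := i)) (List.product (k # ks) [1, 2, 3]) M)
      = levi_civita i j m * ((\<Prod>u\<in>set ks. levi_civita (I (u, 1)) (I (u, 2)) (I (u, 3)))
        * g (incs \<Gamma> I ?es (inc (\<Gamma> (k, 1)) i (inc (\<Gamma> (k, 2)) j (inc (\<Gamma> (k, 3)) m M)))))"
    (is "?P * g ?N = _") for I i j m
  proof -
    have 1: "?P = levi_civita i j m * (\<Prod>u\<in>set ks. levi_civita (I (u, 1)) (I (u, 2)) (I (u, 3)))"
      using k by (simp add: neq_3) (intro disjI2 prod.cong refl, auto simp: neq_3)
    have "incs \<Gamma> (I((k, 3) := m, (k, 2) := j, (k, 1) := i)) ?es M = incs \<Gamma> I ?es M" for M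
      unfolding incs_def using k by (intro foldr_cong) (auto simp: neq_3)
    then have 2: "?N = incs \<Gamma> I ?es (inc (\<Gamma> (k, 1)) i (inc (\<Gamma> (k, 2)) j (inc (\<Gamma> (k, 3)) m M)))"
      unfolding incs_inc by (simp add: incs_def neq_3)
    show ?thesis unfolding 1 2 by (simp add: mult.assoc)
  qed
  have "(\<Sum>I\<in>set (k # ks) \<times> UNIV \<rightarrow>\<^sub>E UNIV. (\<Prod>k\<in>set (k # ks). levi_civita (I (k, 1)) (I (k, 2)) (I (k, 3)))
      * g (incs \<Gamma> I (List.product (k # ks) [1, 2, 3]) M))
    = (\<Sum>i\<in>UNIV. \<Sum>j\<in>UNIV. \<Sum>m\<in>UNIV. levi_civita i j m * br (mg_word ks \<Gamma>) g
        (inc (\<Gamma> (k, 1)) i (inc (\<Gamma> (k, 2)) j (inc (\<Gamma> (k, 3)) m M))))"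
    unfolding E using k
    by (subst sum_PiE_insert, force simp: neq_3)+
      (simp only: I sum_distrib_left[symmetric] Cons.IH[OF distinct.simps(2)[THEN iffD1, OF Cons.prems, THEN conjunct2]])
  then show ?case by (simp add: mg_word_def)
qed

lemma decorate_eq_jet:
  assumes "smooth f"
  shows "decorate n \<Gamma> I v f = jet f (incs \<Gamma> I (List.product [1..<Suc n] [1, 2, 3]) (\<lambda>_. {#}) v)"
proof -
  have "foldr (\<lambda>e g. if \<Gamma> e = v then partial (I e) g else g) es f
      = foldr partial (map I (filter (\<lambda>e. \<Gamma> e = v) es)) f" for es
    by (induction es) auto
  then show ?thesis
    unfolding decorate_def incs_apply by (simp only: jet_mset[OF assms] add_0_right)
qed

text \<open>With the sink as letter 0, the set of indices on edges into the sink is the support of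
  \<open>M 0\<close>, which turns the last factor of \<open>mg_eval\<close> into a functional of the
  multi-index.\<close>

lemma mg_eval_eq_br:
  assumes "smooth \<rho>" "smooth a"
  shows "mg_eval n \<Gamma> \<rho> a S x = br (mg_word [1..<Suc n] \<Gamma>)
    (\<lambda>M. (\<Prod>k\<in>{1..n}. jet \<rho> (M k) x * jet a (M (n + k)) x)
      * (if set_mset (M 0) = S then 1 else 0)) (\<lambda>_. {#})"
proof -
  let ?es = "List.product [1..<Suc n] [1, 2, 3 :: 3]"
  have ks: "{1..n} = set [1..<Suc n]" "distinct [1..<Suc n]" by auto
  have es: "mg_edges n = set ?es" by (auto simp: mg_edges_def UNIV_3)
  have "set_mset (incs \<Gamma> I ?es (\<lambda>_. {#}) 0) = I ` {e \<in> mg_edges n. \<Gamma> e = 0}" for I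
    unfolding incs_apply es by simp
  then have "(if S = I ` {e \<in> mg_edges n. \<Gamma> e = 0} then 1 else (0::real))
      = (if set_mset (incs \<Gamma> I ?es (\<lambda>_. {#}) 0) = S then 1 else 0)" for I
    by auto
  then have "mg_eval n \<Gamma> \<rho> a S x = (\<Sum>I \<in> mg_edges n \<rightarrow>\<^sub>E UNIV.
      (\<Prod>k\<in>{1..n}. levi_civita (I (k, 1)) (I (k, 2)) (I (k, 3)))
      * ((\<Prod>k\<in>{1..n}. jet \<rho> (incs \<Gamma> I ?es (\<lambda>_. {#}) k) x * jet a (incs \<Gamma> I ?es (\<lambda>_. {#}) (n + k)) x)
      * (if set_mset (incs \<Gamma> I ?es (\<lambda>_. {#}) 0) = S then 1 else 0)))"
    unfolding mg_eval_def decorate_eq_jet[OF assms(1)] decorate_eq_jet[OF assms(2)]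
    by (simp only: prod.distrib mult.assoc)
  also have "\<dots> = br (mg_word [1..<Suc n] \<Gamma>)
    (\<lambda>M. (\<Prod>k\<in>{1..n}. jet \<rho> (M k) x * jet a (M (n + k)) x)
      * (if set_mset (M 0) = S then 1 else 0)) (\<lambda>_. {#})"
    unfolding mg_edges_def ks(1) by (rule sum_indices_eq_br[OF ks(2)])
  finally show ?thesis .
qed

section \<open>Reduction to a basis\<close>

definition letters :: "(nat \<times> nat \<times> nat) set" where
  "letters = {..6} \<times> {..6} \<times> {..6}"

fun sort3 :: "nat \<times> nat \<times> nat \<Rightarrow> int \<times> nat \<times> nat \<times> nat" where
  "sort3 (a, b, c) =
    (if a = b \<or> b = c \<or> a = c then (0, a, b, c)
     else if a < b then if b < c then (1, a, b, c) else if a < c then (-1, a, c, b) else (1, c, a, b)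
     else if a < c then (-1, b, a, c) else if b < c then (1, b, c, a) else (-1, c, b, a))"

fun triple_less :: "nat \<times> nat \<times> nat \<Rightarrow> nat \<times> nat \<times> nat \<Rightarrow> bool" where
  "triple_less (a, b, c) (d, e, f) \<longleftrightarrow> a < d \<or> a = d \<and> (b < e \<or> b = e \<and> c < f)"

fun word_less :: "bracket_word \<Rightarrow> bracket_word \<Rightarrow> bool" where
  "word_less (t # w) (u # w') \<longleftrightarrow> triple_less t u \<or> t = u \<and> word_less w w'"
| "word_less _ _ \<longleftrightarrow> False"

fun insert_triple :: "nat \<times> nat \<times> nat \<Rightarrow> bracket_word \<Rightarrow> bracket_word" where
  "insert_triple t [] = [t]"
| "insert_triple t (u # w) = (if triple_less t u then t # u # w else u # insert_triple t w)"

fun add_triple :: "int \<times> nat \<times> nat \<times> nat \<Rightarrow> int \<times> bracket_word \<Rightarrow> int \<times> bracket_word" where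
  "add_triple (s, t) (s', w) = (s * s', insert_triple t w)"

fun norm_word :: "bracket_word \<Rightarrow> int \<times> bracket_word" where
  "norm_word [] = (1, [])"
| "norm_word (t # w) = add_triple (sort3 t) (norm_word w)"

fun relabel :: "nat list \<Rightarrow> bracket_word \<Rightarrow> bracket_word" where
  "relabel p [] = []"
| "relabel p ((a, b, c) # w) = (p ! a, p ! b, p ! c) # relabel p w"

text \<open>The 36 permutations that preserve contents: 0 is fixed, the
  \<open>\<rho>\<close>-letters 1, 2, 3 and the \<open>a\<close>-letters 4, 5, 6 are permuted
  separately. Position \<open>v\<close> of a list holds the image of \<open>v\<close>.\<close>

definition letter_perms :: "nat list list" where
  "letter_perms = concat (map (\<lambda>r. map (\<lambda>a. 0 # r @ a)
     [[4, 5, 6], [4, 6, 5], [5, 4, 6], [5, 6, 4], [6, 4, 5], [6, 5, 4]])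
     [[1, 2, 3], [1, 3, 2], [2, 1, 3], [2, 3, 1], [3, 1, 2], [3, 2, 1]])"

fun smaller :: "int \<times> bracket_word \<Rightarrow> int \<times> bracket_word \<Rightarrow> int \<times> bracket_word" where
  "smaller (s, w) (s', w') = (if word_less w w' then (s, w) else (s', w'))"

fun canon_from :: "bracket_word \<Rightarrow> nat list list \<Rightarrow> int \<times> bracket_word \<Rightarrow> int \<times> bracket_word" where
  "canon_from w [] m = m"
| "canon_from w (p # ps) m = canon_from w ps (smaller (norm_word (relabel p w)) m)"

text \<open>A representative of the orbit under relabelling, together with the sign relating it to
  the word; the sign is 0 if a bracket repeats a letter.\<close>

definition canon :: "bracket_word \<Rightarrow> int \<times> bracket_word" where
  "canon w = canon_from w letter_perms (norm_word w)"

fun valid_word :: "bracket_word \<Rightarrow> bool" where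
  "valid_word [] \<longleftrightarrow> True"
| "valid_word ((a, b, c) # w) \<longleftrightarrow> a \<le> 6 \<and> b \<le> 6 \<and> c \<le> 6 \<and> valid_word w"

lemma letters_iff: "w \<in> lists letters \<longleftrightarrow> valid_word w"
  by (induction w rule: valid_word.induct) (auto simp: letters_def)

text \<open>A functional invariant under relabelling takes such a word to its own negative, hence to
  zero.\<close>

definition odd_word :: "bracket_word \<Rightarrow> bool" where
  "odd_word w \<longleftrightarrow> valid_word w \<and> (\<exists>p\<in>set letter_perms. norm_word (relabel p w) = (-1, w))"

fun scale :: "int \<Rightarrow> int \<times> bracket_word \<Rightarrow> int \<times> bracket_word" where
  "scale n (s, w) = (n * s, w)"

fun total :: "(int \<times> bracket_word) list \<Rightarrow> bracket_word \<Rightarrow> int" where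
  "total [] c = 0"
| "total ((n, w) # L) c = (if w = c then n + total L c else total L c)"

text \<open>A sufficient criterion for a formal combination to be zero under all functionals: after
  passing to normal forms, every word either cancels or is odd.\<close>

definition vanishes :: "(int \<times> bracket_word) list \<Rightarrow> bool" where
  "vanishes L = (let L' = map (\<lambda>(n, w). scale n (canon w)) L in \<forall>(n, c)\<in>set L'. total L' c = 0 \<or> odd_word c)"

lemma sum_list_total:
  fixes F :: "bracket_word \<Rightarrow> real"
  assumes "finite A" "snd ` set L \<subseteq> A"
  shows "(\<Sum>(n, w)\<leftarrow>L. of_int n * F w) = (\<Sum>c\<in>A. of_int (total L c) * F c)"
  using assms(2)
proof (induction L)
  case (Cons p L)
  obtain n w where p: "p = (n, w)" by (cases p)
  have "(\<Sum>c\<in>A. of_int (total (p # L) c) * F c)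
      = (\<Sum>c\<in>A. (if c = w then of_int n * F w else 0) + of_int (total L c) * F c)"
    by (intro sum.cong) (auto simp: p algebra_simps)
  also have "\<dots> = of_int n * F w + (\<Sum>c\<in>A. of_int (total L c) * F c)"
    using Cons.prems assms(1) by (simp add: sum.distrib p)
  finally show ?case using Cons by (simp add: p)
qed simp

fun exchange_terms :: "int \<Rightarrow> bracket_word \<Rightarrow> (int \<times> bracket_word) list" where
  "exchange_terms m ((a, b, c) # (d, e, f) # w) =
    [(m, (a, b, c) # (d, e, f) # w), (-m, (d, b, c) # (a, e, f) # w),
     (-m, (e, b, c) # (d, a, f) # w), (-m, (f, b, c) # (d, e, a) # w)]"
| "exchange_terms m _ = []"

definition basis_words :: "bracket_word list" where
  "basis_words =
   [[(0, 4, 5), (1, 4, 6), (4, 5, 6)],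
   [(0, 1, 4), (1, 4, 5), (4, 5, 6)],
   [(0, 4, 5), (1, 4, 5), (1, 4, 6)],
   [(0, 1, 4), (1, 4, 5), (1, 4, 6)],
   [(0, 1, 4), (1, 4, 5), (1, 5, 6)],
   [(0, 1, 4), (2, 4, 5), (4, 5, 6)],
   [(0, 4, 5), (1, 4, 5), (2, 4, 6)],
   [(0, 1, 4), (1, 4, 5), (2, 4, 6)],
   [(0, 1, 4), (2, 4, 5), (2, 4, 6)],
   [(0, 1, 4), (1, 2, 5), (4, 5, 6)],
   [(0, 1, 4), (1, 4, 5), (2, 5, 6)],
   [(0, 1, 4), (2, 4, 5), (2, 5, 6)],
   [(0, 1, 4), (1, 2, 5), (1, 4, 6)],
   [(0, 1, 4), (1, 2, 5), (1, 5, 6)],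
   [(0, 1, 4), (1, 2, 5), (2, 4, 6)],
   [(0, 1, 4), (1, 2, 5), (1, 2, 6)],
   [(0, 1, 4), (2, 4, 5), (3, 4, 6)],
   [(0, 1, 4), (2, 4, 5), (3, 5, 6)],
   [(0, 1, 4), (1, 2, 5), (3, 4, 6)],
   [(0, 1, 4), (1, 2, 5), (3, 5, 6)],
   [(0, 1, 4), (2, 3, 5), (2, 4, 6)],
   [(0, 1, 4), (1, 2, 5), (1, 3, 6)],
   [(0, 1, 4), (1, 2, 5), (2, 3, 6)]]"

text \<open>
  An entry \<open>(c, v, E)\<close> asserts \<open>F c = \<Sum> n F (basis_words ! j)\<close>, summed over \<open>(j, n)\<close> in \<open>v\<close>; it is
  certified by the exchange relations \<open>E\<close>, each with its multiplicity. All entries were found by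
  computer search.
\<close>

definition relations :: "(bracket_word \<times> (nat \<times> int) list \<times> (int \<times> bracket_word) list) list" where
  "relations =
   [([(0, 1, 4), (4, 5, 6), (4, 5, 6)], [(0, 2)],
    [(1, [(0, 4, 5), (1, 4, 6), (4, 5, 6)])]),
   ([(0, 4, 5), (1, 4, 6), (1, 4, 6)], [(1, -1), (2, 1)],
    [(-1, [(0, 1, 4), (4, 5, 6), (1, 4, 5)])]),
   ([(0, 1, 4), (1, 5, 6), (4, 5, 6)], [],
    [(-1, [(0, 1, 4), (4, 5, 6), (1, 5, 6)])]),
   ([(0, 1, 4), (1, 5, 6), (1, 5, 6)], [(4, -2)],
    [(-1, [(0, 1, 4), (1, 5, 6), (1, 4, 5)])]),
   ([(0, 4, 5), (1, 4, 6), (2, 4, 6)], [(5, -1), (6, 1)],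
    [(-1, [(0, 1, 4), (4, 5, 6), (2, 4, 5)])]),
   ([(0, 1, 4), (2, 5, 6), (4, 5, 6)], [],
    [(-1, [(0, 1, 4), (4, 5, 6), (2, 5, 6)])]),
   ([(0, 4, 5), (1, 2, 4), (1, 4, 6)], [(7, -1), (8, 1)],
    [(-1, [(0, 1, 4), (2, 4, 6), (1, 4, 5)])]),
   ([(0, 1, 4), (1, 5, 6), (2, 4, 5)], [(9, -1), (10, 1)],
    [(-1, [(1, 2, 5), (4, 5, 6), (0, 1, 4)])]),
   ([(0, 1, 4), (1, 5, 6), (2, 5, 6)], [(9, 2), (10, -2)],
    [(1, [(0, 1, 4), (1, 2, 5), (4, 5, 6)]), (-1, [(4, 0, 1), (2, 5, 6), (1, 4, 5)])]),
   ([(0, 1, 4), (2, 5, 6), (2, 5, 6)], [(9, -2), (11, -2)],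
    [(-1, [(0, 1, 4), (1, 2, 5), (4, 5, 6)]), (-1, [(4, 0, 1), (2, 5, 6), (2, 4, 5)])]),
   ([(0, 4, 5), (1, 2, 4), (1, 5, 6)], [(9, 1), (10, -1), (11, 1)],
    [(1, [(1, 2, 5), (4, 5, 6), (0, 1, 4)]), (-1, [(0, 1, 4), (2, 4, 5), (1, 5, 6)])]),
   ([(0, 4, 5), (1, 2, 6), (1, 4, 5)], [(9, -2), (10, 2), (11, -2)],
    [(-1, [(0, 1, 4), (1, 2, 5), (4, 5, 6)]), (1, [(1, 4, 0), (2, 5, 6), (1, 4, 5)]), (1, [(2, 5, 6), (0, 1, 4), (1, 4, 5)])]),
   ([(0, 4, 5), (1, 2, 6), (1, 4, 6)], [(9, -2), (10, 1), (11, -1)],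
    [(-1, [(0, 1, 4), (1, 2, 5), (4, 5, 6)]), (1, [(2, 5, 6), (0, 1, 4), (1, 4, 5)])]),
   ([(0, 1, 4), (1, 2, 5), (2, 5, 6)], [(14, 1)],
    [(1, [(0, 1, 4), (1, 2, 5), (2, 4, 6)])]),
   ([(0, 4, 5), (1, 2, 4), (1, 2, 6)], [(14, -2)],
    [(-1, [(0, 1, 4), (2, 4, 6), (1, 2, 5)])]),
   ([(0, 1, 4), (2, 5, 6), (3, 5, 6)], [(17, -2)],
    [(-1, [(0, 1, 4), (3, 5, 6), (2, 4, 5)])]),
   ([(0, 1, 4), (2, 3, 5), (2, 5, 6)], [(18, -1), (19, 1), (20, 1)],
    [(-1, [(0, 1, 4), (1, 2, 5), (3, 4, 6)]), (1, [(0, 1, 4), (2, 3, 5), (2, 4, 6)])]),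
   ([(0, 4, 5), (1, 2, 4), (1, 3, 6)], [(18, -1), (20, 1)],
    [(-1, [(0, 1, 4), (3, 4, 6), (1, 2, 5)])]),
   ([(0, 1, 4), (2, 3, 5), (2, 3, 6)], [(22, -2)],
    [(-1, [(0, 1, 4), (2, 3, 6), (1, 2, 5)])])]"

definition odd_words :: "bracket_word list" where
  "odd_words =
   [[(0, 1, 4), (1, 4, 5), (2, 3, 6)],
   [(0, 1, 4), (1, 5, 6), (2, 3, 5)],
   [(0, 1, 4), (2, 3, 5), (4, 5, 6)],
   [(0, 4, 5), (1, 2, 4), (3, 4, 6)],
   [(0, 4, 5), (1, 2, 4), (3, 5, 6)],
   [(0, 4, 5), (1, 2, 4), (4, 5, 6)],
   [(0, 4, 5), (1, 2, 6), (3, 4, 5)],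
   [(0, 4, 5), (1, 2, 6), (3, 4, 6)],
   [(0, 4, 5), (1, 2, 6), (4, 5, 6)],
   [(0, 4, 5), (1, 4, 5), (4, 5, 6)],
   [(0, 4, 5), (1, 4, 6), (1, 5, 6)],
   [(0, 4, 5), (1, 4, 6), (2, 5, 6)],
   [(0, 4, 5), (4, 5, 6), (4, 5, 6)]]"

definition reductions :: "(bracket_word \<times> (nat \<times> int) list) list" where
  "reductions = zip basis_words (map (\<lambda>j. [(j, 1)]) [0..<23])
    @ map (\<lambda>(c, v, E). (c, v)) relations @ map (\<lambda>c. (c, [])) odd_words"

fun coord :: "(nat \<times> int) list \<Rightarrow> nat \<Rightarrow> int" where
  "coord [] j = 0"
| "coord ((i, n) # v) j = (if j = i then n + coord v j else coord v j)"

text \<open>A normal form missing from the table receives the empty expansion by default; the result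
  is meaningful for \<open>reducible\<close> words, which exclude this case.\<close>

definition expansion :: "bracket_word \<Rightarrow> (nat \<times> int) list" where
  "expansion w = (case canon w of (s, c) \<Rightarrow>
     case map_of reductions c of None \<Rightarrow> [] | Some v \<Rightarrow> map (\<lambda>(j, n). (j, s * n)) v)"

lemma sum_coord:
  fixes f :: "nat \<Rightarrow> real"
  assumes "\<And>p. p \<in> set v \<Longrightarrow> fst p < N"
  shows "(\<Sum>(j, n)\<leftarrow>v. of_int n * f j) = (\<Sum>j<N. of_int (coord v j) * f j)"
  using assms
proof (induction v)
  case (Cons p v)
  obtain i n where p: "p = (i, n)" by (cases p)
  have "(\<Sum>j<N. of_int (coord (p # v) j) * f j)
      = (\<Sum>j<N. (if j = i then of_int n * f i else 0) + of_int (coord v j) * f j)"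
    by (intro sum.cong) (auto simp: p algebra_simps)
  also have "\<dots> = of_int n * f i + (\<Sum>j<N. of_int (coord v j) * f j)"
    using Cons.prems[of p] by (simp add: sum.distrib p)
  finally show ?case using Cons by (simp add: p)
qed simp

definition reducible :: "bracket_word \<Rightarrow> bool" where
  "reducible w \<longleftrightarrow> valid_word w \<and> (case map_of reductions (snd (canon w)) of None \<Rightarrow> False | Some v \<Rightarrow> True)"

lemma odd_words_check: "list_all odd_word odd_words"
  by code_simp

lemma reductions_bound: "list_all (\<lambda>(c, v). list_all (\<lambda>p. fst p < 23) v) reductions"
  by code_simp

lemma expansion_bound: "p \<in> set (expansion w) \<Longrightarrow> fst p < 23"
proof -
  assume p: "p \<in> set (expansion w)"
  obtain s c where c: "canon w = (s, c)" by (cases "canon w")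
  show "fst p < 23"
  proof (cases "map_of reductions c")
    case None
    then show ?thesis using p by (simp add: expansion_def c)
  next
    case (Some v)
    then have "(c, v) \<in> set reductions" by (rule map_of_SomeD)
    then have v: "\<forall>q\<in>set v. fst q < 23" using reductions_bound unfolding list_all_iff by blast
    obtain q where "q \<in> set v" "p = (\<lambda>(j, n). (j, s * n)) q"
      using p Some by (auto simp: expansion_def c)
    then have "fst p = fst q" "fst q < 23" using v by (simp_all add: case_prod_beta)
    then show ?thesis by simp
  qed
qed

text \<open>The certificate of an entry: multiples of exchange relations, each of value zero, are
  added to \<open>c\<close> minus its claimed expansion, and the whole cancels after normalisation.
  The validity check is what permits relabelling of every word involved.\<close>

lemma relations_check:
  "list_all (\<lambda>(c, v, E). let L = (1, c) # map (\<lambda>(j, n). (- n, basis_words ! j)) v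
      @ concat (map (\<lambda>(m, u). exchange_terms m u) E) in
    vanishes L \<and> (\<forall>(n, w)\<in>set L. valid_word w)) relations"
  by code_simp

text \<open>The interface between algebra and analysis: these rules are all that the symbolic
  reduction knows about the value of a word. Relabelling is restricted to words in 0, ..., 6 because
  a permutation is a list of length 7.\<close>

locale bracket_functional =
  fixes F :: "bracket_word \<Rightarrow> real"
  assumes cyclic: "F ((a, b, c) # w) = F ((b, c, a) # w)"
    and swap: "F ((a, b, c) # w) = - F ((b, a, c) # w)"
    and reorder: "mset w = mset w' \<Longrightarrow> F w = F w'"
    and exchange: "F ((a, b, c) # (d, e, f) # w) =
      F ((d, b, c) # (a, e, f) # w) + F ((e, b, c) # (d, a, f) # w) + F ((f, b, c) # (d, e, a) # w)"
    and relabel: "p \<in> set letter_perms \<Longrightarrow> w \<in> lists letters \<Longrightarrow> F (relabel p w) = F w"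
begin

lemma sort3:
  assumes "sort3 t = (s, t')"
  shows "F (t # w) = of_int s * F (t' # w)"
proof -
  obtain a b c where t: "t = (a, b, c)" by (cases t)
  have 1: "F ((a, c, b) # w) = - F ((a, b, c) # w)" for a b c
    using swap[of a c b w] cyclic[of a b c w] cyclic[of b c a w] by simp
  have 2: "F ((c, b, a) # w) = - F ((a, b, c) # w)" for a b c
    using 1[of a b c] cyclic[of a c b w] by simp
  have 0: "F ((a, b, c) # w) = 0" if "a = b \<or> b = c \<or> a = c"
    using that swap[of a a c w] 1[of a c c] 2[of a b a] by auto
  have 3: "F ((a, b, c) # w) = - F ((a, c, b) # w)" "F ((a, b, c) # w) = F ((c, a, b) # w)"
    "F ((a, b, c) # w) = - F ((b, a, c) # w)" "F ((a, b, c) # w) = F ((b, c, a) # w)"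
    "F ((a, b, c) # w) = - F ((c, b, a) # w)"
    using 1[of a b c] 2[of a b c] swap[of a b c w] cyclic[of a b c w] cyclic[of b c a w] by simp_all
  consider "s = 0" "a = b \<or> b = c \<or> a = c" | "s = 1" "t' = (a, b, c)" | "s = -1" "t' = (a, c, b)"
    | "s = 1" "t' = (c, a, b)" | "s = -1" "t' = (b, a, c)" | "s = 1" "t' = (b, c, a)" | "s = -1" "t' = (c, b, a)"
    using assms unfolding t by (auto split: if_splits)
  then show ?thesis
    unfolding t by cases (use 0 3 in simp_all)
qed

text \<open>The prefix \<open>u\<close> collects brackets already passed, so that the induction can
  work behind them; reordering brings the current bracket to the front.\<close>

lemma norm_word:
  assumes "norm_word w = (s, w')"
  shows "F (u @ w) = of_int s * F (u @ w')"
  using assms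
proof (induction w arbitrary: u s w')
  case (Cons t w)
  obtain s1 t1 where t1: "sort3 t = (s1, t1)" by (cases "sort3 t")
  obtain s2 w2 where w2: "norm_word w = (s2, w2)" by (cases "norm_word w")
  have s: "s = s1 * s2" "w' = insert_triple t1 w2" using Cons.prems by (simp_all add: t1 w2)
  have ins: "mset (insert_triple t1 v) = add_mset t1 (mset v)" for v
    by (induction v) auto
  have "F (u @ t # w) = of_int s2 * F (u @ t # w2)"
    using Cons.IH[OF w2, of "u @ [t]"] by simp
  also have "F (u @ t # w2) = F (t # u @ w2)" by (rule reorder) simp
  also have "\<dots> = of_int s1 * F (t1 # u @ w2)" by (rule sort3[OF t1])
  also have "F (t1 # u @ w2) = F (u @ insert_triple t1 w2)" by (rule reorder) (simp add: ins)
  finally show ?case by (simp add: s)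
qed simp

text \<open>The invariant is that the current candidate represents \<open>F w\<close> with its sign.
  Every relabelled normal form does so too, hence the invariant survives whichever of the two is
  kept.\<close>

lemma canon_from:
  assumes "set ps \<subseteq> set letter_perms" "w \<in> lists letters"
    and "F w = of_int (fst m) * F (snd m)" "canon_from w ps m = (s, c)"
  shows "F w = of_int s * F c"
  using assms
proof (induction w ps m rule: canon_from.induct)
  case (2 w p ps m)
  obtain s1 w1 where n: "norm_word (relabel p w) = (s1, w1)" by (cases "norm_word (relabel p w)")
  have "F w = F (relabel p w)" using 2 by (simp add: relabel)
  also have "\<dots> = of_int s1 * F w1" using norm_word[OF n, of "[]"] by simp
  finally have "F w = of_int (fst (smaller (norm_word (relabel p w)) m)) * F (snd (smaller (norm_word (relabel p w)) m))"
    using 2(4) by (cases m) (simp add: n)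
  with 2 show ?case by simp
qed simp

lemma canon:
  assumes "w \<in> lists letters" "canon w = (s, c)"
  shows "F w = of_int s * F c"
proof (rule canon_from[OF order_refl])
  show "F w = of_int (fst (norm_word w)) * F (snd (norm_word w))"
    using norm_word[of w "fst (norm_word w)" "snd (norm_word w)" "[]"] by simp
qed (use assms in \<open>simp_all add: canon_def\<close>)

lemma odd_word:
  assumes "odd_word w"
  shows "F w = 0"
proof -
  obtain p where p: "p \<in> set letter_perms" "norm_word (relabel p w) = (-1, w)"
    using assms by (auto simp: odd_word_def)
  have "F w = F (relabel p w)" using p(1) assms by (simp add: relabel letters_iff odd_word_def)
  also have "\<dots> = - F w" using norm_word[OF p(2), of "[]"] by simp
  finally show ?thesis by simp
qed

lemma combination_zero:
  assumes "vanishes L" "\<forall>(n, w)\<in>set L. w \<in> lists letters"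
  shows "(\<Sum>(n, w)\<leftarrow>L. of_int n * F w) = 0"
proof -
  let ?L = "map (\<lambda>(n, w). scale n (canon w)) L"
  have "(\<Sum>(n, w)\<leftarrow>L. of_int n * F w) = (\<Sum>(n, w)\<leftarrow>?L. of_int n * F w)"
    using assms(2)
  proof (induction L)
    case (Cons p L)
    obtain n w where p: "p = (n, w)" by (cases p)
    obtain s c where c: "canon w = (s, c)" by (cases "canon w")
    show ?case using Cons canon[OF _ c] by (simp add: p c)
  qed simp
  also have "\<dots> = (\<Sum>c\<in>snd ` set ?L. of_int (total ?L c) * F c)"
    by (rule sum_list_total) auto
  also have "\<dots> = 0"
    using assms(1) unfolding vanishes_def by (intro sum.neutral) (auto simp: Let_def case_prod_unfold odd_word)
  finally show ?thesis .
qed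

lemma exchange_terms: "(\<Sum>(n, w)\<leftarrow>exchange_terms m w. of_int n * F w) = 0"
proof (cases "(m, w)" rule: exchange_terms.cases)
  case (1 m a b c d e f w)
  have "F ((a, b, c) # (d, e, f) # w) - F ((d, b, c) # (a, e, f) # w)
      - F ((e, b, c) # (d, a, f) # w) - F ((f, b, c) # (d, e, a) # w) = 0"
    using exchange[of a b c d e f w] by linarith
  then have "of_int m * (F ((a, b, c) # (d, e, f) # w) - F ((d, b, c) # (a, e, f) # w)
      - F ((e, b, c) # (d, a, f) # w) - F ((f, b, c) # (d, e, a) # w)) = 0"
    by (simp only: mult_zero_right)
  then show ?thesis using 1 by (simp add: algebra_simps)
qed simp_all

lemma sum_list_exchange:
  "(\<Sum>(n, w)\<leftarrow>concat (map (\<lambda>(m, u). exchange_terms m u) E). of_int n * F w) = 0"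
  by (induction E) (auto simp: exchange_terms simp del: exchange_terms.simps)

lemma relation:
  assumes "vanishes ((1, c) # map (\<lambda>(j, n). (- n, basis_words ! j)) v @ concat (map (\<lambda>(m, u). exchange_terms m u) E))"
    and "\<forall>(n, w)\<in>set ((1 :: int, c) # map (\<lambda>(j, n). (- n, basis_words ! j)) v @ concat (map (\<lambda>(m, u). exchange_terms m u) E)).
      w \<in> lists letters"
  shows "F c = (\<Sum>(j, n)\<leftarrow>v. of_int n * F (basis_words ! j))"
proof -
  have "(\<Sum>(n, w)\<leftarrow>map (\<lambda>(j, n). (- n, basis_words ! j)) v. of_int n * F w)
      = - (\<Sum>(j, n)\<leftarrow>v. of_int n * F (basis_words ! j))"
    by (induction v) auto
  then show ?thesis
    using combination_zero[OF assms] by (simp add: sum_list_exchange)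
qed

lemma reductions:
  assumes "map_of reductions c = Some v"
  shows "F c = (\<Sum>(j, n)\<leftarrow>v. of_int n * F (basis_words ! j))"
proof -
  have "(c, v) \<in> set reductions" using assms by (rule map_of_SomeD)
  then consider j where "j < length basis_words" "c = basis_words ! j" "v = [(j, 1)]"
    | "c \<in> set odd_words" "v = []" | E where "(c, v, E) \<in> set relations"
    by (fastforce simp: reductions_def in_set_zip)
  then show ?thesis
  proof cases
    case 2
    then show ?thesis using odd_word[of c] odd_words_check by (auto simp: list_all_iff)
  next
    case 3
    then show ?thesis using relation[of c v E] relations_check
      by (auto simp: list_all_iff letters_iff)
  qed simp
qed

lemma expansion:
  assumes "reducible w"
  shows "F w = (\<Sum>(j, n)\<leftarrow>expansion w. of_int n * F (basis_words ! j))"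
proof -
  obtain s c where c: "canon w = (s, c)" by (cases "canon w")
  obtain v where v: "map_of reductions c = Some v"
    using assms by (auto simp: reducible_def c split: option.splits)
  have "F w = of_int s * F c"
    using assms c by (intro canon) (auto simp: reducible_def letters_iff)
  also have "\<dots> = (\<Sum>(j, n)\<leftarrow>map (\<lambda>(j, n). (j, s * n)) v. of_int n * F (basis_words ! j))"
    unfolding reductions[OF v] by (induction v) (auto simp: distrib_left)
  finally show ?thesis by (simp add: expansion_def c v)
qed

end

text \<open>The 500 words in which each bracket ends with its own Casimir letter, the sink lies in
  the bracket of Casimir 4, and the remaining pairs are increasing. Every micro-graph with a sink is
  brought to one of them by the bracket symmetries.\<close>

definition sink_first_words :: "bracket_word list" where
  "sink_first_words = concat (map (\<lambda>y. concat (map (\<lambda>(u, v). map (\<lambda>(u', v'). [(0, y, 4), (u, v, 5), (u', v', 6)])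
      [(1, 2), (1, 3), (1, 4), (1, 5), (2, 3), (2, 4), (2, 5), (3, 4), (3, 5), (4, 5)])
      [(1, 2), (1, 3), (1, 4), (1, 6), (2, 3), (2, 4), (2, 6), (3, 4), (3, 6), (4, 6)])) [1, 2, 3, 5, 6])"

fun canon_in :: "bracket_word list \<Rightarrow> bracket_word list \<Rightarrow> bool" where
  "canon_in [] cs \<longleftrightarrow> True"
| "canon_in (w # ws) cs \<longleftrightarrow> snd (canon w) \<in> set cs \<and> canon_in ws cs"

lemma sink_first_words_check: "canon_in sink_first_words (map fst reductions)"
  by code_simp

lemma sink_first_words_valid: "list_all valid_word sink_first_words"
  by code_simp

section \<open>Micro-graphs with a sink\<close>

text \<open>The argument \<open>h\<close> fills the sink. Taking x^i for it extracts the i-th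
  component of the vector field.\<close>

definition contents :: "scalar_field \<Rightarrow> scalar_field \<Rightarrow> scalar_field \<Rightarrow> nat \<Rightarrow> scalar_field" where
  "contents h \<rho> a v = (if v = 0 then h else if v \<le> 3 then \<rho> else a)"

definition jet_product :: "scalar_field \<Rightarrow> scalar_field \<Rightarrow> scalar_field \<Rightarrow> real^3 \<Rightarrow> multiindex \<Rightarrow> real" where
  "jet_product h \<rho> a x M = (\<Prod>v\<le>6. jet (contents h \<rho> a v) (M v) x)"

definition bracket_op :: "bracket_word \<Rightarrow> scalar_field \<Rightarrow> scalar_field \<Rightarrow> scalar_field \<Rightarrow> scalar_field" where
  "bracket_op w h \<rho> a x = br w (jet_product h \<rho> a x) (\<lambda>_. {#})"

lemma letter_perms_check:
  "list_all (\<lambda>p. length p = 7 \<and> distinct p \<and> list_all (\<lambda>v. p ! v \<le> 6 \<and> (v = 0 \<longleftrightarrow> p ! v = 0) \<and> (v \<le> 3 \<longleftrightarrow> p ! v \<le> 3)) [0..<7])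
    letter_perms"
  by code_simp

text \<open>Relabelling is the one rule that involves the contents: the permutations in
  \<open>letter_perms\<close> exchange only letters that carry the same function.\<close>

lemma bracket_functional_bracket_op: "bracket_functional (\<lambda>w. bracket_op w h \<rho> a x)"
proof
  fix w w' :: bracket_word and a' b c d e f :: nat and p
  show "bracket_op ((a', b, c) # w) h \<rho> a x = bracket_op ((b, c, a') # w) h \<rho> a x"
    by (simp only: bracket_op_def br_cyclic)
  show "bracket_op ((a', b, c) # w) h \<rho> a x = - bracket_op ((b, a', c) # w) h \<rho> a x"
    unfolding bracket_op_def by (rule br_swap)
  show "bracket_op ((a', b, c) # (d, e, f) # w) h \<rho> a x = bracket_op ((d, b, c) # (a', e, f) # w) h \<rho> a x
      + bracket_op ((e, b, c) # (d, a', f) # w) h \<rho> a x + bracket_op ((f, b, c) # (d, e, a') # w) h \<rho> a x"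
    unfolding bracket_op_def by (rule br_exchange)
  show "bracket_op w h \<rho> a x = bracket_op w' h \<rho> a x" if "mset w = mset w'"
    unfolding bracket_op_def by (rule br_mset_cong[OF that])
  assume p: "p \<in> set letter_perms" and w: "w \<in> lists letters"
  have len: "length p = 7" "distinct p"
    and pv: "\<And>v. v < 7 \<Longrightarrow> p ! v \<le> 6 \<and> (v = 0 \<longleftrightarrow> p ! v = 0) \<and> (v \<le> 3 \<longleftrightarrow> p ! v \<le> 3)"
    using p letter_perms_check by (auto simp: list_all_iff)
  \<comment> \<open>The list \<open>p\<close> is extended by the identity beyond 6, which gives an
    injection on all naturals as \<open>br_relabel\<close> requires.\<close>
  define q where "q v = (if v \<le> 6 then p ! v else v)" for v
  have inj: "inj q"
  proof
    fix u v assume "q u = q v"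
    then show "u = v"
      using pv[of u] pv[of v] len nth_eq_iff_index_eq[of p u v] by (auto simp: q_def split: if_splits)
  qed
  have "q ` {..6} \<subseteq> {..6}" using pv by (auto simp: q_def)
  then have bij: "bij_betw q {..6} {..6}"
    using inj by (metis bij_betw_def card_image card_subset_eq finite_atMost inj_on_subset subset_UNIV)
  have q: "contents h \<rho> a (q v) = contents h \<rho> a v" if "v \<le> 6" for v
    using pv[of v] that by (auto simp: contents_def q_def)
  have "jet_product h \<rho> a x M = jet_product h \<rho> a x (\<lambda>v. M (q v))" for M
    unfolding jet_product_def
    by (subst prod.reindex_bij_betw[OF bij, symmetric]) (simp add: q)
  then have j: "jet_product h \<rho> a x = (\<lambda>M. jet_product h \<rho> a x (\<lambda>v. M (q v)))" by blast
  have "relabel p w = map (\<lambda>(a, b, c). (q a, q b, q c)) w"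
    using w
  proof (induction w)
    case (Cons t w)
    then show ?case by (cases t) (auto simp: letters_def q_def)
  qed simp
  then show "bracket_op (relabel p w) h \<rho> a x = bracket_op w h \<rho> a x"
    unfolding bracket_op_def using br_relabel[OF inj, of w "jet_product h \<rho> a x" "\<lambda>_. {#}"]
    by (simp add: j[symmetric])
qed

section \<open>Coordinate functions as content of the sink\<close>

definition coordinate :: "3 \<Rightarrow> scalar_field" where
  "coordinate i = (\<lambda>x. x $ i)"

lemma partial_coordinate: "partial j (coordinate i) = (\<lambda>x. if i = j then 1 else 0)"
proof
  fix x :: "real^3"
  have "((\<lambda>x. x $ i) has_derivative (\<lambda>x. x $ i)) (at x)"
    by (rule bounded_linear_imp_has_derivative) (rule bounded_linear_vec_nth)
  from partial_eqI[OF this] show "partial j (coordinate i) x = (if i = j then 1 else 0)"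
    by (simp add: coordinate_def axis_def)
qed

lemma foldr_partial_const: "foldr partial is (\<lambda>x. c) = (\<lambda>x. if is = [] then c else 0)"
  by (induction "is") auto

lemma smooth_const: "smooth (\<lambda>x. c)"
  by (simp add: smooth_def foldr_partial_const)

lemma smooth_partialI:
  assumes "\<And>x. f differentiable (at x)" "\<And>i. smooth (partial i f)"
  shows "smooth f"
  unfolding smooth_def
proof
  fix js
  show "foldr partial js f differentiable_on UNIV"
  proof (cases js rule: rev_cases)
    case Nil
    then show ?thesis using assms(1) by (simp add: differentiable_on_def differentiable_at_withinI)
  next
    case (snoc ks i)
    then show ?thesis using assms(2)[of i] by (simp add: smooth_def)
  qed
qed

lemma smooth_coordinate: "smooth (coordinate i)"
proof (rule smooth_partialI)
  show "coordinate i differentiable (at x)" for x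
    unfolding coordinate_def by (rule bounded_linear_imp_differentiable) (rule bounded_linear_vec_nth)
qed (simp add: partial_coordinate smooth_const)

lemma occ_mg_word:
  assumes "distinct ks"
  shows "occ (mg_word ks \<Gamma>) v = card {e \<in> set ks \<times> UNIV. \<Gamma> e = v}"
proof -
  have "card {e \<in> set ks \<times> UNIV. \<Gamma> e = v} = (\<Sum>e\<in>set ks \<times> UNIV. if \<Gamma> e = v then 1 else 0)"
    by (simp add: sum.If_cases Int_def)
  also have "\<dots> = (\<Sum>k\<in>set ks. \<Sum>s\<in>UNIV. if \<Gamma> (k, s) = v then 1 else 0)"
    by (simp add: sum.cartesian_product case_prod_unfold)
  also have "\<dots> = (\<Sum>k\<leftarrow>ks. \<Sum>s\<in>UNIV. if \<Gamma> (k, s) = v then 1 else 0)"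
    using assms by (simp add: sum_list_distinct_conv_sum_set)
  finally show ?thesis
    by (simp add: occ_def mg_word_def sum_3 o_def)
qed

text \<open>Exactly one edge enters the sink, say with index j. Then the indicator of {j} = {i} in
  \<open>mg_eval\<close> is the derivative of x^i in direction j, which is the factor contributed by
  \<open>coordinate i\<close>.\<close>

lemma mg_eval_sink:
  assumes "smooth \<rho>" "smooth a" and sink: "occ (mg_word [1..<Suc 3] \<Gamma>) 0 = 1"
  shows "mg_eval 3 \<Gamma> \<rho> a {i} x = bracket_op (mg_word [1..<Suc 3] \<Gamma>) (coordinate i) \<rho> a x"
    and "(\<And>i. S \<noteq> {i}) \<Longrightarrow> mg_eval 3 \<Gamma> \<rho> a S x = 0"
proof -
  have single: "\<exists>j. N 0 = {#j#}" if "size (N 0) = size ({#} :: 3 multiset) + occ (mg_word [1..<Suc 3] \<Gamma>) 0" for N :: multiindex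
    using that sink by (simp add: size_1_singleton_mset)
  have P: "(\<Prod>k\<in>{1..3}. f k * g (3 + k)) = f 1 * f 2 * f 3 * g 4 * g 5 * g (6 :: nat)" for f g :: "nat \<Rightarrow> real"
  proof -
    have "{1..3 :: nat} = {1, 2, 3}" by auto
    then show ?thesis by (simp add: mult_ac)
  qed
  have Q: "{..6 :: nat} = {0, 1, 2, 3, 4, 5, 6}" by auto
  show "mg_eval 3 \<Gamma> \<rho> a {i} x = bracket_op (mg_word [1..<Suc 3] \<Gamma>) (coordinate i) \<rho> a x"
    unfolding mg_eval_eq_br[OF assms(1,2)] bracket_op_def
  proof (rule br_cong)
    fix N :: multiindex
    assume "\<And>v. size (N v) = size ({#} :: 3 multiset) + occ (mg_word [1..<Suc 3] \<Gamma>) v"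
    then obtain j where j: "N 0 = {#j#}" using single by blast
    show "(\<Prod>k\<in>{1..3}. jet \<rho> (N k) x * jet a (N (3 + k)) x) * (if set_mset (N 0) = {i} then 1 else 0)
        = jet_product (coordinate i) \<rho> a x N"
      unfolding P[of "\<lambda>k. jet \<rho> (N k) x" "\<lambda>k. jet a (N k) x"] jet_product_def Q
      by (cases "i = j") (simp_all add: contents_def j jet_single smooth_coordinate partial_coordinate mult_ac)
  qed
  show "mg_eval 3 \<Gamma> \<rho> a S x = 0" if S: "\<And>i. S \<noteq> {i}"
  proof -
    have "mg_eval 3 \<Gamma> \<rho> a S x = br (mg_word [1..<Suc 3] \<Gamma>) (\<lambda>M. 0) (\<lambda>_. {#})"
      unfolding mg_eval_eq_br[OF assms(1,2)]
    proof (rule br_cong)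
      fix N :: multiindex
      assume "\<And>v. size (N v) = size ({#} :: 3 multiset) + occ (mg_word [1..<Suc 3] \<Gamma>) v"
      then obtain j where j: "N 0 = {#j#}" using single by blast
      show "(\<Prod>k\<in>{1..3}. jet \<rho> (N k) x * jet a (N (3 + k)) x) * (if set_mset (N 0) = S then 1 else 0) = 0"
        using S[of j] by (auto simp: j)
    qed
    then show ?thesis by (simp add: br_zero)
  qed
qed

text \<open>The order of quantifiers matters: one coordinate vector serves all functionals, hence
  all \<open>\<rho>\<close>, \<open>a\<close>, points and components at once, as constant
  coefficients demand.\<close>

definition reduces :: "bracket_word \<Rightarrow> bool" where
  "reduces w \<longleftrightarrow> (\<exists>v :: nat \<Rightarrow> real. \<forall>F. bracket_functional F \<longrightarrow> F w = (\<Sum>j<23. v j * F (basis_words ! j)))"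

lemma reduces_scale:
  assumes "reduces w'" "\<And>F. bracket_functional F \<Longrightarrow> F w = c * F w'"
  shows "reduces w"
proof -
  obtain v :: "nat \<Rightarrow> real" where v: "\<forall>F. bracket_functional F \<longrightarrow> F w' = (\<Sum>j<23. v j * F (basis_words ! j))"
    using assms(1) unfolding reduces_def by blast
  have "F w = (\<Sum>j<23. (c * v j) * F (basis_words ! j))" if F: "bracket_functional F" for F
    unfolding assms(2)[OF F] v[rule_format, OF F] by (simp only: sum_distrib_left mult.assoc)
  then show ?thesis unfolding reduces_def by (intro exI[of _ "\<lambda>j. c * v j"]) simp
qed

lemma reduces_reorder:
  assumes "reduces w'" "mset w = mset w'"
  shows "reduces w"
proof (rule reduces_scale[OF assms(1)])
  show "F w = 1 * F w'" if "bracket_functional F" for F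
    using bracket_functional.reorder[OF that assms(2)] by (simp only: mult_1)
qed

lemma reduces_swap:
  assumes "reduces ((b, a, c) # w)"
  shows "reduces ((a, b, c) # w)"
proof (rule reduces_scale[OF assms])
  show "F ((a, b, c) # w) = - 1 * F ((b, a, c) # w)" if "bracket_functional F" for F
    using bracket_functional.swap[OF that, of a b c w] by (simp only: mult_minus1)
qed

lemma reduces_cyclic:
  assumes "reduces ((b, c, a) # w)"
  shows "reduces ((a, b, c) # w)"
proof (rule reduces_scale[OF assms])
  show "F ((a, b, c) # w) = 1 * F ((b, c, a) # w)" if "bracket_functional F" for F
    using bracket_functional.cyclic[OF that, of a b c w] by (simp only: mult_1)
qed

lemma reduces_relabel:
  assumes "reduces (relabel p w)" "p \<in> set letter_perms" "valid_word w"
  shows "reduces w"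
proof (rule reduces_scale[OF assms(1)])
  show "F w = 1 * F (relabel p w)" if "bracket_functional F" for F
    using bracket_functional.relabel[OF that assms(2), of w] assms(3) by (simp only: letters_iff mult_1)
qed

lemma reduces_reducible:
  assumes "reducible w"
  shows "reduces w"
  unfolding reduces_def
proof (intro exI allI impI)
  show "F w = (\<Sum>j<23. real_of_int (coord (expansion w) j) * F (basis_words ! j))" if "bracket_functional F" for F
    unfolding bracket_functional.expansion[OF that assms]
    by (rule sum_coord) (rule expansion_bound)
qed

lemma canon_in_iff: "canon_in ws cs \<longleftrightarrow> (\<forall>w\<in>set ws. snd (canon w) \<in> set cs)"
  by (induction ws) simp_all

lemma reduces_sink_first_words:
  assumes "w \<in> set sink_first_words"
  shows "reduces w"
proof (rule reduces_reducible)
  have "snd (canon w) \<in> set (map fst reductions)"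
    by (rule sink_first_words_check[unfolded canon_in_iff, rule_format, OF assms])
  then have "map_of reductions (snd (canon w)) \<noteq> None"
    unfolding map_of_eq_None_iff by (simp only: set_map not_not)
  then obtain v where v: "map_of reductions (snd (canon w)) = Some v" by (rule not_None_eq[THEN iffD1, THEN exE])
  have "valid_word w" using sink_first_words_valid assms unfolding list_all_iff by (rule bspec)
  then show "reducible w"
    unfolding reducible_def v by (simp only: option.case simp_thms)
qed

lemma reduces_swap2:
  assumes "reduces (t # (b, a, c) # w)"
  shows "reduces (t # (a, b, c) # w)"
proof -
  have "reduces ((b, a, c) # t # w)" using assms by (rule reduces_reorder) simp
  then have "reduces ((a, b, c) # t # w)" by (rule reduces_swap)
  then show ?thesis by (rule reduces_reorder) simp
qed

lemma reduces_swap3: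
  assumes "reduces (t # u # (b, a, c) # w)"
  shows "reduces (t # u # (a, b, c) # w)"
proof -
  have "reduces ((b, a, c) # t # u # w)" using assms by (rule reduces_reorder) simp
  then have "reduces ((a, b, c) # t # u # w)" by (rule reduces_swap)
  then show ?thesis by (rule reduces_reorder) simp
qed

text \<open>Swapping the pair in the second or third bracket costs only a sign, so both pairs may be
  made increasing, as in the enumerated words.\<close>

lemma reduces_sink_first:
  assumes "y \<in> {1, 2, 3, 5, 6}" "u \<noteq> v" "u \<in> {1, 2, 3, 4, 6}" "v \<in> {1, 2, 3, 4, 6}"
    "u' \<noteq> v'" "u' \<in> {1, 2, 3, 4, 5}" "v' \<in> {1, 2, 3, 4, 5}"
  shows "reduces [(0, y, 4), (u, v, 5), (u', v', 6)]"
proof -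
  \<comment> \<open>Stated for arbitrary lists \<open>P\<close>, \<open>P'\<close>,
    \<open>Y\<close>, membership follows from the shape of the enumeration and the 500 words stay
    folded.\<close>
  have mem: "[(0, y, 4), (u, v, 5), (u', v', 6)] \<in> set (concat (map (\<lambda>y. concat (map (\<lambda>(u, v).
      map (\<lambda>(u', v'). [(0, y, 4), (u, v, 5), (u', v', 6)]) P') P)) Y))"
    if "(u, v) \<in> set P" "(u', v') \<in> set P'" "y \<in> set Y" for u v u' v' P P' Y
  proof -
    have "[(0, y, 4), (u, v, 5), (u', v', 6)] \<in> set (map (\<lambda>(u', v'). [(0, y, 4), (u, v, 5), (u', v', 6)]) P')"
      unfolding set_map by (rule rev_image_eqI[OF that(2)]) simp
    then have "[(0, y, 4), (u, v, 5), (u', v', 6)] \<in> set (concat (map (\<lambda>(u, v).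
        map (\<lambda>(u', v'). [(0, y, 4), (u, v, 5), (u', v', 6)]) P') P))"
      unfolding set_concat set_map[of _ P] by (intro UnionI[OF imageI[OF imageI[OF that(1)]]]) simp
    then show ?thesis
      unfolding set_concat set_map[of _ Y] by (intro UnionI[OF imageI[OF imageI[OF that(3)]]]) simp
  qed
  have sorted: "reduces [(0, y, 4), (u, v, 5), (u', v', 6)]"
    if "u < v" "u \<in> {1, 2, 3, 4, 6}" "v \<in> {1, 2, 3, 4, 6}"
      "u' < v'" "u' \<in> {1, 2, 3, 4, 5}" "v' \<in> {1, 2, 3, 4, 5}" for u v u' v' :: nat
  proof (rule reduces_sink_first_words)
    have "(u, v) \<in> set [(1, 2), (1, 3), (1, 4), (1, 6), (2, 3), (2, 4), (2, 6), (3, 4), (3, 6), (4, 6)]"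
      using that(1-3) unfolding insert_iff empty_iff by (elim disjE) simp_all
    moreover have "(u', v') \<in> set [(1, 2), (1, 3), (1, 4), (1, 5), (2, 3), (2, 4), (2, 5), (3, 4), (3, 5), (4, 5)]"
      using that(4-6) unfolding insert_iff empty_iff by (elim disjE) simp_all
    moreover have "y \<in> set [1, 2, 3, 5, 6]" using assms(1) by auto
    ultimately show "[(0, y, 4), (u, v, 5), (u', v', 6)] \<in> set sink_first_words"
      unfolding sink_first_words_def by (intro mem)
  qed
  have half: "reduces [(0, y, 4), (u, v, 5), (u', v', 6)]"
    if "u' < v'" "u' \<in> {1, 2, 3, 4, 5}" "v' \<in> {1, 2, 3, 4, 5}" for u' v' :: nat
  proof (cases "u < v")
    case True
    then show ?thesis by (rule sorted[OF _ assms(3,4) that])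
  next
    case False
    with assms(2) have "v < u" by simp
    show ?thesis by (rule reduces_swap2, rule sorted[OF \<open>v < u\<close> assms(4,3) that])
  qed
  show ?thesis
  proof (cases "u' < v'")
    case True
    then show ?thesis by (rule half[OF _ assms(6,7)])
  next
    case False
    with assms(5) have "v' < u'" by simp
    show ?thesis by (rule reduces_swap3, rule half[OF \<open>v' < u'\<close> assms(7,6)])
  qed
qed

lemma reduces_sink_in_first:
  assumes "x = 0 \<and> y \<in> {1, 2, 3, 5, 6} \<or> y = 0 \<and> x \<in> {1, 2, 3, 5, 6}"
    "u \<noteq> v" "u \<in> {1, 2, 3, 4, 6}" "v \<in> {1, 2, 3, 4, 6}"
    "u' \<noteq> v'" "u' \<in> {1, 2, 3, 4, 5}" "v' \<in> {1, 2, 3, 4, 5}"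
  shows "reduces [(x, y, 4), (u, v, 5), (u', v', 6)]"
  using assms(1)
proof
  assume "x = 0 \<and> y \<in> {1, 2, 3, 5, 6}"
  then have "x = 0" and y: "y \<in> {1, 2, 3, 5, 6}" by blast+
  then show ?thesis using reduces_sink_first[OF y assms(2-)] by simp
next
  assume "y = 0 \<and> x \<in> {1, 2, 3, 5, 6}"
  then have "y = 0" and x: "x \<in> {1, 2, 3, 5, 6}" by blast+
  then show ?thesis using reduces_sink_first[OF x assms(2-)] by (simp add: reduces_swap)
qed

lemma le_6_cases: "(v :: nat) \<le> 6 \<longleftrightarrow> v \<in> {0, 1, 2, 3, 4, 5, 6}"
  by auto

lemma nonzero_letter:
  assumes "v \<le> 6" "v \<noteq> (0 :: nat)"
  shows "v \<noteq> 4 \<Longrightarrow> v \<in> {1, 2, 3, 5, 6}" "v \<noteq> 5 \<Longrightarrow> v \<in> {1, 2, 3, 4, 6}" "v \<noteq> 6 \<Longrightarrow> v \<in> {1, 2, 3, 4, 5}"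
  using assms unfolding le_6_cases by auto

lemma reduces_sink_in_first':
  assumes "x = 0 \<and> y \<noteq> 0 \<or> y = 0 \<and> x \<noteq> 0" "x \<le> 6" "y \<le> 6" "x \<noteq> 4" "y \<noteq> 4"
    and "u \<noteq> v" "u \<noteq> 0" "v \<noteq> 0" "u \<le> 6" "v \<le> 6" "u \<noteq> 5" "v \<noteq> 5"
    and "u' \<noteq> v'" "u' \<noteq> 0" "v' \<noteq> 0" "u' \<le> 6" "v' \<le> 6" "u' \<noteq> 6" "v' \<noteq> 6"
  shows "reduces [(x, y, 4), (u, v, 5), (u', v', 6)]"
proof (rule reduces_sink_in_first)
  show "x = 0 \<and> y \<in> {1, 2, 3, 5, 6} \<or> y = 0 \<and> x \<in> {1, 2, 3, 5, 6}"
    using assms(1-5) nonzero_letter(1)[of x] nonzero_letter(1)[of y] by argo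
qed (use assms(6-) nonzero_letter in simp_all)

lemma swap_casimirs:
  assumes "v \<le> 6"
  shows "[0, 1, 2, 3, 5, 4, 6] ! v \<le> (6 :: nat)" "[0, 1, 2, 3, 5, 4, 6] ! v = (0 :: nat) \<longleftrightarrow> v = 0"
    "[0, 1, 2, 3, 5, 4, 6] ! v = (4 :: nat) \<longleftrightarrow> v = 5" "[0, 1, 2, 3, 5, 4, 6] ! v = (5 :: nat) \<longleftrightarrow> v = 4"
    "[0, 1, 2, 3, 5, 4, 6] ! v = (6 :: nat) \<longleftrightarrow> v = 6"
    "[0, 1, 2, 3, 6, 5, 4] ! v \<le> (6 :: nat)" "[0, 1, 2, 3, 6, 5, 4] ! v = (0 :: nat) \<longleftrightarrow> v = 0"
    "[0, 1, 2, 3, 6, 5, 4] ! v = (4 :: nat) \<longleftrightarrow> v = 6" "[0, 1, 2, 3, 6, 5, 4] ! v = (5 :: nat) \<longleftrightarrow> v = 5"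
    "[0, 1, 2, 3, 6, 5, 4] ! v = (6 :: nat) \<longleftrightarrow> v = 4"
  using assms unfolding le_6_cases insert_iff empty_iff by (elim disjE; simp)+

lemma swap_casimirs_inj:
  assumes "u \<le> 6" "v \<le> 6"
  shows "[0, 1, 2, 3, 5, 4, 6] ! u = ([0, 1, 2, 3, 5, 4, 6] ! v :: nat) \<longleftrightarrow> u = v"
    "[0, 1, 2, 3, 6, 5, 4] ! u = ([0, 1, 2, 3, 6, 5, 4] ! v :: nat) \<longleftrightarrow> u = v"
  using assms by (simp_all add: nth_eq_iff_index_eq)

text \<open>Exactly one bracket contains the sink. A word does not record which vertex issued a
  bracket, so exchanging Casimir 4 with 5 or 6 and reordering the brackets moves that bracket to the
  front without touching the letters 1, 2, 3.\<close>

lemma reduces_canonical: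
  assumes "x1 \<noteq> y1" "x1 \<le> 6" "y1 \<le> 6" "x1 \<noteq> 4" "y1 \<noteq> 4"
    and "x2 \<noteq> y2" "x2 \<le> 6" "y2 \<le> 6" "x2 \<noteq> 5" "y2 \<noteq> 5"
    and "x3 \<noteq> y3" "x3 \<le> 6" "y3 \<le> 6" "x3 \<noteq> 6" "y3 \<noteq> 6"
    and occ: "occ [(x1, y1, 4), (x2, y2, 5), (x3, y3, 6)] 0 = 1"
  shows "reduces [(x1, y1, 4), (x2, y2, 5), (x3, y3, 6)]"
proof -
  have s2: "[0, 1, 2, 3, 5, 4, 6] \<in> set letter_perms" and s3: "[0, 1, 2, 3, 6, 5, 4] \<in> set letter_perms"
    by (simp_all add: letter_perms_def)
  consider "x1 = 0 \<and> y1 \<noteq> 0 \<or> y1 = 0 \<and> x1 \<noteq> 0" "x2 \<noteq> 0" "y2 \<noteq> 0" "x3 \<noteq> 0" "y3 \<noteq> 0"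
    | "x2 = 0 \<and> y2 \<noteq> 0 \<or> y2 = 0 \<and> x2 \<noteq> 0" "x1 \<noteq> 0" "y1 \<noteq> 0" "x3 \<noteq> 0" "y3 \<noteq> 0"
    | "x3 = 0 \<and> y3 \<noteq> 0 \<or> y3 = 0 \<and> x3 \<noteq> 0" "x1 \<noteq> 0" "y1 \<noteq> 0" "x2 \<noteq> 0" "y2 \<noteq> 0"
    using occ by (simp split: if_splits)
  then show ?thesis
  proof cases
    case 1
    with assms(1-15) show ?thesis by (intro reduces_sink_in_first')
  next
    case 2
    let ?p = "\<lambda>v. [0, 1, 2, 3, 5, 4, 6] ! v :: nat"
    have "reduces [(?p x2, ?p y2, 4), (?p x1, ?p y1, 5), (?p x3, ?p y3, 6)]"
      by (rule reduces_sink_in_first'; (simp only: swap_casimirs swap_casimirs_inj assms(1-15) 2 not_False_eq_True simp_thms)?)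
    then have "reduces (relabel [0, 1, 2, 3, 5, 4, 6] [(x2, y2, 5), (x1, y1, 4), (x3, y3, 6)])"
      by simp
    then have "reduces [(x2, y2, 5), (x1, y1, 4), (x3, y3, 6)]"
      by (rule reduces_relabel[OF _ s2]) (simp add: assms(1-15))
    then show ?thesis by (rule reduces_reorder) simp
  next
    case 3
    let ?p = "\<lambda>v. [0, 1, 2, 3, 6, 5, 4] ! v :: nat"
    have "reduces [(?p x3, ?p y3, 4), (?p x2, ?p y2, 5), (?p x1, ?p y1, 6)]"
      by (rule reduces_sink_in_first'; (simp only: swap_casimirs swap_casimirs_inj assms(1-15) 3 not_False_eq_True simp_thms)?)
    then have "reduces (relabel [0, 1, 2, 3, 6, 5, 4] [(x3, y3, 6), (x2, y2, 5), (x1, y1, 4)])"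
      by simp
    then have "reduces [(x3, y3, 6), (x2, y2, 5), (x1, y1, 4)]"
      by (rule reduces_relabel[OF _ s3]) (simp add: assms(1-15))
    then show ?thesis by (rule reduces_reorder) simp
  qed
qed

text \<open>A cyclic rotation is even and leaves the value unchanged. The conclusions hold for every
  continuation \<open>w\<close>, so that they can be used on each bracket in turn.\<close>

lemma own_casimir_last:
  assumes "p \<noteq> q" "q \<noteq> r" "p \<noteq> r" "c \<in> {p, q, r}"
  obtains x y where "x \<noteq> y" "x \<noteq> c" "y \<noteq> c" "x \<in> {p, q, r}" "y \<in> {p, q, r}"
    "\<And>w. reduces ((x, y, c) # w) \<Longrightarrow> reduces ((p, q, r) # w)"
    "\<And>w v. occ ((x, y, c) # w) v = occ ((p, q, r) # w) v"
proof -
  consider "c = r" | "c = q" | "c = p" using assms(4) by auto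
  then show thesis
  proof cases
    case 1
    then show thesis using assms by (intro that[of p q]) auto
  next
    case 2
    then show thesis using assms by (intro that[of r p]) (auto intro: reduces_cyclic)
  next
    case 3
    then show thesis using assms by (intro that[of q r]) (auto intro: reduces_cyclic)
  qed
qed

lemma nambu_micrograph_word:
  assumes "\<Gamma> \<in> nambu_micrographs 3 True"
  shows "reduces (mg_word [1..<Suc 3] \<Gamma>)" and "occ (mg_word [1..<Suc 3] \<Gamma>) 0 = 1"
proof -
  have set3: "set [1..<Suc 3] = {1..3}" "[1..<Suc 3] = [1, 2, 3 :: nat]" by (auto simp: upt_rec)
  show occ: "occ (mg_word [1..<Suc 3] \<Gamma>) 0 = 1"
  proof -
    have "card {e \<in> {1..3} \<times> UNIV. \<Gamma> e = 0} = 1"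
      using assms unfolding nambu_micrographs_def mg_edges_def by blast
    then show ?thesis
      unfolding occ_mg_word[OF distinct_upt] set3(1) .
  qed
  have \<Gamma>: "\<Gamma> \<in> mg_edges 3 \<rightarrow>\<^sub>E mg_vertices 3 True"
    "\<And>k. k \<in> {1..3} \<Longrightarrow> inj (\<lambda>s. \<Gamma> (k, s))" "\<And>k. k \<in> {1..3} \<Longrightarrow> \<exists>s. \<Gamma> (k, s) = 3 + k"
    using assms unfolding nambu_micrographs_def by blast+
  have bound: "\<Gamma> (k, s) \<le> 6" if "k \<in> {1..3}" for k s
  proof -
    have "(k, s) \<in> mg_edges 3" using that unfolding mg_edges_def by blast
    from PiE_mem[OF \<Gamma>(1) this] show ?thesis unfolding mg_vertices_def by auto
  qed
  have dist: "\<Gamma> (k, 1) \<noteq> \<Gamma> (k, 2) \<and> \<Gamma> (k, 2) \<noteq> \<Gamma> (k, 3) \<and> \<Gamma> (k, 1) \<noteq> \<Gamma> (k, 3)" if "k \<in> {1..3}" for k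
    using inj_eq[OF \<Gamma>(2)[OF that]] by (simp add: neq_3)
  have own: "3 + k \<in> {\<Gamma> (k, 1), \<Gamma> (k, 2), \<Gamma> (k, 3)}" if k: "k \<in> {1..3}" for k
  proof -
    obtain s where s: "\<Gamma> (k, s) = 3 + k" using \<Gamma>(3)[OF k] by blast
    show ?thesis using exhaust_3[of s] unfolding s[symmetric] by blast
  qed
  obtain x1 y1 where 1: "x1 \<noteq> y1" "x1 \<noteq> 3 + 1" "y1 \<noteq> 3 + 1"
    "x1 \<in> {\<Gamma> (1, 1), \<Gamma> (1, 2), \<Gamma> (1, 3)}" "y1 \<in> {\<Gamma> (1, 1), \<Gamma> (1, 2), \<Gamma> (1, 3)}"
    "\<And>w. reduces ((x1, y1, 3 + 1) # w) \<Longrightarrow> reduces ((\<Gamma> (1, 1), \<Gamma> (1, 2), \<Gamma> (1, 3)) # w)"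
    "\<And>w v. occ ((x1, y1, 3 + 1) # w) v = occ ((\<Gamma> (1, 1), \<Gamma> (1, 2), \<Gamma> (1, 3)) # w) v"
    by (rule own_casimir_last[OF dist[of 1, THEN conjunct1] dist[of 1, THEN conjunct2, THEN conjunct1]
          dist[of 1, THEN conjunct2, THEN conjunct2] own[of 1]]) (simp, simp, simp, simp, rule that)
  obtain x2 y2 where 2: "x2 \<noteq> y2" "x2 \<noteq> 3 + 2" "y2 \<noteq> 3 + 2"
    "x2 \<in> {\<Gamma> (2, 1), \<Gamma> (2, 2), \<Gamma> (2, 3)}" "y2 \<in> {\<Gamma> (2, 1), \<Gamma> (2, 2), \<Gamma> (2, 3)}"
    "\<And>w. reduces ((x2, y2, 3 + 2) # w) \<Longrightarrow> reduces ((\<Gamma> (2, 1), \<Gamma> (2, 2), \<Gamma> (2, 3)) # w)"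
    "\<And>w v. occ ((x2, y2, 3 + 2) # w) v = occ ((\<Gamma> (2, 1), \<Gamma> (2, 2), \<Gamma> (2, 3)) # w) v"
    by (rule own_casimir_last[OF dist[of 2, THEN conjunct1] dist[of 2, THEN conjunct2, THEN conjunct1]
          dist[of 2, THEN conjunct2, THEN conjunct2] own[of 2]]) (simp, simp, simp, simp, rule that)
  obtain x3 y3 where 3: "x3 \<noteq> y3" "x3 \<noteq> 3 + 3" "y3 \<noteq> 3 + 3"
    "x3 \<in> {\<Gamma> (3, 1), \<Gamma> (3, 2), \<Gamma> (3, 3)}" "y3 \<in> {\<Gamma> (3, 1), \<Gamma> (3, 2), \<Gamma> (3, 3)}"
    "\<And>w. reduces ((x3, y3, 3 + 3) # w) \<Longrightarrow> reduces ((\<Gamma> (3, 1), \<Gamma> (3, 2), \<Gamma> (3, 3)) # w)"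
    "\<And>w v. occ ((x3, y3, 3 + 3) # w) v = occ ((\<Gamma> (3, 1), \<Gamma> (3, 2), \<Gamma> (3, 3)) # w) v"
    by (rule own_casimir_last[OF dist[of 3, THEN conjunct1] dist[of 3, THEN conjunct2, THEN conjunct1]
          dist[of 3, THEN conjunct2, THEN conjunct2] own[of 3]]) (simp, simp, simp, simp, rule that)
  let ?g = "\<lambda>k. (\<Gamma> (k, 1), \<Gamma> (k, 2), \<Gamma> (k, 3))"
  have w: "mg_word [1..<Suc 3] \<Gamma> = [?g 1, ?g 2, ?g 3]"
    unfolding mg_word_def set3(2) by simp
  have in_le: "v \<le> 6" if "v \<in> {\<Gamma> (k, 1), \<Gamma> (k, 2), \<Gamma> (k, 3)}" "k \<in> {1..3}" for v k
    using that(1) bound[OF that(2)] by auto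
  have le: "x1 \<le> 6" "y1 \<le> 6" "x2 \<le> 6" "y2 \<le> 6" "x3 \<le> 6" "y3 \<le> 6"
    by (rule in_le[OF 1(4)] in_le[OF 1(5)] in_le[OF 2(4)] in_le[OF 2(5)] in_le[OF 3(4)] in_le[OF 3(5)]; simp)+
  have "reduces [(x1, y1, 4), (x2, y2, 5), (x3, y3, 6)]"
  proof (rule reduces_canonical)
    show "occ [(x1, y1, 4), (x2, y2, 5), (x3, y3, 6)] 0 = 1"
      using occ 1(7)[of "[]" 0] 2(7)[of "[]" 0] 3(7)[of "[]" 0] unfolding w by simp
  qed (use 1(1-3) 2(1-3) 3(1-3) le in simp_all)
  \<comment> \<open>The rotation acts on the leading bracket; each of the other two brackets is
    therefore first reordered to the front.\<close>
  then have "reduces [?g 1, (x2, y2, 5), (x3, y3, 6)]" using 1(6) by simp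
  then have "reduces [(x2, y2, 3 + 2), ?g 1, (x3, y3, 6)]" by (rule reduces_reorder) simp
  then have "reduces [?g 2, ?g 1, (x3, y3, 6)]" by (rule 2(6))
  then have "reduces [(x3, y3, 3 + 3), ?g 1, ?g 2]" by (rule reduces_reorder) simp
  then have "reduces [?g 3, ?g 1, ?g 2]" by (rule 3(6))
  then show "reduces (mg_word [1..<Suc 3] \<Gamma>)" unfolding w by (rule reduces_reorder) simp
qed

section \<open>The Schouten bracket with the Nambu bivector\<close>

lemma wedge_coord_vectors:
  "wedge (coord_vector i) (coord_vector j) S x =
    (if i \<noteq> j \<and> S = {i, j} then if j < i then - 1 else 1 else 0)"
proof -
  define c where "c T = (-1 :: real) ^ card {(t, u). t \<in> T \<and> u \<in> S - T \<and> u < t}" for T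
  have "wedge (coord_vector i) (coord_vector j) S x
      = (\<Sum>T\<in>Pow S. if T = {i} then (if S - {i} = {j} then c {i} else 0) else 0)"
    unfolding wedge_def coord_vector_def c_def[symmetric] by (intro sum.cong refl) simp
  also have "\<dots> = (if {i} \<in> Pow S then if S - {i} = {j} then c {i} else 0 else 0)"
    by (rule sum.delta) simp
  also have "\<dots> = (if i \<noteq> j \<and> S = {i, j} then if j < i then - 1 else 1 else 0)"
  proof (cases "i \<noteq> j \<and> S = {i, j}")
    case True
    then have "{(t, u). t \<in> {i} \<and> u \<in> S - {i} \<and> u < t} = (if j < i then {(i, j)} else {})"
      by auto
    moreover have "S - {i} = {j}" using True by blast
    ultimately show ?thesis using True by (simp add: c_def)
  next
    case False
    then have "\<not> ({i} \<in> Pow S \<and> S - {i} = {j})" by blast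
    with False show ?thesis by (simp only: if_False) argo
  qed
  finally show ?thesis .
qed

definition poisson :: "scalar_field \<Rightarrow> scalar_field \<Rightarrow> 3 \<Rightarrow> 3 \<Rightarrow> scalar_field" where
  "poisson \<rho> a i j = (\<lambda>x. \<rho> x * (\<Sum>k\<in>UNIV. levi_civita i j k * partial k a x))"

lemma poisson_swap: "poisson \<rho> a j i x = - poisson \<rho> a i j x"
  using levi_civita_swap[of j i] by (simp add: poisson_def sum_negf)

text \<open>The ordered pairs (i, j) and (j, i) contribute equally, by antisymmetry of both factors,
  which cancels the factor 1/2.\<close>

lemma nambu_bivector_pair:
  assumes "i < j"
  shows "nambu_bivector \<rho> a {i, j} = poisson \<rho> a i j"
proof
  fix x
  have c: "(\<Sum>k\<in>UNIV. \<rho> x * levi_civita p q k * partial k a x) = poisson \<rho> a p q x" for p q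
    by (simp add: poisson_def sum_distrib_left mult.assoc)
  have w: "poisson \<rho> a p q x * wedge (coord_vector p) (coord_vector q) {i, j} x
      = (if (p, q) = (i, j) then poisson \<rho> a i j x else 0)
        + (if (p, q) = (j, i) then - poisson \<rho> a j i x else 0)" for p q
    using assms unfolding wedge_coord_vectors doubleton_eq_iff by (simp add: not_less less_le split del: if_split cong: if_cong) auto
  have "nambu_bivector \<rho> a {i, j} x = 1/2 * (\<Sum>r\<in>UNIV.
      (if r = (i, j) then poisson \<rho> a i j x else 0) + (if r = (j, i) then - poisson \<rho> a j i x else 0))"
    unfolding nambu_bivector_def c w sum.cartesian_product UNIV_Times_UNIV
    by (intro arg_cong[where f="\<lambda>t. 1/2 * t"] sum.cong refl) (simp only: split_paired_all prod.case)
  also have "\<dots> = poisson \<rho> a i j x"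
    unfolding sum.distrib poisson_swap[of \<rho> a j i x] by simp
  finally show "nambu_bivector \<rho> a {i, j} x = poisson \<rho> a i j x" .
qed

lemma nambu_bivector_zero:
  assumes "card S \<noteq> 2"
  shows "nambu_bivector \<rho> a S = (\<lambda>x. 0)"
proof -
  have "wedge (coord_vector i) (coord_vector j) S x = 0" for i j x
    using assms by (auto simp: wedge_coord_vectors)
  then show ?thesis by (simp add: nambu_bivector_def)
qed

text \<open>The sign in the right derivative compensates for the order of \<open>i\<close> and
  \<open>l\<close> in the basis element, so one formula covers both orders.\<close>

lemma xi_right_nambu: "xi_right l (nambu_bivector \<rho> a) {i} x = poisson \<rho> a i l x"
proof -
  have s: "{j \<in> {i}. l < j} = (if l < i then {i} else {})" by auto
  consider "l = i" | "l < i" | "i < l" by (rule linorder_cases)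
  then show ?thesis
  proof cases
    case 1
    have "poisson \<rho> a i i x = 0" using poisson_swap[of \<rho> a i i x] by linarith
    with 1 show ?thesis by (simp add: xi_right_def)
  next
    case 2
    then show ?thesis
      unfolding xi_right_def s by (simp add: nambu_bivector_pair poisson_swap[of \<rho> a i l])
  next
    case 3
    then show ?thesis
      unfolding xi_right_def s by (simp add: insert_commute[of l i] nambu_bivector_pair)
  qed
qed

lemma xi_right_nambu_zero:
  assumes "card S \<noteq> 1"
  shows "xi_right l (nambu_bivector \<rho> a) S = (\<lambda>x. 0)"
  using assms by (auto simp: xi_right_def nambu_bivector_zero fun_eq_iff)

lemma wedge_degree_0_right:
  assumes "\<And>T. T \<noteq> {} \<Longrightarrow> B T x = 0"
  shows "wedge A B S x = A S x * B {} x"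
proof -
  have e: "{(t, u). t \<in> S \<and> u \<in> S - S \<and> u < t} = {}" by auto
  have "(-1) ^ card {(t, u). t \<in> T \<and> u \<in> S - T \<and> u < t} * A T x * B (S - T) x
      = (if T = S then A S x * B {} x else 0)" if "T \<in> Pow S" for T
  proof (cases "T = S")
    case True
    show ?thesis unfolding True e by simp
  next
    case False
    with that have "S - T \<noteq> {}" by auto
    then show ?thesis using assms False by simp
  qed
  then have "wedge A B S x = (\<Sum>T\<in>Pow S. if T = S then A S x * B {} x else 0)"
    unfolding wedge_def by (intro sum.cong refl) (simp only: split_paired_all prod.case)
  then show ?thesis by simp
qed

text \<open>A function has no \<open>\<xi>\<close>-derivative, so only the first half of the bracket
  survives.\<close>

lemma schouten_nambu_function:
  assumes "\<And>S x. S \<noteq> {} \<Longrightarrow> A S x = 0"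
  shows "schouten (nambu_bivector \<rho> a) A S x =
    (\<Sum>l\<in>UNIV. xi_right l (nambu_bivector \<rho> a) S x * partial l (A {}) x)"
proof -
  have A: "A S = (\<lambda>x. 0)" if "S \<noteq> {}" for S using assms[OF that] by blast
  have "wedge B (xi_left l A) S x = 0" for B l
    by (simp add: wedge_degree_0_right xi_left_def A)
  moreover have "wedge B (partial_mv l A) S x = B S x * partial l (A {}) x" for B l
    by (subst wedge_degree_0_right) (simp_all add: partial_mv_def A)
  ultimately show ?thesis by (simp add: schouten_def)
qed

lemma wedge_pair:
  assumes "i < j" "\<And>S. A S x \<noteq> 0 \<Longrightarrow> card S = 1"
  shows "wedge A B {i, j} x = A {i} x * B {j} x - A {j} x * B {i} x"
proof -
  have P: "Pow {i, j} = {{}, {i}, {j}, {i, j}}" by auto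
  have 0: "A {} x = 0" "A {i, j} x = 0" using assms(2)[of "{}"] assms(2)[of "{i, j}"] assms(1) by auto
  have d: "{i, j} - {i} = {j}" "{i, j} - {j} = {i}" using assms(1) by auto
  have s: "{(t, u). t \<in> {i} \<and> u \<in> {j} \<and> u < t} = {}" "{(t, u). t \<in> {j} \<and> u \<in> {i} \<and> u < t} = {(j, i)}"
    using assms(1) by auto
  have n: "{} \<noteq> {i}" "{} \<noteq> {j}" "{i} \<noteq> {j}" "{i} \<noteq> {i, j}" "{j} \<noteq> {i, j}" "{} \<noteq> {i, j}" using assms(1) by auto
  have sum4: "(\<Sum>T\<in>{{}, {i}, {j}, {i, j}}. f T) = f {} + f {i} + f {j} + f {i, j}" for f :: "3 set \<Rightarrow> real"
    using n by (simp add: add.assoc)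
  show ?thesis
    unfolding wedge_def P sum4 d s 0 by simp
qed

text \<open>These are the components of minus the Lie derivative of the bivector along
  \<open>Y\<close>. The \<open>\<xi>\<close>-derivative of a vector field is a function, so the
  second half of the bracket is a plain product.\<close>

lemma schouten_nambu_vector:
  assumes "i < j" and Y: "\<And>S x. (\<And>k. S \<noteq> {k}) \<Longrightarrow> Y S x = 0"
  shows "schouten (nambu_bivector \<rho> a) Y {i, j} x =
    (\<Sum>l\<in>UNIV. poisson \<rho> a i l x * partial l (Y {j}) x - poisson \<rho> a j l x * partial l (Y {i}) x
      - partial l (poisson \<rho> a i j) x * Y {l} x)"
proof -
  have "wedge B (xi_left l Y) S x = B S x * Y {l} x" for B l S
  proof (subst wedge_degree_0_right)
    show "xi_left l Y T x = 0" if "T \<noteq> {}" for T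
    proof (cases "l \<in> T")
      case False
      with that have "insert l T \<noteq> {k}" for k by auto
      then show ?thesis by (simp add: xi_left_def Y)
    qed (simp add: xi_left_def)
  qed (simp add: xi_left_def)
  moreover have "wedge (xi_right l (nambu_bivector \<rho> a)) B {i, j} x
      = poisson \<rho> a i l x * B {j} x - poisson \<rho> a j l x * B {i} x" for B l
  proof (subst wedge_pair[OF assms(1)])
    show "card S = 1" if "xi_right l (nambu_bivector \<rho> a) S x \<noteq> 0" for S
      using that by (metis xi_right_nambu_zero)
  qed (simp add: xi_right_nambu)
  ultimately show ?thesis
    by (simp add: schouten_def partial_mv_def nambu_bivector_pair[OF assms(1)] sum_subtractf)
qed

section \<open>Coboundaries\<close>

lemma jet_product_differentiable:
  assumes "smooth h" "smooth \<rho>" "smooth a"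
  shows "(\<lambda>x. jet_product h \<rho> a x M) differentiable (at x)"
  unfolding jet_product_def
  by (intro differentiable_prod jet_differentiable) (auto simp: contents_def assms)

lemma partial_jets:
  fixes c :: "nat \<Rightarrow> scalar_field"
  assumes "finite V" "\<And>v. v \<in> V \<Longrightarrow> smooth (c v)"
  shows "partial k (\<lambda>x. \<Prod>v\<in>V. jet (c v) (M v) x) x = (\<Sum>v\<in>V. \<Prod>u\<in>V. jet (c u) (inc v k M u) x)"
proof -
  have "partial k (\<lambda>x. \<Prod>v\<in>V. jet (c v) (M v) x) x
      = (\<Sum>v\<in>V. \<Prod>u\<in>V. (if u = v then partial k (jet (c u) (M u)) else jet (c u) (M u)) x)"
    using assms by (intro partial_prod) (simp_all add: jet_differentiable)
  also have "\<dots> = (\<Sum>v\<in>V. \<Prod>u\<in>V. jet (c u) (inc v k M u) x)"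
    using assms by (intro sum.cong prod.cong refl) (simp add: inc_apply partial_jet)
  finally show ?thesis .
qed

text \<open>The derivative passes through the brackets, and the Leibniz rule distributes it over the
  seven vertices as one extra increment each.\<close>

lemma partial_bracket_op:
  assumes "smooth h" "smooth \<rho>" "smooth a"
  shows "bracket_op w h \<rho> a differentiable (at x)"
    and "partial k (bracket_op w h \<rho> a) x = (\<Sum>v\<le>6. br w (jet_product h \<rho> a x) (inc v k (\<lambda>_. {#})))"
proof -
  have op: "bracket_op w h \<rho> a = (\<lambda>x. br w (jet_product h \<rho> a x) (\<lambda>_. {#}))"
    by (rule ext) (simp add: bracket_op_def)
  show "bracket_op w h \<rho> a differentiable (at x)"
    unfolding op by (intro partial_br jet_product_differentiable assms)
  have c: "smooth (contents h \<rho> a v)" for v using assms by (simp add: contents_def)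
  have "partial k (bracket_op w h \<rho> a) x = br w (\<lambda>M. partial k (\<lambda>x. jet_product h \<rho> a x M) x) (\<lambda>_. {#})"
    unfolding op by (intro partial_br jet_product_differentiable assms)
  also have "\<dots> = br w (\<lambda>M. \<Sum>v\<le>6. jet_product h \<rho> a x (inc v k M)) (\<lambda>_. {#})"
    unfolding jet_product_def using c by (simp add: partial_jets)
  also have "\<dots> = (\<Sum>v\<le>6. br w (jet_product h \<rho> a x) (inc v k (\<lambda>_. {#})))"
    by (simp add: br_sum br_inc)
  finally show "partial k (bracket_op w h \<rho> a) x = (\<Sum>v\<le>6. br w (jet_product h \<rho> a x) (inc v k (\<lambda>_. {#})))" .
qed

text \<open>
  The letters 1, 2, 3, 4 of a Hamiltonian become the letters 1, 2, 4, 5 of a vector field, where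
  3 and 6 are the Levi-Civita and Casimir vertices of the new copy of the bivector.
\<close>

definition shift_letter :: "nat \<Rightarrow> nat" where
  "shift_letter v = (if v = 3 then 4 else if v = 4 then 5 else if v = 5 then 3 else v)"

definition shift_word :: "bracket_word \<Rightarrow> bracket_word" where
  "shift_word = map (\<lambda>(a, b, c). (shift_letter a, shift_letter b, shift_letter c))"

definition hamiltonian_jets :: "scalar_field \<Rightarrow> scalar_field \<Rightarrow> real^3 \<Rightarrow> multiindex \<Rightarrow> real" where
  "hamiltonian_jets \<rho> a x M = (\<Prod>v\<in>{1, 2, 4, 5}. jet (contents \<rho> \<rho> a v) (M v) x)"

lemma mg_eval_no_sink:
  assumes "smooth \<rho>" "smooth a" and sink: "occ (mg_word [1..<Suc 2] \<Gamma>) 0 = 0"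
  shows "mg_eval 2 \<Gamma> \<rho> a {} x = br (shift_word (mg_word [1..<Suc 2] \<Gamma>)) (hamiltonian_jets \<rho> a x) (\<lambda>_. {#})"
    and "S \<noteq> {} \<Longrightarrow> mg_eval 2 \<Gamma> \<rho> a S x = 0"
proof -
  let ?w = "mg_word [1..<Suc 2] \<Gamma>"
  \<comment> \<open>The value 3 at 5 closes the cycle 3, 4, 5, which makes the shift
    injective.\<close>
  have "inj shift_letter" by (rule injI) (auto simp: shift_letter_def split: if_splits)
  note relabel = br_relabel[OF this, of ?w "\<lambda>N. jet \<rho> (N 1) x * jet a (N 3) x * (jet \<rho> (N 2) x * jet a (N 4) x)" "\<lambda>_. {#}"]
  have I: "{1..2 :: nat} = {1, 2}" by auto
  have "mg_eval 2 \<Gamma> \<rho> a {} x = br ?w (\<lambda>N. jet \<rho> (N 1) x * jet a (N 3) x * (jet \<rho> (N 2) x * jet a (N 4) x)) (\<lambda>_. {#})"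
    unfolding mg_eval_eq_br[OF assms(1,2)] I
  proof (rule br_cong)
    fix N :: multiindex
    assume N: "\<And>v. size (N v) = size ({#} :: 3 multiset) + occ ?w v"
    have "N 0 = {#}" using N[of 0] sink by simp
    then show "(\<Prod>k\<in>{1, 2}. jet \<rho> (N k) x * jet a (N (2 + k)) x) * (if set_mset (N 0) = {} then 1 else 0)
        = jet \<rho> (N 1) x * jet a (N 3) x * (jet \<rho> (N 2) x * jet a (N 4) x)"
      by (simp add: numeral_eq_Suc)
  qed
  also have "\<dots> = br (shift_word ?w) (\<lambda>N. jet \<rho> (N (shift_letter 1)) x * jet a (N (shift_letter 3)) x
      * (jet \<rho> (N (shift_letter 2)) x * jet a (N (shift_letter 4)) x)) (\<lambda>_. {#})"
    unfolding relabel[symmetric] shift_word_def ..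
  also have "\<dots> = br (shift_word ?w) (hamiltonian_jets \<rho> a x) (\<lambda>_. {#})"
    by (rule arg_cong[where f = "\<lambda>g. br (shift_word ?w) g (\<lambda>_. {#})"])
      (simp add: fun_eq_iff hamiltonian_jets_def shift_letter_def contents_def)
  finally show "mg_eval 2 \<Gamma> \<rho> a {} x = br (shift_word ?w) (hamiltonian_jets \<rho> a x) (\<lambda>_. {#})" .
  show "mg_eval 2 \<Gamma> \<rho> a S x = 0" if "S \<noteq> {}"
  proof -
    have "mg_eval 2 \<Gamma> \<rho> a S x = br ?w (\<lambda>_. 0) (\<lambda>_. {#})"
      unfolding mg_eval_eq_br[OF assms(1,2)]
    proof (rule br_cong)
      fix N :: multiindex
      assume N: "\<And>v. size (N v) = size ({#} :: 3 multiset) + occ ?w v"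
      have "N 0 = {#}" using N[of 0] sink by simp
      then show "(\<Prod>k\<in>{1..2}. jet \<rho> (N k) x * jet a (N (2 + k)) x) * (if set_mset (N 0) = S then 1 else 0) = 0"
        using that by auto
    qed
    then show ?thesis by (simp add: br_zero)
  qed
qed

lemma partial_hamiltonian:
  assumes "smooth \<rho>" "smooth a"
  shows "(\<lambda>x. br w (hamiltonian_jets \<rho> a x) (\<lambda>_. {#})) differentiable (at x)"
    and "partial k (\<lambda>x. br w (hamiltonian_jets \<rho> a x) (\<lambda>_. {#})) x
      = (\<Sum>v\<in>{1, 2, 4, 5}. br w (hamiltonian_jets \<rho> a x) (inc v k (\<lambda>_. {#})))"
proof -
  have c: "smooth (contents \<rho> \<rho> a v)" for v using assms by (simp add: contents_def)
  have d: "(\<lambda>x. hamiltonian_jets \<rho> a x M) differentiable (at x)" for M x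
    unfolding hamiltonian_jets_def by (intro differentiable_prod jet_differentiable c) simp
  show "(\<lambda>x. br w (hamiltonian_jets \<rho> a x) (\<lambda>_. {#})) differentiable (at x)"
    by (intro partial_br d)
  have "partial k (\<lambda>x. br w (hamiltonian_jets \<rho> a x) (\<lambda>_. {#})) x
      = br w (\<lambda>M. partial k (\<lambda>x. hamiltonian_jets \<rho> a x M) x) (\<lambda>_. {#})"
    by (intro partial_br d)
  also have "\<dots> = br w (\<lambda>M. \<Sum>v\<in>{1, 2, 4, 5}. hamiltonian_jets \<rho> a x (inc v k M)) (\<lambda>_. {#})"
    unfolding hamiltonian_jets_def by (subst partial_jets[OF _ c]) (rule finite.intros | rule refl)+
  also have "\<dots> = (\<Sum>v\<in>{1, 2, 4, 5}. br w (hamiltonian_jets \<rho> a x) (inc v k (\<lambda>_. {#})))"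
    unfolding br_sum br_inc ..
  finally show "partial k (\<lambda>x. br w (hamiltonian_jets \<rho> a x) (\<lambda>_. {#})) x
      = (\<Sum>v\<in>{1, 2, 4, 5}. br w (hamiltonian_jets \<rho> a x) (inc v k (\<lambda>_. {#})))" .
qed

text \<open>In the bracket [0 v 6] the sink fixes the first index to \<open>i\<close>, letter 3
  contributes \<open>\<rho>\<close> undifferentiated and letter 6 one derivative of
  \<open>a\<close>. Together with the Levi-Civita symbol these form the component of the bivector,
  while \<open>v\<close> takes the derivative of the Hamiltonian. The vanishing occurrences keep
  \<open>w\<close> away from the new letters.\<close>

lemma bracket_op_new_copy:
  assumes "smooth \<rho>" "smooth a" "occ w 0 = 0" "occ w 3 = 0" "occ w 6 = 0" "v \<in> {1, 2, 4, 5}"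
  shows "bracket_op ((0, v, 6) # w) (coordinate i) \<rho> a x =
    (\<Sum>l\<in>UNIV. poisson \<rho> a i l x * br w (hamiltonian_jets \<rho> a x) (inc v l (\<lambda>_. {#})))"
proof -
  have Q: "{..6 :: nat} = {0, 1, 2, 3, 4, 5, 6}" by auto
  have b: "br w (jet_product (coordinate i) \<rho> a x) (inc 0 p (inc v l (inc 6 k (\<lambda>_. {#}))))
      = (if i = p then \<rho> x * partial k a x else 0) * br w (hamiltonian_jets \<rho> a x) (inc v l (\<lambda>_. {#}))" for p l k
  proof -
    have "br w (jet_product (coordinate i) \<rho> a x) (inc 0 p (inc v l (inc 6 k (\<lambda>_. {#}))))
        = br w (\<lambda>N. jet_product (coordinate i) \<rho> a x (inc 0 p (inc 6 k N))) (inc v l (\<lambda>_. {#}))"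
      unfolding inc_commute[of v l 6] br_inc ..
    also have "\<dots> = br w (\<lambda>N. (if i = p then \<rho> x * partial k a x else 0) * hamiltonian_jets \<rho> a x N) (inc v l (\<lambda>_. {#}))"
    proof (rule br_cong)
      fix N :: multiindex
      assume N: "\<And>u. size (N u) = size (inc v l (\<lambda>_. {#}) u) + occ w u"
      have z: "N 0 = {#}" "N 3 = {#}" "N 6 = {#}"
        using N[of 0] N[of 3] N[of 6] assms(3-6) by (auto simp: inc_apply)
      show "jet_product (coordinate i) \<rho> a x (inc 0 p (inc 6 k N))
          = (if i = p then \<rho> x * partial k a x else 0) * hamiltonian_jets \<rho> a x N"
        unfolding jet_product_def hamiltonian_jets_def Q
        by (simp add: inc_apply contents_def z jet_single smooth_coordinate partial_coordinate assms(2))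
    qed
    finally show ?thesis unfolding br_scale .
  qed
  have "bracket_op ((0, v, 6) # w) (coordinate i) \<rho> a x
      = (\<Sum>p\<in>UNIV. if i = p then \<Sum>l\<in>UNIV. \<Sum>k\<in>UNIV. levi_civita p l k * (\<rho> x * partial k a x
          * br w (hamiltonian_jets \<rho> a x) (inc v l (\<lambda>_. {#}))) else 0)"
    unfolding bracket_op_def br.simps b by (intro sum.cong refl) simp
  also have "\<dots> = (\<Sum>l\<in>UNIV. poisson \<rho> a i l x * br w (hamiltonian_jets \<rho> a x) (inc v l (\<lambda>_. {#})))"
    by (simp add: poisson_def sum_distrib_left sum_distrib_right mult_ac)
  finally show ?thesis .
qed

lemma schouten_hamiltonian:
  assumes "smooth \<rho>" "smooth a"
    and "\<And>\<Gamma>. \<Gamma> \<in> set Gs \<Longrightarrow> occ (mg_word [1..<Suc 2] \<Gamma>) 0 = 0"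
    and "\<And>\<Gamma> v. \<Gamma> \<in> set Gs \<Longrightarrow> v \<in> {0, 3, 6} \<Longrightarrow> occ (shift_word (mg_word [1..<Suc 2] \<Gamma>)) v = 0"
  shows "schouten (nambu_bivector \<rho> a) (\<lambda>S x. \<Sum>\<Gamma>\<in>set Gs. c \<Gamma> * mg_eval 2 \<Gamma> \<rho> a S x) {i} x
      = (\<Sum>\<Gamma>\<in>set Gs. c \<Gamma> * (\<Sum>v\<in>{1, 2, 4, 5}.
          bracket_op ((0, v, 6) # shift_word (mg_word [1..<Suc 2] \<Gamma>)) (coordinate i) \<rho> a x))"
    and "(\<And>i. S \<noteq> {i}) \<Longrightarrow>
      schouten (nambu_bivector \<rho> a) (\<lambda>S x. \<Sum>\<Gamma>\<in>set Gs. c \<Gamma> * mg_eval 2 \<Gamma> \<rho> a S x) S x = 0"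
proof -
  let ?H = "\<lambda>S x. \<Sum>\<Gamma>\<in>set Gs. c \<Gamma> * mg_eval 2 \<Gamma> \<rho> a S x"
  let ?w = "\<lambda>\<Gamma>. shift_word (mg_word [1..<Suc 2] \<Gamma>)"
  have H: "?H S x = 0" if "S \<noteq> {}" for S x
    using that assms by (intro sum.neutral) (simp add: mg_eval_no_sink(2) del: upt_Suc)
  have fn: "schouten (nambu_bivector \<rho> a) ?H S x =
      (\<Sum>l\<in>UNIV. xi_right l (nambu_bivector \<rho> a) S x * partial l (?H {}) x)" for S x
    by (rule schouten_nambu_function) (rule H)
  have H0: "?H {} = (\<lambda>x. \<Sum>\<Gamma>\<in>set Gs. c \<Gamma> * br (?w \<Gamma>) (hamiltonian_jets \<rho> a x) (\<lambda>_. {#}))"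
    using assms by (intro ext sum.cong refl) (simp add: mg_eval_no_sink(1) del: upt_Suc)
  have dH: "partial l (?H {}) x = (\<Sum>\<Gamma>\<in>set Gs. c \<Gamma> * (\<Sum>v\<in>{1, 2, 4, 5}.
      br (?w \<Gamma>) (hamiltonian_jets \<rho> a x) (inc v l (\<lambda>_. {#}))))" for l
    unfolding H0 partial_hamiltonian(2)[OF assms(1,2), symmetric]
    by (subst partial_sum) (simp_all add: partial_cmult partial_hamiltonian(1)[OF assms(1,2)] del: upt_Suc)
  have "schouten (nambu_bivector \<rho> a) ?H {i} x = (\<Sum>l\<in>UNIV. \<Sum>\<Gamma>\<in>set Gs. \<Sum>v\<in>{1, 2, 4, 5}.
      c \<Gamma> * (poisson \<rho> a i l x * br (?w \<Gamma>) (hamiltonian_jets \<rho> a x) (inc v l (\<lambda>_. {#}))))"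
    unfolding fn xi_right_nambu dH by (simp only: sum_distrib_left mult.left_commute)
  also have "\<dots> = (\<Sum>\<Gamma>\<in>set Gs. \<Sum>v\<in>{1, 2, 4, 5}. \<Sum>l\<in>UNIV.
      c \<Gamma> * (poisson \<rho> a i l x * br (?w \<Gamma>) (hamiltonian_jets \<rho> a x) (inc v l (\<lambda>_. {#}))))"
    by (subst sum.swap) (intro sum.cong refl sum.swap)
  also have "\<dots> = (\<Sum>\<Gamma>\<in>set Gs. c \<Gamma> * (\<Sum>v\<in>{1, 2, 4, 5}. bracket_op ((0, v, 6) # ?w \<Gamma>) (coordinate i) \<rho> a x))"
    unfolding sum_distrib_left
    by (intro sum.cong refl) (subst bracket_op_new_copy[OF assms(1,2)], (rule assms(4); simp)+, assumption,
      simp only: sum_distrib_left)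
  finally show "schouten (nambu_bivector \<rho> a) ?H {i} x
      = (\<Sum>\<Gamma>\<in>set Gs. c \<Gamma> * (\<Sum>v\<in>{1, 2, 4, 5}. bracket_op ((0, v, 6) # ?w \<Gamma>) (coordinate i) \<rho> a x))" .
  show "schouten (nambu_bivector \<rho> a) ?H S x = 0" if "\<And>i. S \<noteq> {i}" for S
  proof -
    have "card S \<noteq> 1" using that by (metis card_1_singletonE)
    then show ?thesis unfolding fn by (simp add: xi_right_nambu_zero)
  qed
qed

section \<open>Test fields\<close>

text \<open>
  A triple of exponents stands for a product of divided powers, so that differentiation does not
  create coefficients.
\<close>

type_synonym sparse_poly = "(nat \<times> nat \<times> nat) list"

fun poly_fun :: "sparse_poly \<Rightarrow> scalar_field" where
  "poly_fun [] x = 0"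
| "poly_fun ((l, m, n) # p) x = x $ 1 ^ l / fact l * (x $ 2 ^ m / fact m) * (x $ 3 ^ n / fact n) + poly_fun p x"

fun diff1 :: "sparse_poly \<Rightarrow> sparse_poly" where
  "diff1 [] = []"
| "diff1 ((0, m, n) # p) = diff1 p"
| "diff1 ((Suc l, m, n) # p) = (l, m, n) # diff1 p"

fun diff2 :: "sparse_poly \<Rightarrow> sparse_poly" where
  "diff2 [] = []"
| "diff2 ((l, 0, n) # p) = diff2 p"
| "diff2 ((l, Suc m, n) # p) = (l, m, n) # diff2 p"

fun diff3 :: "sparse_poly \<Rightarrow> sparse_poly" where
  "diff3 [] = []"
| "diff3 ((l, m, 0) # p) = diff3 p"
| "diff3 ((l, m, Suc n) # p) = (l, m, n) # diff3 p"

fun const_coeff :: "sparse_poly \<Rightarrow> int" where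
  "const_coeff [] = 0"
| "const_coeff ((l, m, n) # p) = (if l = 0 \<and> m = 0 \<and> n = 0 then 1 + const_coeff p else const_coeff p)"

text \<open>Naturals stand for directions in the symbolic computation. Every number above 1 means
  the third direction, here and in \<open>poly_diff\<close>, so that the two agree without a bound
  on \<open>d\<close>.\<close>

definition index :: "nat \<Rightarrow> 3" where
  "index d = (if d = 0 then 1 else if d = 1 then 2 else 3)"

fun poly_diff :: "nat \<Rightarrow> sparse_poly \<Rightarrow> sparse_poly" where
  "poly_diff 0 p = diff1 p"
| "poly_diff (Suc 0) p = diff2 p"
| "poly_diff (Suc (Suc d)) p = diff3 p"

lemma has_derivative_coordinate_power:
  "((\<lambda>x :: real^3. x $ i ^ n / fact n) has_derivative
    (\<lambda>h. (if n = 0 then 0 else x $ i ^ (n - 1) / fact (n - 1)) * h $ i)) (at x)"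
proof -
  have "((\<lambda>x :: real^3. x $ i ^ n) has_derivative (\<lambda>h. of_nat n * h $ i * x $ i ^ (n - 1))) (at x)"
    by (rule has_derivative_power[OF bounded_linear_imp_has_derivative[OF bounded_linear_vec_nth]])
  then have "((\<lambda>x :: real^3. x $ i ^ n / fact n) has_derivative
      (\<lambda>h. of_nat n * h $ i * x $ i ^ (n - 1) / fact n)) (at x)"
    by (rule bounded_linear.has_derivative[OF bounded_linear_divide])
  moreover have "of_nat n * y * x $ i ^ (n - 1) / fact n
      = (if n = 0 then 0 else x $ i ^ (n - 1) / fact (n - 1)) * y" for y :: real
    by (cases n) (simp_all add: fact_Suc divide_simps)
  ultimately show ?thesis by simp
qed

lemma partial_power:
  "(\<lambda>x :: real^3. x $ i ^ n / fact n) differentiable (at x)"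
  "partial k (\<lambda>x. x $ i ^ n / fact n) x = (if k = i \<and> n \<noteq> 0 then x $ i ^ (n - 1) / fact (n - 1) else 0)"
proof -
  show "(\<lambda>x :: real^3. x $ i ^ n / fact n) differentiable (at x)"
    using has_derivative_coordinate_power by (rule differentiableI)
  show "partial k (\<lambda>x. x $ i ^ n / fact n) x = (if k = i \<and> n \<noteq> 0 then x $ i ^ (n - 1) / fact (n - 1) else 0)"
    using partial_eqI[OF has_derivative_coordinate_power] by (auto simp: axis_def)
qed

lemma partial_poly_fun:
  "poly_fun p differentiable (at x) \<and> partial (index d) (poly_fun p) x = poly_fun (poly_diff d p) x"
proof (induction p)
  case Nil
  have "poly_fun [] = (\<lambda>x. 0)" by (rule ext) simp
  then show ?case by (cases "(d, [] :: sparse_poly)" rule: poly_diff.cases) simp_all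
next
  case (Cons e p)
  obtain l m n where e: "e = (l, m, n)" by (cases e)
  let ?X = "\<lambda>x :: real^3. x $ 1 ^ l / fact l" and ?Y = "\<lambda>x :: real^3. x $ 2 ^ m / fact m"
    and ?Z = "\<lambda>x :: real^3. x $ 3 ^ n / fact n"
  have f: "poly_fun (e # p) = (\<lambda>x. ?X x * ?Y x * ?Z x + poly_fun p x)" by (rule ext) (simp add: e)
  have D: "(\<lambda>x. ?X x * ?Y x) differentiable (at x)" "(\<lambda>x. ?X x * ?Y x * ?Z x) differentiable (at x)"
    by (intro differentiable_mult partial_power(1))+
  have P: "partial (index d) (poly_fun (e # p)) x = (?X x * ?Y x * partial (index d) ?Z x
      + (?X x * partial (index d) ?Y x + partial (index d) ?X x * ?Y x) * ?Z x) + poly_fun (poly_diff d p) x"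
    unfolding f using Cons.IH D partial_power(1) by (simp only: partial_add partial_mult)
  consider "d = 0" | "d = 1" | d' where "d = Suc (Suc d')"
    by (metis One_nat_def not0_implies_Suc)
  then have "partial (index d) (poly_fun (e # p)) x = poly_fun (poly_diff d (e # p)) x"
  proof cases
    case 1
    then show ?thesis unfolding P partial_power(2)
      by (cases l) (simp_all add: index_def neq_3 e del: fact_Suc power_Suc)
  next
    case 2
    then show ?thesis unfolding P partial_power(2)
      by (cases m) (simp_all add: index_def neq_3 e del: fact_Suc power_Suc)
  next
    case 3
    then show ?thesis unfolding P partial_power(2)
      by (cases n) (simp_all add: index_def neq_3 e del: fact_Suc power_Suc)
  qed
  moreover have "poly_fun (e # p) differentiable (at x)"
    unfolding f using Cons.IH D by (intro differentiable_add) auto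
  ultimately show ?case by blast
qed

lemma partial_poly_fun_eq: "partial (index d) (poly_fun p) = poly_fun (poly_diff d p)"
  using partial_poly_fun by blast

lemma index_cases: obtains d where "i = index d" "d < 3"
proof -
  have "i = index 0 \<or> i = index 1 \<or> i = index 2" using exhaust_3[of i] by (auto simp: index_def)
  then show thesis using that[of 0] that[of 1] that[of 2] by auto
qed

lemma smooth_poly_fun: "smooth (poly_fun p)"
proof -
  have "\<exists>q. foldr partial is (poly_fun p) = poly_fun q" for "is"
  proof (induction "is")
    case (Cons i "is")
    obtain d where "i = index d" by (rule index_cases)
    then show ?case using Cons partial_poly_fun_eq by auto
  qed auto
  then have "foldr partial is (poly_fun p) differentiable (at x)" for "is" x
    using partial_poly_fun by metis
  then show ?thesis by (simp add: smooth_def differentiable_on_def differentiable_at_withinI)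
qed

lemma poly_fun_0: "poly_fun p 0 = of_int (const_coeff p)"
  by (induction p rule: const_coeff.induct) (auto simp: power_0_left)

definition diff_letter :: "nat \<Rightarrow> nat \<Rightarrow> sparse_poly list \<Rightarrow> sparse_poly list" where
  "diff_letter v d L = L[v := poly_diff d (L ! v)]"

fun constants :: "sparse_poly list \<Rightarrow> int" where
  "constants [] = 1"
| "constants (p # L) = (if const_coeff p = 0 then 0 else const_coeff p * constants L)"

text \<open>Used for pruning: an empty polynomial stays empty under differentiation, so every term
  below it is zero.\<close>

fun has_zero :: "sparse_poly list \<Rightarrow> bool" where
  "has_zero [] \<longleftrightarrow> False"
| "has_zero (p # L) \<longleftrightarrow> (case p of [] \<Rightarrow> True | _ \<Rightarrow> has_zero L)"

text \<open>The evaluation of \<open>br\<close> at the origin, with polynomials differentiated in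
  place of multi-indices; the six summands are the nonzero values of the Levi-Civita symbol.\<close>

fun br_value :: "bracket_word \<Rightarrow> sparse_poly list \<Rightarrow> int" where
  "br_value [] L = constants L"
| "br_value ((a, b, c) # w) L = (if has_zero L then 0 else
     br_value w (diff_letter a 0 (diff_letter b 1 (diff_letter c 2 L)))
     + br_value w (diff_letter a 1 (diff_letter b 2 (diff_letter c 0 L)))
     + br_value w (diff_letter a 2 (diff_letter b 0 (diff_letter c 1 L)))
     - br_value w (diff_letter a 0 (diff_letter b 2 (diff_letter c 1 L)))
     - br_value w (diff_letter a 2 (diff_letter b 1 (diff_letter c 0 L)))
     - br_value w (diff_letter a 1 (diff_letter b 0 (diff_letter c 2 L))))"

definition sink_poly :: "nat \<Rightarrow> sparse_poly" where
  "sink_poly d = (if d = 0 then [(1, 0, 0)] else if d = 1 then [(0, 1, 0)] else [(0, 0, 1)])"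

definition letter_polys :: "nat \<Rightarrow> sparse_poly \<Rightarrow> sparse_poly \<Rightarrow> sparse_poly list" where
  "letter_polys d R A = [sink_poly d, R, R, R, A, A, A]"

definition field_value :: "sparse_poly \<Rightarrow> sparse_poly \<Rightarrow> bracket_word \<Rightarrow> nat \<Rightarrow> int" where
  "field_value R A w d = br_value w (letter_polys d R A)"

text \<open>By the Leibniz rule, the derivative in direction \<open>e\<close> of component
  \<open>d\<close> at the origin.\<close>

definition field_diff :: "sparse_poly \<Rightarrow> sparse_poly \<Rightarrow> bracket_word \<Rightarrow> nat \<Rightarrow> nat \<Rightarrow> int" where
  "field_diff R A w e d = (let L = letter_polys d R A in
     br_value w (diff_letter 0 e L) + br_value w (diff_letter 1 e L) + br_value w (diff_letter 2 e L)
     + br_value w (diff_letter 3 e L) + br_value w (diff_letter 4 e L) + br_value w (diff_letter 5 e L)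
     + br_value w (diff_letter 6 e L))"

text \<open>The derivative of \<open>p\<close> along the field of the word, at the origin. The
  guards skip components with coefficient zero.\<close>

definition contract :: "sparse_poly \<Rightarrow> sparse_poly \<Rightarrow> sparse_poly \<Rightarrow> bracket_word \<Rightarrow> int" where
  "contract p R A w =
     (if const_coeff (diff1 p) = 0 then 0 else const_coeff (diff1 p) * field_value R A w 0)
     + (if const_coeff (diff2 p) = 0 then 0 else const_coeff (diff2 p) * field_value R A w 1)
     + (if const_coeff (diff3 p) = 0 then 0 else const_coeff (diff3 p) * field_value R A w 2)"

text \<open>
  If \<open>da = dx\<^sup>3\<close> at the origin, then the values for 0, 1, 2 are, up to sign, the components of
  \<open>d_P Y\<close> at \<open>{3, 2}\<close>, \<open>{3, 1}\<close> and \<open>{1, 2}\<close> there, for the field \<open>Y\<close> given by the word.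
\<close>

fun cocycle_value :: "nat \<times> sparse_poly \<times> sparse_poly \<Rightarrow> bracket_word \<Rightarrow> int" where
  "cocycle_value (0, R, A) w = (if const_coeff R = 0 then 0 else const_coeff R *
     (field_diff R A w 0 2 + contract (diff1 A) R A w))"
| "cocycle_value (Suc 0, R, A) w = (if const_coeff R = 0 then 0 else const_coeff R *
     (field_diff R A w 1 2 + contract (diff2 A) R A w))"
| "cocycle_value (_, R, A) w = (if const_coeff R = 0 then contract R R A w else
     contract R R A w + const_coeff R * (contract (diff3 A) R A w
       - field_diff R A w 0 0 - field_diff R A w 1 1))"

text \<open>An entry holds the case of \<open>cocycle_value\<close>, the polynomials for
  \<open>\<rho>\<close> and \<open>a\<close>, and the resulting equation as pairs of word number and
  coefficient. The only linear term of each polynomial for \<open>a\<close> is x^3, the third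
  coordinate, which gives da = dx^3 at the origin.\<close>

definition tests :: "((nat \<times> sparse_poly \<times> sparse_poly) \<times> (nat \<times> int) list) list" where
  "tests =
   [((2, [(0, 1, 0), (3, 0, 0)], [(0, 0, 1)]), [(21, -1)]),
    ((2, [(0, 0, 0), (0, 3, 0)], [(0, 0, 1), (3, 0, 1)]), [(3, -1)]),
    ((1, [(0, 0, 0), (1, 0, 0)], [(0, 0, 1), (0, 4, 0)]), [(16, 1)]),
    ((1, [(0, 0, 0), (0, 2, 0), (2, 1, 0)], [(0, 0, 1), (1, 1, 0)]), [(12, -2)]),
    ((2, [(0, 0, 0), (1, 0, 1)], [(0, 0, 1), (0, 3, 0), (1, 0, 1)]), [(0, -1)]),
    ((1, [(0, 0, 0), (0, 2, 0)], [(0, 0, 1), (3, 0, 0)]), [(7, -1), (8, -1)]),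
    ((0, [(0, 0, 0), (0, 1, 1)], [(0, 0, 1), (2, 1, 0)]), [(1, 2), (2, 2)]),
    ((0, [(0, 0, 0), (1, 0, 0)], [(0, 0, 1), (0, 1, 1), (1, 2, 0)]), [(5, 1), (6, 1)]),
    ((1, [(0, 0, 0), (1, 0, 0), (1, 0, 1)], [(0, 0, 1), (0, 2, 0)]), [(18, 1), (20, 1)]),
    ((2, [(0, 0, 0), (0, 1, 0), (0, 2, 0), (3, 0, 0)], [(0, 0, 1)]), [(21, 1), (22, 1)]),
    ((2, [(0, 0, 0), (0, 1, 0), (1, 0, 1)], [(0, 0, 1), (2, 1, 0)]), [(16, 1), (19, 1)]),
    ((2, [(0, 0, 0), (0, 1, 0)], [(0, 0, 1), (1, 0, 1), (2, 0, 1)]), [(16, -1), (17, -2)]),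
    ((2, [(0, 0, 0), (0, 1, 0), (1, 1, 1), (3, 0, 0)], [(0, 0, 1), (2, 0, 0)]), [(18, 1), (21, 1)]),
    ((2, [(0, 0, 0), (0, 1, 1), (1, 2, 0)], [(0, 0, 1), (2, 0, 0)]), [(13, -1), (14, -1), (15, -2)]),
    ((2, [(0, 0, 0), (0, 0, 1), (3, 0, 0)], [(0, 0, 1), (0, 3, 0)]), [(3, 1), (8, 1), (13, -1)]),
    ((1, [(0, 0, 0), (0, 0, 2), (0, 1, 0)], [(0, 0, 1), (1, 1, 0)]), [(9, 1), (10, 1), (11, -1)]),
    ((2, [(0, 0, 0), (2, 1, 0)], [(0, 0, 1), (0, 1, 2), (1, 1, 0)]), [(2, 2), (3, 4), (4, 2)]),
    ((2, [(0, 0, 0), (1, 0, 0), (2, 1, 0)], [(0, 0, 1), (0, 1, 1)]), [(4, -1), (11, 1), (12, -1), (13, -1)]),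
    ((2, [(0, 0, 0), (0, 0, 1), (0, 2, 0)], [(0, 0, 1), (1, 0, 1), (2, 1, 0)]), [(1, -1), (2, -1), (5, -1), (6, 1), (8, 1), (9, -1), (11, 1)])]"

fun test_ok :: "(nat \<times> sparse_poly \<times> sparse_poly) \<times> (nat \<times> int) list \<Rightarrow> bool" where
  "test_ok ((k, R, A), v) \<longleftrightarrow> k < 3 \<and> const_coeff (diff1 A) = 0 \<and> const_coeff (diff2 A) = 0 \<and> const_coeff (diff3 A) = 1
     \<and> map (cocycle_value (k, R, A)) basis_words = map (coord v) [0..<23]"

lemma tests_check: "list_all test_ok tests"
  by code_simp

section \<open>Correctness of the symbolic evaluation\<close>

definition poly_jets :: "sparse_poly list \<Rightarrow> multiindex \<Rightarrow> real" where
  "poly_jets L N = (\<Prod>v\<le>6. jet (poly_fun (L ! v)) (N v) 0)"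

lemma length_diff_letter [simp]: "length (diff_letter v d L) = length L"
  by (simp add: diff_letter_def)

lemma poly_jets_inc:
  assumes "length L = 7" "v \<le> 6"
  shows "poly_jets L (inc v (index d) N) = poly_jets (diff_letter v d L) N"
  unfolding poly_jets_def
proof (rule prod.cong[OF refl])
  fix u :: nat assume "u \<in> {..6}"
  have "jet (poly_fun p) (add_mset (index d) M) = jet (poly_fun (poly_diff d p)) M" for p M
  proof -
    \<comment> \<open>The last direction in the list is applied first, so it acts directly on the
      polynomial.\<close>
    have "jet (poly_fun p) (mset (sorted_list_of_multiset M @ [index d]))
        = foldr partial (sorted_list_of_multiset M @ [index d]) (poly_fun p)"
      by (rule jet_mset[OF smooth_poly_fun, symmetric])
    also have "\<dots> = jet (poly_fun (poly_diff d p)) M"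
      by (simp add: jet_def partial_poly_fun_eq)
    finally show ?thesis by simp
  qed
  then show "jet (poly_fun (L ! u)) (inc v (index d) N u) 0 = jet (poly_fun (diff_letter v d L ! u)) (N u) 0"
    using assms by (cases "u = v") (simp_all add: inc_apply diff_letter_def)
qed

lemma constants: "of_int (constants L) = (\<Prod>p\<leftarrow>L. poly_fun p 0)"
  by (induction L) (simp_all add: poly_fun_0)

lemma has_zero:
  assumes "has_zero L" "length L = 7"
  shows "poly_jets L N = 0"
proof -
  have "\<exists>v<length L. L ! v = []"
    using assms(1)
  proof (induction L rule: has_zero.induct)
    case (2 p L)
    then show ?case by (cases p) auto
  qed simp
  then obtain v where "v < 7" and v: "L ! v = []" using assms(2) by auto
  then have v6: "v \<le> 6" by simp
  have "poly_fun [] = (\<lambda>x. 0)" by (rule ext) simp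
  then have "jet (poly_fun (L ! v)) (N v) 0 = 0"
    unfolding v jet_def by (simp add: foldr_partial_const)
  then show ?thesis
    unfolding poly_jets_def using v6 by (intro prod_zero) auto
qed

lemma br_value:
  assumes "length L = 7" "valid_word w"
  shows "br w (poly_jets L) (\<lambda>_. {#}) = of_int (br_value w L)"
  using assms
proof (induction w L rule: br_value.induct)
  case (1 L)
  have "(\<Prod>p\<leftarrow>L. poly_fun p 0) = (\<Prod>v<7. poly_fun (L ! v) 0)"
    using 1 by (simp add: prod.list_conv_set_nth atLeast0LessThan)
  also have "{..<7 :: nat} = {..6}" by auto
  finally show ?case by (simp add: poly_jets_def constants)
next
  case (2 a b c w L)
  show ?case
  proof (cases "has_zero L")
    case True
    then have "poly_jets L = (\<lambda>N. 0)" using has_zero 2 by blast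
    then show ?thesis using True by (simp add: br_zero del: br.simps)
  next
    case False
    have abc: "a \<le> 6" "b \<le> 6" "c \<le> 6" "valid_word w" using 2 by auto
    have step: "br w (poly_jets L) (inc a (index i) (inc b (index j) (inc c (index k) (\<lambda>_. {#}))))
        = br w (poly_jets (diff_letter a i (diff_letter b j (diff_letter c k L)))) (\<lambda>_. {#})" for i j k
    proof -
      have "inc a (index i) (inc b (index j) (inc c (index k) (\<lambda>_. {#})))
          = inc c (index k) (inc b (index j) (inc a (index i) (\<lambda>_. {#})))"
        by (simp add: inc_commute)
      then show ?thesis using abc 2(7) by (simp add: br_inc poly_jets_inc)
    qed
    have ix: "1 = index 0" "2 = index 1" "3 = index 2" by (simp_all add: index_def)
    have len: "length (diff_letter a i (diff_letter b j (diff_letter c k L))) = 7" for i j k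
      using 2 by simp
    show ?thesis
      using False 2(1-6)[OF False len abc(4)]
      by (simp add: sum_3) (simp add: ix step)
  qed
qed

lemma index_simps [simp]: "index 0 = 1" "index 1 = 2" "index (Suc 0) = 2" "index 2 = 3" "index (Suc (Suc 0)) = 3"
  by (simp_all add: index_def)

lemma sum_index: "(\<Sum>l\<in>UNIV. f (l :: 3)) = f (index 0) + f (index 1) + f (index 2)"
  by (simp add: sum_3)

lemma coordinate_eq_poly_fun: "d < 3 \<Longrightarrow> coordinate (index d) = poly_fun (sink_poly d)"
  by (rule ext) (auto simp: coordinate_def sink_poly_def index_def less_Suc_eq numeral_3_eq_3)

lemma jet_product_poly_fun:
  assumes "d < 3"
  shows "jet_product (coordinate (index d)) (poly_fun R) (poly_fun A) 0 = poly_jets (letter_polys d R A)"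
proof
  fix N
  have "contents (coordinate (index d)) (poly_fun R) (poly_fun A) v = poly_fun (letter_polys d R A ! v)" if "v \<le> 6" for v
    using that assms unfolding le_6_cases
    by (auto simp: contents_def letter_polys_def coordinate_eq_poly_fun)
  then show "jet_product (coordinate (index d)) (poly_fun R) (poly_fun A) 0 N = poly_jets (letter_polys d R A) N"
    by (simp add: jet_product_def poly_jets_def)
qed

lemma field_value:
  assumes "d < 3" "valid_word w"
  shows "bracket_op w (coordinate (index d)) (poly_fun R) (poly_fun A) 0 = of_int (field_value R A w d)"
  unfolding bracket_op_def jet_product_poly_fun[OF assms(1)] field_value_def
  using assms(2) by (intro br_value) (simp add: letter_polys_def)

lemma field_diff:
  assumes "d < 3" "valid_word w"
  shows "partial (index e) (bracket_op w (coordinate (index d)) (poly_fun R) (poly_fun A)) 0 = of_int (field_diff R A w e d)"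
proof -
  let ?L = "letter_polys d R A"
  have len: "length ?L = 7" by (simp add: letter_polys_def)
  have Q: "{..6 :: nat} = {0, 1, 2, 3, 4, 5, 6}" by auto
  have "br w (poly_jets ?L) (inc v (index e) (\<lambda>_. {#})) = of_int (br_value w (diff_letter v e ?L))" if "v \<le> 6" for v
  proof -
    have "br w (poly_jets ?L) (inc v (index e) (\<lambda>_. {#})) = br w (poly_jets (diff_letter v e ?L)) (\<lambda>_. {#})"
      unfolding br_inc poly_jets_inc[OF len that] ..
    also have "\<dots> = of_int (br_value w (diff_letter v e ?L))"
      using assms(2) len by (intro br_value) simp_all
    finally show ?thesis .
  qed
  then show ?thesis
    unfolding partial_bracket_op(2)[OF smooth_coordinate smooth_poly_fun smooth_poly_fun]
      jet_product_poly_fun[OF assms(1)] Q field_diff_def Let_def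
    by simp
qed

lemma contract_eq: "contract p R A w = const_coeff (poly_diff 0 p) * field_value R A w 0
    + const_coeff (poly_diff 1 p) * field_value R A w 1 + const_coeff (poly_diff 2 p) * field_value R A w 2"
  by (simp add: contract_def numeral_2_eq_2)

lemma cocycle_value_eq:
  "cocycle_value (0, R, A) w = const_coeff R * (field_diff R A w 0 2 + contract (poly_diff 0 A) R A w)"
  "cocycle_value (1, R, A) w = const_coeff R * (field_diff R A w 1 2 + contract (poly_diff 1 A) R A w)"
  "cocycle_value (2, R, A) w = contract R R A w + const_coeff R * (contract (poly_diff 2 A) R A w
       - field_diff R A w 0 0 - field_diff R A w 1 1)"
  by (simp_all add: numeral_2_eq_2)

lemma partial_poly_fun_0: "partial (index d) (poly_fun p) 0 = of_int (const_coeff (poly_diff d p))"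
  by (simp only: partial_poly_fun_eq poly_fun_0)

lemma valid_basis_words: "b < 23 \<Longrightarrow> valid_word (basis_words ! b)"
proof -
  have "list_all valid_word basis_words" "length basis_words = 23" by code_simp+
  then show "b < 23 \<Longrightarrow> valid_word (basis_words ! b)" by (simp add: list_all_length)
qed

text \<open>At the origin da = dx^3, so the bivector there is \<open>\<rho>\<close> times the
  Levi-Civita symbol with last index 3, and few terms of the general formula for
  \<open>d_P Y\<close> survive. What remains is linear in the coordinates \<open>y\<close>.\<close>

lemma cocycle_value:
  assumes A: "const_coeff (diff1 A) = 0" "const_coeff (diff2 A) = 0" "const_coeff (diff3 A) = 1"
    and Y: "\<And>i x. Y {i} x = (\<Sum>b<23. y b * bracket_op (basis_words ! b) (coordinate i) (poly_fun R) (poly_fun A) x)"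
    and Y0: "\<And>S x. (\<And>k. S \<noteq> {k}) \<Longrightarrow> Y S x = 0"
    and cocycle: "\<And>S x. schouten (nambu_bivector (poly_fun R) (poly_fun A)) Y S x = 0"
    and k: "k < 3"
  shows "(\<Sum>b<23. y b * of_int (cocycle_value (k, R, A) (basis_words ! b))) = 0"
proof -
  let ?P = "poisson (poly_fun R) (poly_fun A)"
  define V where "V d = (\<Sum>b<23. y b * of_int (field_value R A (basis_words ! b) d))" for d
  define D where "D e d = (\<Sum>b<23. y b * of_int (field_diff R A (basis_words ! b) e d))" for e d
  define r where "r = real_of_int (const_coeff R)"
  define R' where "R' d = real_of_int (const_coeff (poly_diff d R))" for d
  define A' where "A' d e = real_of_int (const_coeff (poly_diff d (poly_diff e A)))" for d e
  have V: "Y {index d} 0 = V d" if "d < 3" for d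
    unfolding Y V_def using that by (intro sum.cong refl) (simp add: field_value valid_basis_words)
  have D: "partial (index e) (Y {index d}) 0 = D e d" if "d < 3" for d e
  proof -
    have "Y {index d} = (\<lambda>x. \<Sum>b<23. y b * bracket_op (basis_words ! b) (coordinate (index d)) (poly_fun R) (poly_fun A) x)"
      by (rule ext) (rule Y)
    then have "partial (index e) (Y {index d}) 0 = (\<Sum>b<23. y b *
        partial (index e) (bracket_op (basis_words ! b) (coordinate (index d)) (poly_fun R) (poly_fun A)) 0)"
      by (simp add: partial_sum partial_cmult partial_bracket_op(1) smooth_coordinate smooth_poly_fun)
    also have "\<dots> = D e d"
      unfolding D_def using that by (intro sum.cong refl) (simp add: field_diff valid_basis_words)
    finally show ?thesis .
  qed
  have a0: "partial 1 (poly_fun A) 0 = 0" "partial 2 (poly_fun A) 0 = 0" "partial 3 (poly_fun A) 0 = 1"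
    using A partial_poly_fun_0[of 0 A] partial_poly_fun_0[of 1 A] partial_poly_fun_0[of 2 A]
    by (simp_all add: numeral_2_eq_2)
  have P0: "?P i l 0 = r * levi_civita i l 3" for i l
    by (simp add: poisson_def sum_3 a0 r_def poly_fun_0)
  have dP: "partial (index l) (?P i j) 0 = R' l * levi_civita i j 3
      + r * (levi_civita i j 1 * A' l 0 + levi_civita i j 2 * A' l 1 + levi_civita i j 3 * A' l 2)" for l i j
  proof -
    have d: "poly_fun p differentiable (at x)" for p x using partial_poly_fun by blast
    have da: "partial k (poly_fun A) differentiable (at x)" for k x
      by (intro smooth_differentiable smooth_partial smooth_poly_fun)
    have "partial (index l) (?P i j) 0 = poly_fun R 0 * (\<Sum>k\<in>UNIV. levi_civita i j k * partial (index l) (partial k (poly_fun A)) 0)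
        + partial (index l) (poly_fun R) 0 * (\<Sum>k\<in>UNIV. levi_civita i j k * partial k (poly_fun A) 0)"
      unfolding poisson_def
      by (simp add: partial_mult partial_sum partial_cmult d da differentiable_sum differentiable_mult)
    then show ?thesis
      unfolding sum_index partial_poly_fun_eq poly_fun_0
      by (simp add: A numeral_2_eq_2 r_def R'_def A'_def)
  qed
  have sch: "schouten (nambu_bivector (poly_fun R) (poly_fun A)) Y {i, j} 0 = (\<Sum>l\<in>UNIV.
      ?P i l 0 * partial l (Y {j}) 0 - ?P j l 0 * partial l (Y {i}) 0 - partial l (?P i j) 0 * Y {l} 0)" if "i < j" for i j
    by (rule schouten_nambu_vector[OF that]) (rule Y0)
  have eq: "(\<Sum>l\<in>UNIV. ?P i l 0 * partial l (Y {j}) 0 - ?P j l 0 * partial l (Y {i}) 0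
      - partial l (?P i j) 0 * Y {l} 0) = 0" if "i < j" for i j
    using trans[OF sch[OF that, symmetric] cocycle] .
  note eqs = eq[unfolded sum_index P0 dP]
  have VD: "Y {1} 0 = V 0" "Y {2} 0 = V 1" "Y {3} 0 = V 2"
    "partial 1 (Y {3}) 0 = D 0 2" "partial 2 (Y {3}) 0 = D 1 2"
    "partial 1 (Y {1}) 0 = D 0 0" "partial 2 (Y {2}) 0 = D 1 1"
    using V[of 0] V[of 1] V[of 2] D[of 2 0] D[of 2 1] D[of 0 0] D[of 1 1] by simp_all
  have C: "(\<Sum>b<23. y b * of_int (contract p R A (basis_words ! b)))
      = of_int (const_coeff (poly_diff 0 p)) * V 0 + of_int (const_coeff (poly_diff 1 p)) * V 1
        + of_int (const_coeff (poly_diff 2 p)) * V 2" for p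
    unfolding contract_eq V_def by (simp add: algebra_simps sum.distrib sum_distrib_left)
  \<comment> \<open>The component at {3, 2}, taken as (3, 2) since 3 < 1 < 2. Derivatives of
    \<open>\<rho>\<close> drop out because they are multiplied by the first derivative of
    \<open>a\<close> in direction 1, which is zero at the origin.\<close>
  have "(\<Sum>b<23. y b * of_int (cocycle_value (0, R, A) (basis_words ! b)))
      = r * (D 0 2 + (\<Sum>b<23. y b * of_int (contract (poly_diff 0 A) R A (basis_words ! b))))"
    unfolding cocycle_value_eq D_def r_def by (simp add: algebra_simps sum.distrib sum_distrib_left)
  also have "\<dots> = 0"
    using eqs[of 3 2] less_3 unfolding C A'_def[symmetric] by (simp add: VD algebra_simps)
  finally have 0: "(\<Sum>b<23. y b * of_int (cocycle_value (0, R, A) (basis_words ! b))) = 0" .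
  have "(\<Sum>b<23. y b * of_int (cocycle_value (1, R, A) (basis_words ! b)))
      = r * (D 1 2 + (\<Sum>b<23. y b * of_int (contract (poly_diff 1 A) R A (basis_words ! b))))"
    unfolding cocycle_value_eq D_def r_def by (simp add: algebra_simps sum.distrib sum_distrib_left)
  also have "\<dots> = 0"
    using eqs[of 3 1] less_3 unfolding C A'_def[symmetric] by (simp add: VD algebra_simps)
  finally have 1: "(\<Sum>b<23. y b * of_int (cocycle_value (1, R, A) (basis_words ! b))) = 0" .
  \<comment> \<open>In the component at {1, 2} the derivative of \<open>a\<close> in direction 3 is
    1, so the derivative of \<open>\<rho>\<close> along \<open>Y\<close> stays; the sum is minus the
    component.\<close>
  have "(\<Sum>b<23. y b * of_int (cocycle_value (2, R, A) (basis_words ! b)))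
      = (\<Sum>b<23. y b * of_int (contract R R A (basis_words ! b)))
        + r * ((\<Sum>b<23. y b * of_int (contract (poly_diff 2 A) R A (basis_words ! b))) - D 0 0 - D 1 1)"
    unfolding cocycle_value_eq D_def r_def by (simp add: algebra_simps sum.distrib sum_distrib_left sum_subtractf)
  also have "\<dots> = 0"
    using eqs[of 1 2] less_3 unfolding C A'_def[symmetric] R'_def[symmetric] by (simp add: VD algebra_simps)
  finally have 2: "(\<Sum>b<23. y b * of_int (cocycle_value (2, R, A) (basis_words ! b))) = 0" .
  from k consider "k = 0" | "k = 1" | "k = 2" by linarith
  then show ?thesis using 0 1 2 by cases simp_all
qed

section \<open>The cohomology group\<close>

text \<open>The value \<open>undefined\<close> off the edges puts the map into the extensional
  function space required of a micro-graph.\<close>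

definition word_graph :: "bracket_word \<Rightarrow> micrograph" where
  "word_graph w = (\<lambda>(k, s). if k \<in> {1..length w} then
     (case w ! (k - 1) of (a, b, c) \<Rightarrow> if s = 1 then a else if s = 2 then b else c) else undefined)"

lemma mg_word_word_graph: "mg_word [1..<Suc 2] (word_graph [(a, b, c), (d, e, f)]) = [(a, b, c), (d, e, f)]"
  by (simp add: mg_word_def word_graph_def numeral_2_eq_2 neq_3)

text \<open>The assumption \<open>link\<close> gives weak connectivity: vertex 1 points to vertex 2
  or to its Casimir 4, and the edges from 1 to 3 and from 2 to 4 are always present.\<close>

lemma word_graph_nambu:
  assumes "{a, b, d, e} \<subseteq> {1, 2, 3, 4}" "a \<noteq> b" "a \<noteq> 3" "b \<noteq> 3" "d \<noteq> e" "d \<noteq> 4" "e \<noteq> 4"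
    and link: "a = 2 \<or> b = 2 \<or> a = 4 \<or> b = 4"
  shows "word_graph [(a, b, 3), (d, e, 4)] \<in> nambu_micrographs 2 False"
proof -
  define g where "g = word_graph [(a, b, 3), (d, e, 4)]"
  have I: "{1..2 :: nat} = {1, 2}" and J: "{1..2 * 2 :: nat} = {1, 2, 3, 4}" by auto
  have V: "mg_vertices 2 False = {1, 2, 3, 4}" unfolding mg_vertices_def J by simp
  have G: "g (1, 1) = a" "g (1, 2) = b" "g (1, 3) = 3" "g (2, 1) = d" "g (2, 2) = e" "g (2, 3) = 4"
    unfolding g_def word_graph_def by (simp_all add: neq_3)
  have "g \<in> mg_edges 2 \<rightarrow>\<^sub>E mg_vertices 2 False"
  proof (rule PiE_I)
    fix p :: "nat \<times> 3" assume "p \<in> mg_edges 2"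
    then obtain k s where p: "p = (k, s)" "k = 1 \<or> k = 2" unfolding mg_edges_def I by blast
    have "g (1, s) \<in> {1, 2, 3, 4}" "g (2, s) \<in> {1, 2, 3, 4}"
      using exhaust_3[of s] G assms(1) by (metis insertCI insert_subset)+
    then show "g p \<in> mg_vertices 2 False" unfolding V p(1) using p(2) by blast
  next
    fix p :: "nat \<times> 3" assume "p \<notin> mg_edges 2"
    then show "g p = undefined" by (cases p) (auto simp: g_def mg_edges_def word_graph_def)
  qed
  moreover have "\<forall>k\<in>{1..2}. inj (\<lambda>s. g (k, s)) \<and> (\<exists>s. g (k, s) = 2 + k)"
  proof -
    have "inj (\<lambda>s. g (1, s))" "inj (\<lambda>s. g (2, s))"
      unfolding inj_def forall_3 G using assms(2-7) by simp_all
    moreover have "\<exists>s. g (1, s) = 2 + 1" "\<exists>s. g (2, s) = 2 + 2"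
      using exI[of "\<lambda>s. g (1, s) = 2 + 1" 3] exI[of "\<lambda>s. g (2, s) = 2 + 2" 3] G(3,6) by simp_all
    ultimately show ?thesis unfolding I by blast
  qed
  moreover have "weakly_connected 2 False g"
  proof -
    define A where "A = (\<lambda>e. (fst e, g e)) ` mg_edges 2"
    define R where "R = A \<union> A\<inverse>"
    have "sym R" unfolding R_def by (rule sym_Un_converse)
    then have sym: "(v, u) \<in> R\<^sup>*" if "(u, v) \<in> R\<^sup>*" for u v
      using that by (meson sym_rtrancl symE)
    have edge: "(k, g (k, s)) \<in> R" if "k \<in> {1, 2}" for k s
    proof -
      have "(k, s) \<in> mg_edges 2" using that unfolding mg_edges_def I by blast
      then have "(fst (k, s), g (k, s)) \<in> A" unfolding A_def by (rule imageI)
      then show ?thesis by (simp add: R_def)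
    qed
    have e: "(1, a) \<in> R" "(1, b) \<in> R" "(1, 3) \<in> R" "(2, 4) \<in> R"
      using edge[of 1 1] edge[of 1 2] edge[of 1 3] edge[of 2 3] unfolding G by blast+
    have 12: "(1, 2) \<in> R\<^sup>*"
    proof (cases "a = 2 \<or> b = 2")
      case True
      then show ?thesis using e(1,2) by blast
    next
      case False
      then have "(1, 4) \<in> R" using link e(1,2) by blast
      moreover have "(4, 2) \<in> R\<^sup>*" using e(4) sym by blast
      ultimately show ?thesis by (rule converse_rtrancl_into_rtrancl)
    qed
    have one: "(1, v) \<in> R\<^sup>*" if "v \<in> {1, 2, 3, 4}" for v
    proof -
      have "(1, 1) \<in> R\<^sup>*" "(1, 3) \<in> R\<^sup>*" "(1, 4) \<in> R\<^sup>*"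
        using e(3) rtrancl.rtrancl_into_rtrancl[OF 12 e(4)] by blast+
      with 12 that show ?thesis by blast
    qed
    have "(u, v) \<in> R\<^sup>*" if "u \<in> {1, 2, 3, 4}" "v \<in> {1, 2, 3, 4}" for u v
      by (rule rtrancl_trans[OF sym[OF one[OF that(1)]] one[OF that(2)]])
    then show ?thesis
      unfolding weakly_connected_def V A_def[symmetric] Let_def R_def[symmetric] by blast
  qed
  ultimately show ?thesis unfolding g_def[symmetric] by (simp add: nambu_micrographs_def)
qed

definition hamiltonian_words :: "bracket_word list" where
  "hamiltonian_words = [[(1, 4, 3), (1, 3, 4)], [(1, 4, 3), (2, 3, 4)], [(1, 2, 3), (1, 3, 4)], [(1, 2, 3), (1, 2, 4)]]"

definition hamiltonian_graphs :: "micrograph list" where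
  "hamiltonian_graphs = map word_graph hamiltonian_words"

lemma hamiltonian_graphs:
  "set hamiltonian_graphs \<subseteq> nambu_micrographs 2 False"
  "map (mg_word [1..<Suc 2]) hamiltonian_graphs = hamiltonian_words"
  "distinct hamiltonian_graphs"
proof -
  show "set hamiltonian_graphs \<subseteq> nambu_micrographs 2 False"
    by (auto simp: hamiltonian_graphs_def hamiltonian_words_def intro!: word_graph_nambu)
  show m: "map (mg_word [1..<Suc 2]) hamiltonian_graphs = hamiltonian_words"
    unfolding hamiltonian_graphs_def hamiltonian_words_def by (simp only: list.map mg_word_word_graph)
  have "distinct hamiltonian_words" by (simp add: hamiltonian_words_def)
  then show "distinct hamiltonian_graphs" unfolding m[symmetric] by (rule distinct_map[THEN iffD1, THEN conjunct1])
qed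

definition coboundaries :: "(nat \<times> int) list list" where
  "coboundaries = map (\<lambda>w. concat (map (\<lambda>v. expansion ((0, v, 6) # shift_word w)) [1, 2, 4, 5])) hamiltonian_words"

lemma shifted_reducible:
  "list_all (\<lambda>w. list_all (\<lambda>v. reducible ((0, v, 6) # shift_word w)) [1, 2, 4, 5]) hamiltonian_words"
  by code_simp

text \<open>An index is repeated when several vertices \<open>v\<close> of the Hamiltonian
  contribute the same word; the sums over these lists collect the coefficients.\<close>

lemma coboundaries_eq: "coboundaries =
   [[(4, 2), (9, 2), (11, 2), (1, 1), (2, -1), (1, 1), (2, -1)],
    [(9, -2), (10, 2), (9, -2), (10, 2), (5, 1), (6, -1), (5, 1), (6, -1)],
    [(13, 1), (14, -1), (7, -1), (8, 1), (9, 2), (10, -1), (11, 1)],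
    [(15, 1), (15, 1), (14, -2), (14, -2)]]"
  by code_simp

lemma schouten_hamiltonian_graphs:
  assumes "smooth \<rho>" "smooth a"
  shows "schouten (nambu_bivector \<rho> a) (\<lambda>S x. \<Sum>j<4. h j * mg_eval 2 (hamiltonian_graphs ! j) \<rho> a S x) {i} x
      = (\<Sum>j<4. h j * (\<Sum>(b, n)\<leftarrow>coboundaries ! j. of_int n * bracket_op (basis_words ! b) (coordinate i) \<rho> a x))"
    and "(\<And>i. S \<noteq> {i}) \<Longrightarrow>
      schouten (nambu_bivector \<rho> a) (\<lambda>S x. \<Sum>j<4. h j * mg_eval 2 (hamiltonian_graphs ! j) \<rho> a S x) S x = 0"
proof -
  let ?G = "\<lambda>j. hamiltonian_graphs ! j" and ?w = "\<lambda>\<Gamma>. shift_word (mg_word [1..<Suc 2] \<Gamma>)"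
  have len: "length hamiltonian_graphs = 4" "length hamiltonian_words = 4"
    by (simp_all add: hamiltonian_graphs_def hamiltonian_words_def)
  have bij: "bij_betw ?G {..<4} (set hamiltonian_graphs)"
    using bij_betw_nth[OF hamiltonian_graphs(3)] len by simp
  \<comment> \<open>A span assigns coefficients to graphs, the matrix of coboundaries to positions.
    The four graphs are distinct, so the position can be recovered from the graph.\<close>
  define c where "c \<Gamma> = h (inv_into {..<4} ?G \<Gamma>)" for \<Gamma>
  have c: "c (?G j) = h j" if "j < 4" for j
    unfolding c_def using bij that by (simp add: bij_betw_def inv_into_f_f)
  have sum: "(\<Sum>\<Gamma>\<in>set hamiltonian_graphs. c \<Gamma> * f \<Gamma>) = (\<Sum>j<4. h j * f (?G j))" for f
    unfolding sum.reindex_bij_betw[OF bij, symmetric] by (intro sum.cong refl) (simp add: c)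
  have word: "mg_word [1..<Suc 2] (?G j) = hamiltonian_words ! j" if "j < 4" for j
    unfolding hamiltonian_graphs(2)[symmetric] using that len by (simp del: upt_Suc)
  have occ: "\<forall>w\<in>set hamiltonian_words. occ w 0 = 0 \<and> (\<forall>v\<in>{0, 3, 6}. occ (shift_word w) v = 0)"
    by (simp add: hamiltonian_words_def shift_word_def shift_letter_def)
  have G: "mg_word [1..<Suc 2] \<Gamma> \<in> set hamiltonian_words" if "\<Gamma> \<in> set hamiltonian_graphs" for \<Gamma>
    unfolding hamiltonian_graphs(2)[symmetric] using that by simp
  have occ0: "occ (mg_word [1..<Suc 2] \<Gamma>) 0 = 0" if "\<Gamma> \<in> set hamiltonian_graphs" for \<Gamma>
    using bspec[OF occ G[OF that]] by (rule conjunct1)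
  have occ': "occ (?w \<Gamma>) v = 0" if "\<Gamma> \<in> set hamiltonian_graphs" "v \<in> {0, 3, 6}" for \<Gamma> v
    using bspec[OF bspec[OF occ G[OF that(1)], THEN conjunct2] that(2)] .
  have H: "(\<lambda>S x. \<Sum>j<4. h j * mg_eval 2 (?G j) \<rho> a S x)
      = (\<lambda>S x. \<Sum>\<Gamma>\<in>set hamiltonian_graphs. c \<Gamma> * mg_eval 2 \<Gamma> \<rho> a S x)"
    by (intro ext) (rule sum[symmetric])
  note S1 = schouten_hamiltonian(1)[OF assms occ0 occ', where c = c]
    and S2 = schouten_hamiltonian(2)[OF assms occ0 occ', where c = c]
  show "schouten (nambu_bivector \<rho> a) (\<lambda>S x. \<Sum>j<4. h j * mg_eval 2 (?G j) \<rho> a S x) S x = 0" if "\<And>i. S \<noteq> {i}" for S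
    unfolding H by (rule S2) (assumption | rule that)+
  have W: "(\<Sum>v\<in>{1, 2, 4, 5}. bracket_op ((0, v, 6) # ?w (?G j)) (coordinate i) \<rho> a x)
      = (\<Sum>(b, n)\<leftarrow>coboundaries ! j. of_int n * bracket_op (basis_words ! b) (coordinate i) \<rho> a x)" if j: "j < 4" for j
  proof -
    have "\<forall>v\<in>set [1, 2, 4, 5]. reducible ((0, v, 6) # shift_word (hamiltonian_words ! j))"
      using bspec[OF shifted_reducible[unfolded list_all_iff] nth_mem[of j hamiltonian_words]] j len by simp
    then have red: "reducible ((0, v, 6) # shift_word (hamiltonian_words ! j))" if "v \<in> {1, 2, 4, 5}" for v
      using that by auto
    have "bracket_op ((0, v, 6) # shift_word (hamiltonian_words ! j)) (coordinate i) \<rho> a x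
        = (\<Sum>(b, n)\<leftarrow>expansion ((0, v, 6) # shift_word (hamiltonian_words ! j)).
            of_int n * bracket_op (basis_words ! b) (coordinate i) \<rho> a x)" if "v \<in> {1, 2, 4, 5}" for v
      by (rule bracket_functional.expansion[OF bracket_functional_bracket_op red[OF that]])
    then show ?thesis
      unfolding word[OF j] coboundaries_def using j len by simp
  qed
  show "schouten (nambu_bivector \<rho> a) (\<lambda>S x. \<Sum>j<4. h j * mg_eval 2 (?G j) \<rho> a S x) {i} x
      = (\<Sum>j<4. h j * (\<Sum>(b, n)\<leftarrow>coboundaries ! j. of_int n * bracket_op (basis_words ! b) (coordinate i) \<rho> a x))"
    unfolding H
  proof (subst S1)
    show "(\<Sum>\<Gamma>\<in>set hamiltonian_graphs. c \<Gamma> * (\<Sum>v\<in>{1, 2, 4, 5}. bracket_op ((0, v, 6) # ?w \<Gamma>) (coordinate i) \<rho> a x))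
      = (\<Sum>j<4. h j * (\<Sum>(b, n)\<leftarrow>coboundaries ! j. of_int n * bracket_op (basis_words ! b) (coordinate i) \<rho> a x))"
      unfolding sum by (intro sum.cong refl arg_cong2[where f = "(*)"] W) simp
  qed assumption+
qed

text \<open>The rows verified in \<open>tests_check\<close> replace the evaluated values, which
  leaves short equations suited to linear arithmetic.\<close>

lemma cocycle_relations:
  fixes y :: "nat \<Rightarrow> real"
  assumes "\<And>k R A v. ((k, R, A), v) \<in> set tests \<Longrightarrow>
    (\<Sum>b<23. y b * of_int (cocycle_value (k, R, A) (basis_words ! b))) = 0"
  shows "list_all (\<lambda>(t, v). (\<Sum>(j, n)\<leftarrow>v. of_int n * y j) = 0) tests"
proof -
  have "(\<Sum>(j, n)\<leftarrow>v. of_int n * y j) = 0" if t: "((k, R, A), v) \<in> set tests" for k R A v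
  proof -
    have "list_all (\<lambda>(t, v). list_all (\<lambda>p. fst p < 23) v) tests"
      by (simp add: tests_def)
    then have bound: "fst p < 23" if "p \<in> set v" for p
      using t that by (auto simp: list_all_iff)
    have "map (cocycle_value (k, R, A)) basis_words = map (coord v) [0..<23]"
      using tests_check t by (auto simp: list_all_iff)
    moreover have "length basis_words = 23" by (simp add: basis_words_def)
    ultimately have "cocycle_value (k, R, A) (basis_words ! b) = coord v b" if "b < 23" for b
      using that by (metis add_0 diff_zero length_upt nth_map nth_upt)
    then have "(\<Sum>b<23. of_int (coord v b) * y b) = 0"
      using assms[OF t] by (simp add: mult.commute)
    then show ?thesis using sum_coord[of v 23 y] bound by simp
  qed
  then show ?thesis by (auto simp: list_all_iff)
qed

theorem theorem12:
  shows "\<forall>Y\<in>V3D. generic_eq (d_P Y) (\<lambda>\<rho> a S x. 0) \<longrightarrow> (\<exists>H\<in>H3D. generic_eq Y (d_P H))"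
proof (intro ballI impI)
  fix Y assume "Y \<in> V3D" and closed: "generic_eq (d_P Y) (\<lambda>\<rho> a S x. 0)"
  then obtain F c where F: "finite F" "F \<subseteq> nambu_micrographs 3 True"
    and Y: "Y = (\<lambda>\<rho> a S x. \<Sum>\<Gamma>\<in>F. c \<Gamma> * mg_eval 3 \<Gamma> \<rho> a S x)"
    unfolding V3D_def mg_span_def by blast
  let ?w = "mg_word [1..<Suc 3]"
  have "\<forall>\<Gamma>\<in>F. \<exists>v :: nat \<Rightarrow> real. \<forall>F. bracket_functional F \<longrightarrow> F (?w \<Gamma>) = (\<Sum>j<23. v j * F (basis_words ! j))"
    using nambu_micrograph_word(1) F(2) unfolding reduces_def by blast
  then obtain v :: "micrograph \<Rightarrow> nat \<Rightarrow> real" where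
    v: "\<And>\<Gamma> f. \<Gamma> \<in> F \<Longrightarrow> bracket_functional f \<Longrightarrow> f (?w \<Gamma>) = (\<Sum>j<23. v \<Gamma> j * f (basis_words ! j))"
    by (auto dest!: bchoice)
  \<comment> \<open>These coordinates depend only on the coefficients of \<open>Y\<close>, so
    equations found with polynomial \<open>\<rho>\<close> and \<open>a\<close> apply to all smooth
    arguments.\<close>
  define y where "y j = (\<Sum>\<Gamma>\<in>F. c \<Gamma> * v \<Gamma> j)" for j
  have Y1: "Y \<rho> a {i} x = (\<Sum>j<23. y j * bracket_op (basis_words ! j) (coordinate i) \<rho> a x)"
    if "smooth \<rho>" "smooth a" for \<rho> a i x
  proof -
    have "Y \<rho> a {i} x = (\<Sum>\<Gamma>\<in>F. c \<Gamma> * bracket_op (?w \<Gamma>) (coordinate i) \<rho> a x)"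
      unfolding Y using nambu_micrograph_word(2) F(2) that
      by (intro sum.cong refl arg_cong2[where f = "(*)"] mg_eval_sink(1)) auto
    also have "\<dots> = (\<Sum>\<Gamma>\<in>F. \<Sum>j<23. c \<Gamma> * v \<Gamma> j * bracket_op (basis_words ! j) (coordinate i) \<rho> a x)"
      by (intro sum.cong refl) (simp only: v[OF _ bracket_functional_bracket_op] sum_distrib_left mult.assoc)
    also have "\<dots> = (\<Sum>j<23. y j * bracket_op (basis_words ! j) (coordinate i) \<rho> a x)"
      unfolding y_def sum_distrib_right by (rule sum.swap)
    finally show ?thesis .
  qed
  have Y0: "Y \<rho> a S x = 0" if "smooth \<rho>" "smooth a" "\<And>k. S \<noteq> {k}" for \<rho> a S x
    unfolding Y
  proof (rule sum.neutral, rule ballI)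
    fix \<Gamma> assume "\<Gamma> \<in> F"
    then have "occ (?w \<Gamma>) 0 = 1" using nambu_micrograph_word(2) F(2) by blast
    from mg_eval_sink(2)[OF that(1,2) this that(3)] show "c \<Gamma> * mg_eval 3 \<Gamma> \<rho> a S x = 0" by simp
  qed
  have d: "schouten (nambu_bivector \<rho> a) (Y \<rho> a) S x = 0" if "smooth \<rho>" "smooth a" for \<rho> a S x
  proof -
    have "d_P Y \<rho> a = (\<lambda>S x. 0)" using closed that unfolding generic_eq_def by blast
    then show ?thesis unfolding d_P_def by (metis (full_types))
  qed
  have "list_all (\<lambda>(t, v). (\<Sum>(j, n)\<leftarrow>v. of_int n * y j) = 0) tests"
  proof (rule cocycle_relations)
    fix k R A v assume "((k, R, A), v) \<in> set tests"
    then have t: "k < 3" "const_coeff (diff1 A) = 0" "const_coeff (diff2 A) = 0" "const_coeff (diff3 A) = 1"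
      using tests_check by (auto simp: list_all_iff)
    show "(\<Sum>b<23. y b * of_int (cocycle_value (k, R, A) (basis_words ! b))) = 0"
    proof (rule cocycle_value[where Y = "Y (poly_fun R) (poly_fun A)"])
      show "Y (poly_fun R) (poly_fun A) {i} x = (\<Sum>b<23. y b *
          bracket_op (basis_words ! b) (coordinate i) (poly_fun R) (poly_fun A) x)" for i x
        by (intro Y1 smooth_poly_fun)
      show "Y (poly_fun R) (poly_fun A) S x = 0" if "\<And>k. S \<noteq> {k}" for S x
        by (intro Y0 smooth_poly_fun that)
      show "schouten (nambu_bivector (poly_fun R) (poly_fun A)) (Y (poly_fun R) (poly_fun A)) S x = 0" for S x
        by (intro d smooth_poly_fun)
    qed (use t in auto)
  qed
  note rel = this[unfolded tests_def, simplified]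
  \<comment> \<open>The common value, up to sign, that the equations force on \<open>y 7\<close>,
    \<open>y 8\<close> and \<open>y 13\<close>.\<close>
  define s where "s = y 14 + 2 * y 15"
  \<comment> \<open>Read off from \<open>coboundaries\<close>: word 7 occurs only in the third one,
    with coefficient -1, and word 15 only in the fourth, with total 2. Words 11 and 10 then
    determine \<open>h 0\<close> and \<open>h 1\<close>.\<close>
  define h :: "nat \<Rightarrow> real" where "h j = [(y 11 + s) / 2, (y 10 - s) / 4, - s, y 15 / 2] ! j" for j
  have combine: "(\<Sum>j<23. y j * f j) = (\<Sum>j<4. h j * (\<Sum>(b, n)\<leftarrow>coboundaries ! j. of_int n * f b))" for f :: "nat \<Rightarrow> real"
  proof -
    \<comment> \<open>The 19 equations leave \<open>y 10\<close>, \<open>y 11\<close>,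
      \<open>y 14\<close> and \<open>y 15\<close> free, the last two entering through
      \<open>s\<close> and \<open>y 15\<close>; all other coordinates are expressed by
      these.\<close>
    have y: "y 0 = 0" "y 3 = 0" "y 12 = 0" "y 16 = 0" "y 17 = 0" "y 18 = 0" "y 19 = 0" "y 20 = 0" "y 21 = 0" "y 22 = 0"
      "y 7 = s" "y 8 = - s" "y 13 = - s" "y 14 = s - 2 * y 15" "y 4 = y 11 + s"
      "y 2 = - (y 11 + s)" "y 1 = y 11 + s" "y 9 = y 11 - y 10"
      using rel unfolding s_def One_nat_def by linarith+
    have "y 6 = - y 5" "y 6 + y 8 + y 11 - y 9 - y 5 - y 2 - y 1 = 0"
      using rel unfolding One_nat_def by linarith+
    then have y56: "y 5 = (y 10 - s) / 2" "y 6 = - (y 10 - s) / 2"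
      using y by simp_all
    show ?thesis
      unfolding coboundaries_eq h_def
      by (simp add: lessThan_nat_numeral lessThan_Suc y[unfolded One_nat_def] y56 numeral_2_eq_2[symmetric] field_simps)
  qed
  define H :: mv_operator where "H = (\<lambda>\<rho> a S x. \<Sum>j<4. h j * mg_eval 2 (hamiltonian_graphs ! j) \<rho> a S x)"
  have "generic_eq Y (d_P H)"
    unfolding generic_eq_def
  proof (intro allI impI ext)
    fix \<rho> a S x assume sm: "smooth \<rho>" "smooth a"
    show "Y \<rho> a S x = d_P H \<rho> a S x"
    proof (cases "\<exists>i. S = {i}")
      case True
      then obtain i where S: "S = {i}" by blast
      show ?thesis
        unfolding S d_P_def H_def Y1[OF sm] schouten_hamiltonian_graphs(1)[OF sm] by (rule combine)
    next
      case False
      then have S: "S \<noteq> {i}" for i by blast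
      show ?thesis
        unfolding d_P_def H_def Y0[OF sm S] schouten_hamiltonian_graphs(2)[OF sm S] ..
    qed
  qed
  moreover have "H \<in> H3D"
  proof -
    have bij: "bij_betw (\<lambda>j. hamiltonian_graphs ! j) {..<4} (set hamiltonian_graphs)"
      using bij_betw_nth[OF hamiltonian_graphs(3), of "{..<4}"]
      by (simp add: hamiltonian_graphs_def hamiltonian_words_def)
    define c where "c \<Gamma> = h (inv_into {..<4} (\<lambda>j. hamiltonian_graphs ! j) \<Gamma>)" for \<Gamma>
    have "c (hamiltonian_graphs ! j) = h j" if "j < 4" for j
      unfolding c_def using bij that by (simp add: bij_betw_def inv_into_f_f)
    then have "H = (\<lambda>\<rho> a S x. \<Sum>\<Gamma>\<in>set hamiltonian_graphs. c \<Gamma> * mg_eval 2 \<Gamma> \<rho> a S x)"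
      unfolding H_def sum.reindex_bij_betw[OF bij, symmetric] by simp
    then show ?thesis
      unfolding H3D_def mg_span_def using hamiltonian_graphs(1) by blast
  qed
  ultimately show "\<exists>H\<in>H3D. generic_eq Y (d_P H)" by blast
qed

end
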